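(* Let $\mathbb{B}$ be a quadratic associative division algebra over a field $\mathbb{K}$ with $\dim_{\mathbb{K}}(\mathbb{B})=d$, put $v=d-1$, and let $(X,\Xi)=\mathcal{V}_2(\mathbb{K},\mathsf{CD}(\mathbb{B},0))$. Then $X$ spans a projective space $\mathbb{P}=\mathsf{PG}(6d+2,\mathbb{K})$, each vertex of a quadric in a member of $\Xi$ has dimension $d-1$, the vertices form a regular spread $\mathcal{S}$ of a $(3v+2)$-space $Y$ in $\mathbb{P}$, and there exists a subspace $F$ of $\mathbb{P}$ complementary to $Y$ such that $(X',\Xi'):=(X\cap F,\{\xi\cap F\mid\xi\in\Xi\})$ is projectively equivalent to $\mathcal{V}_2(\mathbb{K},\mathbb{B})$. Moreover, if $\mathcal{B}$ is the set of $(2v+1)$-spaces each spanned by two distinct vertices, then $(\mathcal{S},\mathcal{B})$, with natural incidence, is a projective plane isomorphic to $\mathsf{PG}(2,\mathbb{B})$, and there is a linear duality $\chi$ between $(X',\Xi')$ and $(\mathcal{S},\mathcal{B})$ such that $X$ is the union of the sets $\langle x',\chi(x')\rangle\setminus\chi(x')$, for $x'$ ranging over $X'$.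
   Context: All dimensions are projective dimensions. **Algebras.** A quadratic associative division algebra $\mathbb{B}$ over $\mathbb{K}$ is a unital associative $\mathbb{K}$-algebra (containing $\mathbb{K}$) in which each $a$ satisfies $a^2-\mathsf{T}(a)a+\mathsf{N}(a)=0$ with $\mathsf{T}:\mathbb{B}\to\mathbb{K}$ linear, $\mathsf{T}(1)=2$, $\mathsf{N}:\mathbb{B}\to\mathbb{K}$ an anisotropic quadratic form, $\mathsf{N}(1)=1$. Put $\overline{a}=\mathsf{T}(a)-a$. $\mathsf{CD}(\mathbb{B},0)$ is $\mathbb{B}\times\mathbb{B}$ with componentwise addition and $(a,b)(c,e)=(ac,\overline{a}e+cb)$, with involution $\overline{(a,b)}=(\overline{a},-b)$; write $(a,b)=a+tb$ with $t=(0,1)$, $t^2=0$. **Veronese representations.** Let $\mathbb{A}$ be $\mathsf{CD}(\mathbb{B},0)$, or $\mathbb{B}$ (in which case put $t=0$). $\mathsf{G}(2,\mathbb{A})=(\mathcal{P},\mathcal{L})$ has point set $\mathcal{P}=\{(x,y,1)\mid x,y\in\mathbb{A}\}\cup\{(1,y,tz_1)\mid y\in\mathbb{A},z_1\in\mathbb{B}\}\cup\{(tx_1,1,tz_1)\mid x_1,z_1\in\mathbb{B}\}$, line set $\mathcal{L}=\{[a,1,c]\mid a,c\in\mathbb{A}\}\cup\{[1,tb_1,c]\mid b_1\in\mathbb{B},c\in\mathbb{A}\}\cup\{[ta_1,tb_1,1]\mid a_1,b_1\in\mathbb{B}\}$, and $(x,y,z)$ is incident with $[a,b,c]$ iff $ax+by+cz=0$.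 With $\rho:(x,y,z)\mapsto\mathbb{K}(x\overline{x},y\overline{y},z\overline{z};y\overline{z},z\overline{x},x\overline{y})$, a point of the projective space of $\mathbb{K}^3\oplus\mathbb{A}^3$, $\mathcal{V}_2(\mathbb{K},\mathbb{A})=(X,\Xi)$ with $X=\{\rho(p)\mid p\in\mathcal{P}\}$ and $\Xi=\{\langle\rho(L)\rangle\mid L\in\mathcal{L}\}$, where $\rho(L)=\{\rho(p)\mid p\text{ incident with }L\}$. When $\mathbb{A}=\mathsf{CD}(\mathbb{B},0)$, for each $\xi\in\Xi$ the set $X\cap\xi$ is a singular quadric (a cone over a quadric of Witt index 1) with its vertex removed; "the vertex" refers to that removed subspace. **Regular spreads.** A spread of $v$-spaces of a projective space is a partition of its point set into $v$-spaces. Three pairwise disjoint $v$-spaces in a $(2v+1)$-space determine a regulus: the set of $v$-spaces meeting every line (transversal) that meets the three given ones. A spread of $v$-spaces of a $(2v+1)$-space is regular if it contains the regulus determined by any three of its members; a spread of $v$-spaces of a $(3v+2)$-space is regular if for any two of its members $V_1,V_2$, the members meeting $\langle V_1,V_2\rangle$ lie in it and form a regular spread of it. **Linear duality.** Regarding $X'$ as points and $\Xi'$ as lines, a duality $\chi$ is a bijection $X'\to\mathcal{B}$ together with a bijection $\Xi'\to\mathcal{S}$ such that $x'\in\xi'$ iff $\chi(\xi')\subseteq\chi(x')$. It is linear if it preserves cross-ratio: for each $\xi'\in\Xi'$ with $V=\chi(\xi')$, the induced map from the quadric $X'\cap\xi'$ to the regular spread of $v$-spaces obtained by projecting the members of $\mathcal{B}$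 through $V$ from $V$ takes conics to reguli and its restriction to each conic preserves the cross-ratio. Projectively equivalent means related by a linear isomorphism of the ambient projective spaces.
   Formalization: Ξ' is taken to be only those ξ∩F for which ξ contains at least two points of X' = X∩F; with all ξ in Ξ the claim fails, since many ξ share a vertex and at most one of these meets F in a (d+1)-space. *)

theory Defs
  imports "HOL-Analysis.Product_Vector"
begin

section \<open>Projective spaces over a field\<close>

text \<open>
  A projective space is given by a vector space with scalar multiplication \<open>s\<close> over an arbitrary
  field. Projective subspaces are linear subspaces, incidence is inclusion, and a projective point
  is a one-dimensional linear subspace; in particular, an \<open>n\<close>-space has linear dimension \<open>n + 1\<close>.
\<close>

definition has_dimension :: "('k::field \<Rightarrow> 'v::ab_group_add \<Rightarrow> 'v) \<Rightarrow> nat \<Rightarrow> 'v set \<Rightarrow> bool" where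
  "has_dimension s n U \<longleftrightarrow>
     (\<exists>E. finite E \<and> card E = n \<and> \<not> module.dependent s E \<and> module.span s E = U)"

definition n_space :: "('k::field \<Rightarrow> 'v::ab_group_add \<Rightarrow> 'v) \<Rightarrow> nat \<Rightarrow> 'v set \<Rightarrow> bool" where
  "n_space s n U \<longleftrightarrow> has_dimension s (n + 1) U"

definition points :: "('k::field \<Rightarrow> 'v::ab_group_add \<Rightarrow> 'v) \<Rightarrow> 'v set \<Rightarrow> 'v set set" where
  "points s U = {module.span s {u} | u. u \<in> U \<and> u \<noteq> 0}"

definition meets :: "'v::zero set \<Rightarrow> 'v set \<Rightarrow> bool" where
  "meets U W \<longleftrightarrow> U \<inter> W \<noteq> {0}"

definition complement_in ::
  "('k::field \<Rightarrow> 'v::ab_group_add \<Rightarrow> 'v) \<Rightarrow> 'v set \<Rightarrow> 'v set \<Rightarrow> 'v set \<Rightarrow> bool" where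
  "complement_in s U V W \<longleftrightarrow>
     module.subspace s V \<and> module.subspace s W \<and> V \<inter> W = {0} \<and> module.span s (V \<union> W) = U"

text \<open>
  The cross-ratio of four points on a line, normalised by \<open>(\<infinity>, 0; 1, r) = r\<close>, where the parameter
  \<open>z\<close> stands for the point \<open>\<langle>z a + b\<rangle>\<close>. It is only used for pairwise distinct points.
\<close>

definition cross_ratio ::
  "('k::field \<Rightarrow> 'v::ab_group_add \<Rightarrow> 'v) \<Rightarrow> 'v set \<Rightarrow> 'v set \<Rightarrow> 'v set \<Rightarrow> 'v set \<Rightarrow> 'k \<Rightarrow> bool" where
  "cross_ratio s p\<^sub>1 p\<^sub>2 p\<^sub>3 p\<^sub>4 r \<longleftrightarrow>
     (\<exists>a b. a \<noteq> 0 \<and> b \<noteq> 0 \<and> module.span s {a} \<noteq> module.span s {b} \<and>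
        p\<^sub>1 = module.span s {a} \<and> p\<^sub>2 = module.span s {b} \<and>
        p\<^sub>3 = module.span s {a + b} \<and> p\<^sub>4 = module.span s {s r a + b})"

definition projectively_equivalent ::
  "('k::field \<Rightarrow> 'v::ab_group_add \<Rightarrow> 'v) \<Rightarrow> 'v set \<Rightarrow> 'v set set \<times> 'v set set \<Rightarrow>
   ('k \<Rightarrow> 'w::ab_group_add \<Rightarrow> 'w) \<Rightarrow> 'w set \<Rightarrow> 'w set set \<times> 'w set set \<Rightarrow> bool" where
  "projectively_equivalent s U G s' U' G' \<longleftrightarrow>
     (\<exists>f. Vector_Spaces.linear s s' f \<and> bij_betw f U U' \<and>
          (`) f ` fst G = fst G' \<and> (`) f ` snd G = snd G')"


section \<open>Quadrics\<close>

definition polar_form :: "('v::ab_group_add \<Rightarrow> 'k::field) \<Rightarrow> 'v \<Rightarrow> 'v \<Rightarrow> 'k" where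
  "polar_form q u w = q (u + w) - q u - q w"

definition quadratic_form_on ::
  "('k::field \<Rightarrow> 'v::ab_group_add \<Rightarrow> 'v) \<Rightarrow> 'v set \<Rightarrow> ('v \<Rightarrow> 'k) \<Rightarrow> bool" where
  "quadratic_form_on s W q \<longleftrightarrow>
     (\<forall>k. \<forall>w\<in>W. q (s k w) = k\<^sup>2 * q w) \<and>
     (\<forall>u\<in>W. \<forall>v\<in>W. \<forall>w\<in>W. polar_form q (u + v) w = polar_form q u w + polar_form q v w) \<and>
     (\<forall>k. \<forall>u\<in>W. \<forall>w\<in>W. polar_form q (s k u) w = k * polar_form q u w)"

text \<open>In characteristic 2 the polar form itself may be degenerate (e.g. for a conic).\<close>

definition nondegenerate_on :: "'v::ab_group_add set \<Rightarrow> ('v \<Rightarrow> 'k::field) \<Rightarrow> bool" where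
  "nondegenerate_on W q \<longleftrightarrow>
     (\<forall>w\<in>W. q w = 0 \<and> (\<forall>u\<in>W. polar_form q w u = 0) \<longrightarrow> w = 0)"

definition witt_index ::
  "('k::field \<Rightarrow> 'v::ab_group_add \<Rightarrow> 'v) \<Rightarrow> 'v set \<Rightarrow> ('v \<Rightarrow> 'k) \<Rightarrow> nat \<Rightarrow> bool" where
  "witt_index s W q n \<longleftrightarrow>
     (\<exists>U \<subseteq> W. has_dimension s n U \<and> (\<forall>u\<in>U. q u = 0)) \<and>
     (\<forall>U m. U \<subseteq> W \<and> has_dimension s m U \<and> (\<forall>u\<in>U. q u = 0) \<longrightarrow> m \<le> n)"

definition quadric ::
  "('k::field \<Rightarrow> 'v::ab_group_add \<Rightarrow> 'v) \<Rightarrow> 'v set \<Rightarrow> ('v \<Rightarrow> 'k) \<Rightarrow> 'v set set" where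
  "quadric s W q = {module.span s {w} | w. w \<in> W \<and> w \<noteq> 0 \<and> q w = 0}"

definition cone ::
  "('k::field \<Rightarrow> 'v::ab_group_add \<Rightarrow> 'v) \<Rightarrow> 'v set \<Rightarrow> 'v set set \<Rightarrow> 'v set set" where
  "cone s V Q = (\<Union>p\<in>Q. points s (module.span s (V \<union> p)))"

text \<open>
  \<open>V\<close> is the vertex of the quadric belonging to \<open>\<xi>\<close>: the points of \<open>X\<close> in \<open>\<xi>\<close> form a cone with
  vertex \<open>V\<close> over a quadric of Witt index 1, with the vertex itself removed.
\<close>

definition is_vertex ::
  "('k::field \<Rightarrow> 'v::ab_group_add \<Rightarrow> 'v) \<Rightarrow> 'v set set \<Rightarrow> 'v set \<Rightarrow> 'v set \<Rightarrow> bool" where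
  "is_vertex s X \<xi> V \<longleftrightarrow>
     (\<exists>W q. complement_in s \<xi> V W \<and>
        quadratic_form_on s W q \<and> nondegenerate_on W q \<and> witt_index s W q 1 \<and>
        X \<inter> points s \<xi> = cone s V (quadric s W q) - points s V)"

definition is_conic ::
  "('k::field \<Rightarrow> 'v::ab_group_add \<Rightarrow> 'v) \<Rightarrow> 'v set \<Rightarrow> 'v set set \<Rightarrow> bool" where
  "is_conic s E C \<longleftrightarrow> n_space s 2 E \<and> C \<noteq> {} \<and>
     (\<exists>q. quadratic_form_on s E q \<and> nondegenerate_on E q \<and> C = quadric s E q)"

definition conics_of ::
  "('k::field \<Rightarrow> 'v::ab_group_add \<Rightarrow> 'v) \<Rightarrow> 'v set \<Rightarrow> 'v set set \<Rightarrow> 'v set set set" where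
  "conics_of s \<xi> Q = {C. \<exists>E \<subseteq> \<xi>. is_conic s E C \<and> C = Q \<inter> points s E}"

text \<open>
  The cross-ratio on a conic is that of the parameters in a parametrisation
  \<open>(a, b) \<mapsto> a\<^sup>2 e\<^sub>1 + a b e\<^sub>2 + b\<^sup>2 e\<^sub>3\<close> of the conic by a projective line. It does not depend on the
  parametrisation, and agrees with the cross-ratio of the lines projecting the four points from
  a point of the conic.
\<close>

definition conic_cross_ratio ::
  "('k::field \<Rightarrow> 'v::ab_group_add \<Rightarrow> 'v) \<Rightarrow> 'v set set \<Rightarrow>
   'v set \<Rightarrow> 'v set \<Rightarrow> 'v set \<Rightarrow> 'v set \<Rightarrow> 'k \<Rightarrow> bool" where
  "conic_cross_ratio s C p\<^sub>1 p\<^sub>2 p\<^sub>3 p\<^sub>4 r \<longleftrightarrow>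
     (\<exists>e\<^sub>1 e\<^sub>2 e\<^sub>3. card {e\<^sub>1, e\<^sub>2, e\<^sub>3} = 3 \<and> \<not> module.dependent s {e\<^sub>1, e\<^sub>2, e\<^sub>3} \<and>
       (let \<nu> = (\<lambda>u :: 'k \<times> 'k. module.span s
                  {s ((fst u)\<^sup>2) e\<^sub>1 + s (fst u * snd u) e\<^sub>2 + s ((snd u)\<^sup>2) e\<^sub>3});
            s\<^sub>2 = module_prod.scale (*) (*)
        in C = \<nu> ` (UNIV - {0}) \<and>
           (\<exists>u\<^sub>1 u\<^sub>2 u\<^sub>3 u\<^sub>4. u\<^sub>1 \<noteq> 0 \<and> u\<^sub>2 \<noteq> 0 \<and> u\<^sub>3 \<noteq> 0 \<and> u\<^sub>4 \<noteq> 0 \<and>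
              p\<^sub>1 = \<nu> u\<^sub>1 \<and> p\<^sub>2 = \<nu> u\<^sub>2 \<and> p\<^sub>3 = \<nu> u\<^sub>3 \<and> p\<^sub>4 = \<nu> u\<^sub>4 \<and>
              cross_ratio s\<^sub>2 (module.span s\<^sub>2 {u\<^sub>1}) (module.span s\<^sub>2 {u\<^sub>2})
                             (module.span s\<^sub>2 {u\<^sub>3}) (module.span s\<^sub>2 {u\<^sub>4}) r)))"


section \<open>Regular spreads\<close>

definition transversal ::
  "('k::field \<Rightarrow> 'v::ab_group_add \<Rightarrow> 'v) \<Rightarrow> 'v set set \<Rightarrow> 'v set \<Rightarrow> bool" where
  "transversal s M l \<longleftrightarrow> n_space s 1 l \<and> (\<forall>V\<in>M. meets l V)"

definition regulus ::
  "('k::field \<Rightarrow> 'v::ab_group_add \<Rightarrow> 'v) \<Rightarrow> nat \<Rightarrow> 'v set \<Rightarrow> 'v set \<Rightarrow> 'v set \<Rightarrow> 'v set \<Rightarrow> 'v set set" where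
  "regulus s v Z V\<^sub>1 V\<^sub>2 V\<^sub>3 =
     {U. n_space s v U \<and> U \<subseteq> Z \<and> (\<forall>l \<subseteq> Z. transversal s {V\<^sub>1, V\<^sub>2, V\<^sub>3} l \<longrightarrow> meets l U)}"

definition is_regulus ::
  "('k::field \<Rightarrow> 'v::ab_group_add \<Rightarrow> 'v) \<Rightarrow> nat \<Rightarrow> 'v set \<Rightarrow> 'v set set \<Rightarrow> bool" where
  "is_regulus s v Z R \<longleftrightarrow> n_space s (2 * v + 1) Z \<and>
     (\<exists>V\<^sub>1 V\<^sub>2 V\<^sub>3. (\<forall>V\<in>{V\<^sub>1, V\<^sub>2, V\<^sub>3}. n_space s v V \<and> V \<subseteq> Z) \<and>
        \<not> meets V\<^sub>1 V\<^sub>2 \<and> \<not> meets V\<^sub>1 V\<^sub>3 \<and> \<not> meets V\<^sub>2 V\<^sub>3 \<and> R = regulus s v Z V\<^sub>1 V\<^sub>2 V\<^sub>3)"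

text \<open>The cross-ratio on a regulus is that of the points of intersection with a transversal.\<close>

definition regulus_cross_ratio ::
  "('k::field \<Rightarrow> 'v::ab_group_add \<Rightarrow> 'v) \<Rightarrow> 'v set \<Rightarrow> 'v set \<Rightarrow> 'v set \<Rightarrow> 'v set \<Rightarrow> 'k \<Rightarrow> bool" where
  "regulus_cross_ratio s V\<^sub>1 V\<^sub>2 V\<^sub>3 V\<^sub>4 r \<longleftrightarrow>
     (\<exists>l. transversal s {V\<^sub>1, V\<^sub>2, V\<^sub>3, V\<^sub>4} l \<and>
          cross_ratio s (l \<inter> V\<^sub>1) (l \<inter> V\<^sub>2) (l \<inter> V\<^sub>3) (l \<inter> V\<^sub>4) r)"

definition is_spread ::
  "('k::field \<Rightarrow> 'v::ab_group_add \<Rightarrow> 'v) \<Rightarrow> nat \<Rightarrow> 'v set \<Rightarrow> 'v set set \<Rightarrow> bool" where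
  "is_spread s v Z S \<longleftrightarrow>
     (\<forall>V\<in>S. n_space s v V \<and> V \<subseteq> Z) \<and> (\<forall>p\<in>points s Z. \<exists>!V. V \<in> S \<and> p \<subseteq> V)"

text \<open>Regular spreads of \<open>v\<close>-spaces of a \<open>(2v+1)\<close>-space and of a \<open>(3v+2)\<close>-space, respectively.\<close>

definition regular_spread_line ::
  "('k::field \<Rightarrow> 'v::ab_group_add \<Rightarrow> 'v) \<Rightarrow> nat \<Rightarrow> 'v set \<Rightarrow> 'v set set \<Rightarrow> bool" where
  "regular_spread_line s v Z S \<longleftrightarrow> n_space s (2 * v + 1) Z \<and> is_spread s v Z S \<and>
     (\<forall>V\<^sub>1\<in>S. \<forall>V\<^sub>2\<in>S. \<forall>V\<^sub>3\<in>S. V\<^sub>1 \<noteq> V\<^sub>2 \<and> V\<^sub>1 \<noteq> V\<^sub>3 \<and> V\<^sub>2 \<noteq> V\<^sub>3 \<longrightarrow> regulus s v Z V\<^sub>1 V\<^sub>2 V\<^sub>3 \<subseteq> S)"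

definition regular_spread_plane ::
  "('k::field \<Rightarrow> 'v::ab_group_add \<Rightarrow> 'v) \<Rightarrow> nat \<Rightarrow> 'v set \<Rightarrow> 'v set set \<Rightarrow> bool" where
  "regular_spread_plane s v Y S \<longleftrightarrow> n_space s (3 * v + 2) Y \<and> is_spread s v Y S \<and>
     (\<forall>V\<^sub>1\<in>S. \<forall>V\<^sub>2\<in>S. V\<^sub>1 \<noteq> V\<^sub>2 \<longrightarrow>
        (let Z = module.span s (V\<^sub>1 \<union> V\<^sub>2); M = {V \<in> S. meets V Z}
         in (\<forall>V\<in>M. V \<subseteq> Z) \<and> regular_spread_line s v Z M))"


section \<open>Projective planes and linear dualities\<close>

text \<open>
  A point-line geometry whose points and lines are both given by sets, with inclusion as incidence.
\<close>

definition projective_plane :: "'v set set \<Rightarrow> 'v set set \<Rightarrow> bool" where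
  "projective_plane P L \<longleftrightarrow>
     (\<forall>p\<in>P. \<forall>q\<in>P. p \<noteq> q \<longrightarrow> (\<exists>!l. l \<in> L \<and> p \<subseteq> l \<and> q \<subseteq> l)) \<and>
     (\<forall>l\<in>L. \<forall>m\<in>L. l \<noteq> m \<longrightarrow> (\<exists>!p. p \<in> P \<and> p \<subseteq> l \<and> p \<subseteq> m)) \<and>
     (\<exists>M \<subseteq> P. card M = 4 \<and> (\<forall>l\<in>L. \<forall>N \<subseteq> M. card N = 3 \<longrightarrow> \<not> (\<forall>p\<in>N. p \<subseteq> l)))"

definition isomorphic_geometries ::
  "'v set set \<Rightarrow> 'v set set \<Rightarrow> 'w set set \<Rightarrow> 'w set set \<Rightarrow> bool" where
  "isomorphic_geometries P L P' L' \<longleftrightarrow>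
     (\<exists>\<phi> \<psi>. bij_betw \<phi> P P' \<and> bij_betw \<psi> L L' \<and> (\<forall>p\<in>P. \<forall>l\<in>L. p \<subseteq> l \<longleftrightarrow> \<phi> p \<subseteq> \<psi> l))"

text \<open>
  The plane \<open>PG(2, \<bbbB>)\<close> over a possibly noncommutative division ring: the one- and two-dimensional
  subspaces of the right vector space \<open>\<bbbB>\<^sup>3\<close>. The involution of a quadratic division algebra
  identifies it with the plane obtained from the left vector space.
\<close>

definition pg2_points :: "('b::ring_1 \<times> 'b \<times> 'b) set set" where
  "pg2_points = {range (\<lambda>c. (x * c, y * c, z * c)) | x y z. (x, y, z) \<noteq> 0}"

definition pg2_lines :: "('b::ring_1 \<times> 'b \<times> 'b) set set" where
  "pg2_lines = {{u + w | u w. u \<in> p \<and> w \<in> q} | p q.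
                  p \<in> pg2_points \<and> q \<in> pg2_points \<and> p \<noteq> q}"

definition is_duality ::
  "'v set set \<Rightarrow> 'v set set \<Rightarrow> 'v set set \<Rightarrow> 'v set set \<Rightarrow>
   ('v set \<Rightarrow> 'v set) \<Rightarrow> ('v set \<Rightarrow> 'v set) \<Rightarrow> bool" where
  "is_duality X \<Xi> S \<B> \<chi> \<chi>' \<longleftrightarrow>
     bij_betw \<chi> X \<B> \<and> bij_betw \<chi>' \<Xi> S \<and> (\<forall>x\<in>X. \<forall>\<xi>\<in>\<Xi>. x \<subseteq> \<xi> \<longleftrightarrow> \<chi>' \<xi> \<subseteq> \<chi> x)"

text \<open>
  Here \<open>\<chi>\<close> is the map on points and \<open>\<chi>'\<close> the map on lines. Projecting a subspace \<open>b\<close> of \<open>Y\<close> from a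
  subspace \<open>V\<close> of \<open>b\<close> is realised as intersecting \<open>b\<close> with a complement \<open>W\<close> of \<open>V\<close> in \<open>Y\<close>.
\<close>

definition linear_duality ::
  "('k::field \<Rightarrow> 'v::ab_group_add \<Rightarrow> 'v) \<Rightarrow> nat \<Rightarrow> 'v set \<Rightarrow> 'v set set \<Rightarrow> 'v set set \<Rightarrow>
   'v set set \<Rightarrow> 'v set set \<Rightarrow> ('v set \<Rightarrow> 'v set) \<Rightarrow> ('v set \<Rightarrow> 'v set) \<Rightarrow> bool" where
  "linear_duality s v Y X \<Xi> S \<B> \<chi> \<chi>' \<longleftrightarrow>
     is_duality X \<Xi> S \<B> \<chi> \<chi>' \<and>
     (\<forall>\<xi>\<in>\<Xi>. \<forall>W. complement_in s Y (\<chi>' \<xi>) W \<longrightarrow>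
        regular_spread_line s v W {b \<inter> W | b. b \<in> \<B> \<and> \<chi>' \<xi> \<subseteq> b} \<and>
        (\<forall>C \<in> conics_of s \<xi> (X \<inter> points s \<xi>).
           is_regulus s v W ((\<lambda>x. \<chi> x \<inter> W) ` C) \<and>
           (\<forall>p\<^sub>1\<in>C. \<forall>p\<^sub>2\<in>C. \<forall>p\<^sub>3\<in>C. \<forall>p\<^sub>4\<in>C. distinct [p\<^sub>1, p\<^sub>2, p\<^sub>3, p\<^sub>4] \<longrightarrow>
              (\<forall>r. conic_cross_ratio s C p\<^sub>1 p\<^sub>2 p\<^sub>3 p\<^sub>4 r \<longleftrightarrow>
                   regulus_cross_ratio s (\<chi> p\<^sub>1 \<inter> W) (\<chi> p\<^sub>2 \<inter> W) (\<chi> p\<^sub>3 \<inter> W) (\<chi> p\<^sub>4 \<inter> W) r))))"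


section \<open>Quadratic division algebras and Veronese representations\<close>

definition quadratic_division_algebra ::
  "('k::field \<Rightarrow> 'b::ring_1 \<Rightarrow> 'b) \<Rightarrow> ('b \<Rightarrow> 'k) \<Rightarrow> ('b \<Rightarrow> 'k) \<Rightarrow> bool" where
  "quadratic_division_algebra scl T N \<longleftrightarrow>
     vector_space scl \<and>
     (\<forall>k a b. scl k (a * b) = scl k a * b \<and> scl k (a * b) = a * scl k b) \<and>
     (\<forall>a. a\<^sup>2 - scl (T a) a + scl (N a) 1 = 0) \<and>
     Vector_Spaces.linear scl (*) T \<and> T 1 = 2 \<and>
     quadratic_form_on scl UNIV N \<and> (\<forall>a. N a = 0 \<longrightarrow> a = 0) \<and> N 1 = 1"

text \<open>
  The algebra \<open>\<bbbA>\<close> over which a Veronese representation is taken; it need not be associative.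
  The field \<open>rad\<close> is the set of all elements \<open>t b\<close> with \<open>b\<close> in \<open>\<bbbB>\<close>; it is \<open>{0}\<close> if \<open>\<bbbA> = \<bbbB>\<close>, where
  \<open>t = 0\<close>.
\<close>

record ('k, 'a) conic_algebra =
  mul :: "'a \<Rightarrow> 'a \<Rightarrow> 'a"
  unit :: 'a
  conj :: "'a \<Rightarrow> 'a"
  scal :: "'k \<Rightarrow> 'a \<Rightarrow> 'a"
  rad :: "'a set"

definition base_algebra ::
  "('k::field \<Rightarrow> 'b::ring_1 \<Rightarrow> 'b) \<Rightarrow> ('b \<Rightarrow> 'k) \<Rightarrow> ('k, 'b) conic_algebra" where
  "base_algebra scl T =
     \<lparr>mul = (*), unit = 1, conj = (\<lambda>a. scl (T a) 1 - a), scal = scl, rad = {0}\<rparr>"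

definition CD_zero ::
  "('k::field \<Rightarrow> 'b::ring_1 \<Rightarrow> 'b) \<Rightarrow> ('b \<Rightarrow> 'k) \<Rightarrow> ('k, 'b \<times> 'b) conic_algebra" where
  "CD_zero scl T =
     (let cnj = conj (base_algebra scl T) in
      \<lparr>mul = (\<lambda>(a, b) (c, e). (a * c, cnj a * e + c * b)),
       unit = (1, 0),
       conj = (\<lambda>(a, b). (cnj a, - b)),
       scal = module_prod.scale scl scl,
       rad = range (\<lambda>b. (0, b))\<rparr>)"

definition G2_points :: "('k, 'a::ab_group_add) conic_algebra \<Rightarrow> ('a \<times> 'a \<times> 'a) set" where
  "G2_points A = {(x, y, unit A) | x y. True}
     \<union> {(unit A, y, z) | y z. z \<in> rad A}
     \<union> {(x, unit A, z) | x z. x \<in> rad A \<and> z \<in> rad A}"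

definition G2_lines :: "('k, 'a::ab_group_add) conic_algebra \<Rightarrow> ('a \<times> 'a \<times> 'a) set" where
  "G2_lines A = {(a, unit A, c) | a c. True}
     \<union> {(unit A, b, c) | b c. b \<in> rad A}
     \<union> {(a, b, unit A) | a b. a \<in> rad A \<and> b \<in> rad A}"

fun G2_incident ::
  "('k, 'a::ab_group_add) conic_algebra \<Rightarrow> 'a \<times> 'a \<times> 'a \<Rightarrow> 'a \<times> 'a \<times> 'a \<Rightarrow> bool" where
  "G2_incident A (x, y, z) (a, b, c) \<longleftrightarrow> mul A a x + mul A b y + mul A c z = 0"

type_synonym ('k, 'a) ambient = "('k \<times> 'k \<times> 'k) \<times> ('a \<times> 'a \<times> 'a)"

definition ambient_scale ::
  "('k::field, 'a::ab_group_add) conic_algebra \<Rightarrow> 'k \<Rightarrow> ('k, 'a) ambient \<Rightarrow> ('k, 'a) ambient" where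
  "ambient_scale A =
     module_prod.scale (module_prod.scale (*) (module_prod.scale (*) (*)))
       (module_prod.scale (scal A) (module_prod.scale (scal A) (scal A)))"

text \<open>The scalar of an element of \<open>\<bbbK>\<close>, viewed inside the algebra; used for norms \<open>x * conj x\<close> only.\<close>

definition to_scalar :: "('k, 'a) conic_algebra \<Rightarrow> 'a \<Rightarrow> 'k" where
  "to_scalar A a = (THE k. scal A k (unit A) = a)"

fun veronese_map ::
  "('k::field, 'a::ab_group_add) conic_algebra \<Rightarrow> 'a \<times> 'a \<times> 'a \<Rightarrow> ('k, 'a) ambient set" where
  "veronese_map A (x, y, z) = module.span (ambient_scale A)
     {((to_scalar A (mul A x (conj A x)), to_scalar A (mul A y (conj A y)),
        to_scalar A (mul A z (conj A z))),
       (mul A y (conj A z), mul A z (conj A x), mul A x (conj A y)))}"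

definition veronese ::
  "('k::field, 'a::ab_group_add) conic_algebra \<Rightarrow>
   ('k, 'a) ambient set set \<times> ('k, 'a) ambient set set" where
  "veronese A =
     (veronese_map A ` G2_points A,
      {module.span (ambient_scale A) (\<Union>p \<in> {p \<in> G2_points A. G2_incident A p l}. veronese_map A p)
         | l. l \<in> G2_lines A})"

text \<open>
  The structure induced by \<open>(X, \<Xi>)\<close> on a subspace \<open>F\<close>. As usual for an induced geometry, a member of
  \<open>\<Xi>\<close> counts only if it contains at least two points of \<open>X\<close> in \<open>F\<close>. This proviso is necessary:
  over \<open>CD_zero\<close>, a complement \<open>F\<close> of the span of the vertices meets most members of \<open>\<Xi>\<close> in too
  small a subspace.
  For \<open>\<bbbB> = \<bbbK>\<close> of order 2 and \<open>F\<close> given by vanishing \<open>t\<close>-parts, 7 of the 28 members of \<open>\<Xi>\<close> meet \<open>F\<close>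
  in a plane of the Veronese representation of \<open>\<bbbB>\<close>, and the other 21 meet \<open>F\<close> in a single point.
\<close>

definition induced_points ::
  "('k::field \<Rightarrow> 'v::ab_group_add \<Rightarrow> 'v) \<Rightarrow> 'v set set \<Rightarrow> 'v set \<Rightarrow> 'v set set" where
  "induced_points s X F = X \<inter> points s F"

definition induced_lines ::
  "('k::field \<Rightarrow> 'v::ab_group_add \<Rightarrow> 'v) \<Rightarrow> 'v set set \<Rightarrow> 'v set set \<Rightarrow> 'v set \<Rightarrow> 'v set set" where
  "induced_lines s X \<Xi> F = {\<xi> \<inter> F | \<xi>. \<xi> \<in> \<Xi> \<and>
     (\<exists>x \<in> induced_points s X F. \<exists>y \<in> induced_points s X F. x \<noteq> y \<and> x \<subseteq> \<xi> \<and> y \<subseteq> \<xi>)}"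

end

theory Submission
  imports Defs
begin

text \<open>
  Read an element of the ambient space as a Hermitian \<open>3 \<times> 3\<close> matrix over \<open>\<bbbB>\<close> together with a vector
  \<open>\<tau>\<close> of \<open>t\<close>-parts in \<open>\<bbbB>\<^sup>3\<close>. The points of \<open>X\<close> are exactly the pairs \<open>(p p\<^sup>*, \<tau>)\<close> with \<open>p\<^sup>* \<tau> = 0\<close>, where
  \<open>p\<close> runs through the points of the plane over \<open>\<bbbB>\<close>. Let \<open>m\<^sup>*\<close> be the row of \<open>\<bbbB>\<close>-parts of a line, and
  let \<open>u\<close>, \<open>w\<close> be a basis of the solutions of \<open>m\<^sup>* p = 0\<close>. The corresponding member of \<open>\<Xi>\<close> is
  parametrised by a quadric \<open>k\<^sub>1 k\<^sub>3 = N \<gamma>\<close>, through \<open>k\<^sub>1 u u\<^sup>* + k\<^sub>3 w w\<^sup>* + u \<gamma> w\<^sup>* + w \<gamma>\<^sup>* u\<^sup>*\<close>, and by the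
  vertex, which consists of the vectors \<open>m r\<close> among the \<open>t\<close>-parts. So the vertices are the
  points of the plane over \<open>\<bbbB>\<close>, and the standard polarity \<open>p \<mapsto> p\<^sup>\<bottom>\<close>, \<open>m\<^sup>\<bottom> \<mapsto> m\<close> is the required duality:
  a conic is a subline over \<open>\<bbbK>\<close> of a line of this plane, and the polarity takes it to a regulus
  with the same parameters.
\<close>

section \<open>Linear algebra\<close>

text \<open>The condition \<open>p* \<tau> = 0\<close> has its origin in a cross product: for a
  point in normal form, the t-parts of the off-diagonal products are a cross product of its B-part
  with its t-part. The t-part of a line adds to \<open>\<tau>\<close> only a term linear in the
  point of the quadric. Hence all members of \<Xi> over one \<open>m\<close> share their vertex, and
  two points of X in F force that term to vanish.

  The notions to be met are existential: a vertex is any subspace with a suitable complement and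
  form, a conic any suitable plane section, a cross-ratio any suitable parametrisation, and the
  duality has to work for every complement of a vertex. So each construction needs a uniqueness
  argument, valid over every field: nothing is divided by 2, and very small fields get their own
  argument where there are too few points. The Hermitian form on triples may have isotropic vectors,
  so dual vectors take the place of orthogonal complements. Three points of a conic can be written
  as \<open>u\<close>, \<open>w\<close>, \<open>u + w\<close>, which makes the pairs of scalars
  \<open>(a, b)\<close> coordinates on both sides of the duality.\<close>

context vector_space
begin

lemma span_singleton_eq_iff:
  assumes "u \<noteq> 0"
  shows "span {u} = span {w} \<longleftrightarrow> (\<exists>c. c \<noteq> 0 \<and> w = scale c u)"
proof
  assume eq: "span {u} = span {w}"
  have "w \<in> span {w}" "u \<in> span {u}" by (simp_all add: span_base)
  then have "w \<in> span {u}" "u \<in> span {w}" using eq by simp_all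
  then obtain c c' where w: "w = scale c u" and u: "u = scale c' w"
    unfolding span_singleton by blast
  from u assms have "w \<noteq> 0" by auto
  with w show "\<exists>c. c \<noteq> 0 \<and> w = scale c u" by auto
next
  assume "\<exists>c. c \<noteq> 0 \<and> w = scale c u"
  then obtain c where c: "c \<noteq> 0" "w = scale c u" by blast
  then have "u = scale (inverse c) w" by simp
  then have "u \<in> span {w}" by (metis span_base span_scale singletonI)
  moreover have "w \<in> span {u}" using c by (metis span_base span_scale singletonI)
  ultimately show "span {u} = span {w}" by (simp add: span_eq)
qed

lemma span_singleton_nonzero: "span {u} = span {w} \<Longrightarrow> u = 0 \<longleftrightarrow> w = 0"
  by (metis dependent_single span_base span_empty span_insert_0 singletonI singletonD)

lemma span_singleton_subset_iff: "subspace U \<Longrightarrow> span {u} \<subseteq> U \<longleftrightarrow> u \<in> U"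
  by (metis empty_subsetI insert_subset span_base span_minimal subset_iff singletonI)

lemma span_singleton_in_points_iff:
  assumes "subspace U"
  shows "span {x} \<in> points scale U \<longleftrightarrow> x \<in> U \<and> x \<noteq> 0"
proof
  assume "span {x} \<in> points scale U"
  then obtain u where u: "u \<in> U" "u \<noteq> 0" "span {x} = span {u}"
    unfolding points_def by auto
  then have "x \<in> U"
    by (metis assms span_singleton_subset_iff)
  then show "x \<in> U \<and> x \<noteq> 0" using u span_singleton_nonzero by blast
qed (auto simp: points_def)

section \<open>Complements and cones\<close>

lemma complement_decomposition_unique:
  assumes "complement_in scale \<xi> V W" "a \<in> V" "a' \<in> V" "b \<in> W" "b' \<in> W" "a + b = a' + b'"
  shows "a = a' \<and> b = b'"
proof -
  have V: "subspace V" and W: "subspace W" and VW: "V \<inter> W = {0}"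
    using assms(1) by (auto simp: complement_in_def)
  have "a - a' = b' - b" using assms(6) by (simp add: algebra_simps)
  moreover have "a - a' \<in> V" using V assms by (simp add: subspace_diff)
  moreover have "b' - b \<in> W" using W assms by (simp add: subspace_diff)
  ultimately have "a - a' \<in> V \<inter> W" by simp
  then have "a - a' = 0" using VW by simp
  then show ?thesis using assms(6) by simp
qed

lemma complement_decomposition:
  assumes "complement_in scale \<xi> V W" "x \<in> \<xi>"
  obtains a b where "a \<in> V" "b \<in> W" "x = a + b"
proof -
  have "span V = V" "span W = W" "x \<in> span (V \<union> W)"
    using assms by (auto simp: complement_in_def)
  then show ?thesis using that unfolding span_Un by blast
qed

lemma complement_in_subset:
  assumes "complement_in scale \<xi> V W"
  shows "V \<subseteq> \<xi>" "W \<subseteq> \<xi>" "subspace \<xi>"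
  using assms span_superset[of "V \<union> W"] unfolding complement_in_def by auto

text \<open>Off the vertex, a vector of the join of \<open>V\<close> with a point \<open>w'\<close>
  has as W-component a nonzero multiple of \<open>w'\<close>. So membership depends on the
  W-component alone, and the punctured cone is invariant under translation by \<open>V\<close>; this
  invariance later identifies the vertex.\<close>

lemma cone_minus_vertex_iff:
  assumes c: "complement_in scale \<xi> V W" and q: "quadratic_form_on scale W q"
    and v: "v \<in> V" and w: "w \<in> W"
  shows "span {v + w} \<in> cone scale V (quadric scale W q) - points scale V \<longleftrightarrow> w \<noteq> 0 \<and> q w = 0"
proof
  have V: "subspace V" and W: "subspace W" and VW: "V \<inter> W = {0}"
    using c by (auto simp: complement_in_def)
  show "w \<noteq> 0 \<and> q w = 0" if "span {v + w} \<in> cone scale V (quadric scale W q) - points scale V"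
  proof -
    from that obtain p where p: "p \<in> quadric scale W q" "span {v + w} \<in> points scale (span (V \<union> p))"
      by (auto simp: cone_def)
    then obtain w' where w': "w' \<in> W" "q w' = 0" "p = span {w'}"
      by (auto simp: quadric_def)
    have vw: "v + w \<in> span (V \<union> p)" "v + w \<noteq> 0"
      using p(2) by (simp_all add: span_singleton_in_points_iff)
    then obtain v' b where b: "v' \<in> V" "b \<in> p" "v + w = v' + b"
      unfolding span_Un span_eq_iff[THEN iffD2, OF V] w'(3) span_span by blast
    then obtain k where k: "b = scale k w'" using w' by (auto simp: span_singleton)
    have "b \<in> W" using k W w' by (simp add: subspace_scale)
    then have "w = b" using complement_decomposition_unique[OF c v b(1) w _ b(3)] by simp
    moreover have "q b = 0" using k q w' by (simp add: quadratic_form_on_def)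
    moreover have "w \<noteq> 0"
      using that v vw(2) V by (auto simp: span_singleton_in_points_iff)
    ultimately show ?thesis by simp
  qed
  show "span {v + w} \<in> cone scale V (quadric scale W q) - points scale V" if "w \<noteq> 0 \<and> q w = 0"
  proof -
    have nV: "v + w \<notin> V"
    proof
      assume "v + w \<in> V"
      then have "w \<in> V" using v V by (metis add_diff_cancel_left' subspace_diff)
      then show False using w VW that by auto
    qed
    then have "v + w \<noteq> 0" using V subspace_0 by metis
    moreover have "v + w \<in> span (V \<union> span {w})"
      using v by (intro span_add) (auto simp: span_base)
    ultimately have "span {v + w} \<in> points scale (span (V \<union> span {w}))"
      by (simp add: span_singleton_in_points_iff)
    moreover have "span {w} \<in> quadric scale W q" using that w by (auto simp: quadric_def)
    ultimately show ?thesis using nV V by (auto simp: cone_def span_singleton_in_points_iff)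
  qed
qed

section \<open>Linear independence and dimension\<close>

text \<open>Independence is a property of the set, which hides repeated vectors; the cardinality
  turns it into a property of the triple.\<close>

lemma independent_3_iff:
  "card {a, b, c} = 3 \<and> independent {a, b, c} \<longleftrightarrow>
    (\<forall>x y z. scale x a + scale y b + scale z c = 0 \<longrightarrow> x = 0 \<and> y = 0 \<and> z = 0)"
proof
  assume l: "card {a, b, c} = 3 \<and> independent {a, b, c}"
  then have d: "a \<noteq> b" "a \<noteq> c" "b \<noteq> c" by (auto simp: card_insert_if split: if_splits)
  show "\<forall>x y z. scale x a + scale y b + scale z c = 0 \<longrightarrow> x = 0 \<and> y = 0 \<and> z = 0"
  proof (intro allI impI)
    fix x y z
    assume z: "scale x a + scale y b + scale z c = 0"
    define u where "u = (\<lambda>t. if t = a then x else if t = b then y else z)"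
    have "(\<Sum>t\<in>{a, b, c}. scale (u t) t) = 0"
      using d z by (simp add: u_def add.assoc)
    then have "u t = 0" if "t \<in> {a, b, c}" for t
      using l that independentD[of "{a,b,c}" "{a,b,c}" u] by blast
    from this[of a] this[of b] this[of c] show "x = 0 \<and> y = 0 \<and> z = 0"
      using d by (simp add: u_def)
  qed
next
  assume r: "\<forall>x y z. scale x a + scale y b + scale z c = 0 \<longrightarrow> x = 0 \<and> y = 0 \<and> z = 0"
  have ab: "a \<noteq> b" using r[rule_format, of 1 "-1" 0] by auto
  have ac: "a \<noteq> c" using r[rule_format, of 1 0 "-1"] by auto
  have bc: "b \<noteq> c" using r[rule_format, of 0 1 "-1"] by auto
  have "independent {a, b, c}"
    unfolding independent_explicit_module
  proof (intro allI impI)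
    fix t u v
    assume t: "finite t" "t \<subseteq> {a, b, c}" "(\<Sum>v\<in>t. scale (u v) v) = 0" "v \<in> t"
    define u' where "u' = (\<lambda>v. if v \<in> t then u v else 0)"
    have "(\<Sum>v\<in>{a, b, c}. scale (u' v) v) = (\<Sum>v\<in>t. scale (u' v) v)"
      using t by (intro sum.mono_neutral_right) (auto simp: u'_def)
    also have "\<dots> = 0" using t by (simp add: u'_def)
    finally have "scale (u' a) a + scale (u' b) b + scale (u' c) c = 0"
      using ab ac bc by (simp add: add.assoc)
    with r have "u' a = 0 \<and> u' b = 0 \<and> u' c = 0" by blast
    then show "u v = 0" using t by (auto simp: u'_def split: if_splits)
  qed
  then show "card {a, b, c} = 3 \<and> independent {a, b, c}" using ab ac bc by simp
qed

lemma span_3: "span {a, b, c} = {scale x a + scale y b + scale z c | x y z. True}"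
  by (auto simp: span_insert span_singleton algebra_simps)

lemma independent_2_iff:
  assumes "a \<noteq> 0" "b \<noteq> 0"
  shows "span {a} \<noteq> span {b} \<longleftrightarrow> (\<forall>x y. scale x a + scale y b = 0 \<longrightarrow> x = 0 \<and> y = 0)"
proof
  assume n: "span {a} \<noteq> span {b}"
  show "\<forall>x y. scale x a + scale y b = 0 \<longrightarrow> x = 0 \<and> y = 0"
  proof (intro allI impI)
    fix x y
    assume z: "scale x a + scale y b = 0"
    have "y = 0"
    proof (rule ccontr)
      assume y: "y \<noteq> 0"
      have "scale y b = scale (- x) a" using z by (simp add: add_eq_0_iff)
      then have "scale (inverse y) (scale y b) = scale (inverse y) (scale (- x) a)" by simp
      then have b: "b = scale (- x / y) a" using y by (simp add: field_simps)
      moreover have "- x / y \<noteq> 0" using b assms(2) by (metis scale_zero_left)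
      ultimately show False using n span_singleton_eq_iff[OF assms(1)] by blast
    qed
    then show "x = 0 \<and> y = 0" using z assms by simp
  qed
next
  assume r: "\<forall>x y. scale x a + scale y b = 0 \<longrightarrow> x = 0 \<and> y = 0"
  show "span {a} \<noteq> span {b}"
  proof
    assume "span {a} = span {b}"
    then obtain c where "c \<noteq> 0" "b = scale c a" using span_singleton_eq_iff[OF assms(1)] by blast
    then show False using r[rule_format, of "- c" 1] by simp
  qed
qed

lemma has_dimension_subspace: "has_dimension scale n U \<Longrightarrow> subspace U"
  by (auto simp: has_dimension_def)

lemma has_dimension_1: "u \<noteq> 0 \<Longrightarrow> has_dimension scale 1 (span {u})"
  unfolding has_dimension_def by (rule exI[of _ "{u}"]) auto

lemma has_dimension_independent_bound:
  assumes "has_dimension scale n U" "independent A" "A \<subseteq> U"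
  shows "finite A" "card A \<le> n"
  using assms independent_span_bound unfolding has_dimension_def by blast+

lemma has_dimension_full:
  assumes U: "has_dimension scale n U" and A: "independent A" "A \<subseteq> U" "n \<le> card A"
  shows "span A = U"
proof (rule ccontr)
  assume ne: "span A \<noteq> U"
  have "span A \<subseteq> U" using A U has_dimension_subspace span_minimal by blast
  with ne obtain x where x: "x \<in> U" "x \<notin> span A" by blast
  then have i: "independent (insert x A)" using A independent_insertI by blast
  have "card (insert x A) \<le> n" "finite A"
    using has_dimension_independent_bound[OF U i] A x by auto
  moreover have "x \<notin> A" using x span_base by blast
  ultimately show False using A by simp
qed

lemma has_dimension_subset_eq:
  assumes "has_dimension scale n U" "has_dimension scale n W" "U \<subseteq> W"
  shows "U = W"
proof -
  obtain E where E: "independent E" "card E = n" "span E = U"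
    using assms(1) unfolding has_dimension_def by blast
  then have "E \<subseteq> W" using assms(3) span_superset by blast
  then show ?thesis using has_dimension_full[OF assms(2) E(1)] E by simp
qed

lemma has_dimension_sum:
  assumes U: "has_dimension scale n U" and W: "has_dimension scale m W" and d: "U \<inter> W = {0}"
  shows "has_dimension scale (n + m) (span (U \<union> W))"
proof -
  obtain E where E: "finite E" "independent E" "card E = n" "span E = U"
    using U unfolding has_dimension_def by blast
  obtain G where G: "finite G" "independent G" "card G = m" "span G = W"
    using W unfolding has_dimension_def by blast
  \<comment> \<open>The basis \<open>G\<close> joins \<open>E\<close> one vector at a time. A
    dependence would have its \<open>U\<close>-part in \<open>U \<inter> W\<close>, hence would be a
    dependence inside \<open>G\<close>.\<close>
  have "finite H \<Longrightarrow> H \<subseteq> G \<Longrightarrow> independent (E \<union> H) \<and> card (E \<union> H) = card E + card H" for H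
  proof (induction H rule: finite_induct)
    case (insert a H)
    have "a \<notin> span (E \<union> H)"
    proof
      assume "a \<in> span (E \<union> H)"
      then obtain x y where xy: "x \<in> U" "y \<in> span H" "a = x + y"
        unfolding span_Un E(4) by blast
      have yW: "y \<in> W" "a \<in> W"
        using xy insert.prems G span_mono[of H G] span_superset[of G] by auto
      then have "x \<in> W"
        using xy W has_dimension_subspace subspace_diff by (metis add_diff_cancel_right')
      then have "x = 0" using xy(1) d by blast
      then have "a \<in> span H" using xy by simp
      moreover have "H \<subseteq> G - {a}" using insert by auto
      ultimately have "a \<in> span (G - {a})" using span_mono by blast
      then show False using G(2) insert.prems by (auto simp: dependent_def)
    qed
    moreover have "a \<notin> E \<union> H"
      using calculation span_base by blast
    ultimately show ?case using insert E by (simp add: independent_insertI)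
  qed (use E in simp)
  from this[OF G(1)] have "independent (E \<union> G)" "card (E \<union> G) = n + m" using E G by auto
  moreover have "span (E \<union> G) = span (U \<union> W)"
    unfolding span_Un using E G by (metis span_span)
  ultimately show ?thesis unfolding has_dimension_def
    using E(1) G(1) by (metis finite_UnI)
qed

section \<open>Conics over an arbitrary field\<close>

text \<open>One point \<open>e\<close> of the conic is completed to a hyperbolic pair
  \<open>e\<close>, \<open>f\<close>. A third vector \<open>g\<close> orthogonal to both is
  anisotropic by nondegeneracy, and \<open>e - q(g) f + g\<close> is a third isotropic vector. This
  uses no division by 2, and it also covers the field with two elements, where the conic has just
  three points.\<close>

lemma conic_spanning_points:
  assumes E: "n_space scale 2 E" and q: "quadratic_form_on scale E q"
    and nd: "nondegenerate_on E q" and ne: "quadric scale E q \<noteq> {}"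
  obtains e f h where "card {e, f, h} = 3" "independent {e, f, h}" "span {e, f, h} = E"
    "q e = 0" "q f = 0" "q h = 0"
proof -
  have E3: "has_dimension scale 3 E" using E by (simp add: n_space_def)
  then have sE: "subspace E" using has_dimension_subspace by blast
  note cl = subspace_add[OF sE] subspace_diff[OF sE] subspace_scale[OF sE] subspace_0[OF sE]
    subspace_neg[OF sE]
  let ?b = "polar_form q"
  have sq: "q (scale k w) = k\<^sup>2 * q w" if "w \<in> E" for k w
    using q that by (auto simp: quadratic_form_on_def)
  have bl: "?b (u + v) w = ?b u w + ?b v w" if "u \<in> E" "v \<in> E" "w \<in> E" for u v w
    using q that by (auto simp: quadratic_form_on_def)
  have bs: "?b (scale k u) w = k * ?b u w" if "u \<in> E" "w \<in> E" for k u w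
    using q that by (auto simp: quadratic_form_on_def)
  have sym: "?b u w = ?b w u" for u w by (simp add: polar_form_def add.commute)
  have bm: "?b (- u) w = - ?b u w" if "u \<in> E" "w \<in> E" for u w
    using bs[of u w "-1"] that by simp
  have br: "?b w (u + v) = ?b w u + ?b w v" if "u \<in> E" "v \<in> E" "w \<in> E" for u v w
    using bl that sym by metis
  have brs: "?b w (scale k u) = k * ?b w u" if "u \<in> E" "w \<in> E" for k u w
    using bs that sym by metis
  have brm: "?b w (- u) = - ?b w u" if "u \<in> E" "w \<in> E" for u w
    using bm that sym by metis
  have qa: "q (u + w) = q u + q w + ?b u w" for u w by (simp add: polar_form_def)
  have qd: "q (u - w) = q u + q w - ?b u w" if "u \<in> E" "w \<in> E" for u w
    using qa[of u "- w"] brm[of w u] sq[of w "-1"] that by simp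
  have bd: "?b (u - v) w = ?b u w - ?b v w" if "u \<in> E" "v \<in> E" "w \<in> E" for u v w
    using bl[of u "- v" w] bm[of v w] that cl by simp
  have brd: "?b w (u - v) = ?b w u - ?b w v" if "u \<in> E" "v \<in> E" "w \<in> E" for u v w
    using bd that sym by metis
  \<comment> \<open>Comes from \<open>q (w + w) = 4 * q w\<close>, so it is available in
    characteristic 2 as well.\<close>
  have two: "q w = 0 \<Longrightarrow> ?b w w = 0" if "w \<in> E" for w
  proof -
    have "scale 2 w = w + w" by (metis one_add_one scale_left_distrib scale_one)
    then show "q w = 0 \<Longrightarrow> ?b w w = 0" using sq[OF that, of 2] by (simp add: polar_form_def)
  qed
  have qm: "q (- u) = q u" if "u \<in> E" for u using sq[of u "-1"] that by simp
  obtain e where e: "e \<in> E" "e \<noteq> 0" "q e = 0" using ne by (auto simp: quadric_def)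
  have bee: "?b e e = 0" using two e by blast
  obtain f0 where f0: "f0 \<in> E" "?b e f0 \<noteq> 0" using nd e unfolding nondegenerate_on_def by blast
  define f1 where "f1 = scale (inverse (?b e f0)) f0"
  have f1: "f1 \<in> E" "?b e f1 = 1" using f0 e by (auto simp: f1_def cl brs)
  \<comment> \<open>\<open>q (f1 + c e) = q f1 + c\<close> because \<open>e\<close> is isotropic and
    pairs to 1 with \<open>f1\<close>; this choice of \<open>c\<close> makes the vector
    isotropic.\<close>
  define f where "f = f1 + scale (- q f1) e"
  have f: "f \<in> E" "q f = 0" "?b e f = 1"
    using f1 e bee sym[of f1 e] unfolding f_def
    by (auto simp: qa qd bd brd br brs brm bm bs bl sq qm cl)
  have bff: "?b f f = 0" using two f by blast
  have ef: "independent {e, f}" "e \<noteq> f"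
  proof -
    show "e \<noteq> f" using bee f by auto
    have "f \<notin> span {e}"
      using e bee f brs by (auto simp: span_singleton)
    then show "independent {e, f}" using e independent_insertI[of f "{e}"]
      by (simp add: insert_commute)
  qed
  have "\<not> E \<subseteq> span {e, f}"
  proof
    assume s: "E \<subseteq> span {e, f}"
    obtain G where G: "independent G" "card G = 3" "span G = E"
      using E3 unfolding has_dimension_def by blast
    then have "G \<subseteq> span {e, f}" using s span_superset by blast
    then have "card G \<le> card {e, f}" using independent_span_bound[of "{e,f}" G] G by simp
    then show False using G ef by simp
  qed
  then obtain h0 where h0: "h0 \<in> E" "h0 \<notin> span {e, f}" by blast
  \<comment> \<open>The component of \<open>h0\<close> orthogonal to the hyperbolic plane spanned by
    \<open>e\<close> and \<open>f\<close>.\<close>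
  define g where "g = h0 + scale (- ?b h0 f) e + scale (- ?b h0 e) f"
  have g: "g \<in> E" "?b g e = 0" "?b g f = 0"
    using h0 e f bee bff sym[of f e] unfolding g_def
    by (auto simp: bd brd bl bs bm brs brm br sq qm cl)
  have gn: "g \<notin> span {e, f}"
  proof
    assume "g \<in> span {e, f}"
    moreover have "h0 = g - scale (- ?b h0 f) e - scale (- ?b h0 e) f" by (simp add: g_def)
    ultimately have "h0 \<in> span {e, f}"
      by (metis insertCI span_base span_diff span_scale)
    then show False using h0 by blast
  qed
  have full: "span {e, f, x} = E \<and> card {e, f, x} = 3 \<and> independent {e, f, x}"
    if "x \<in> E" "x \<notin> span {e, f}" for x
  proof -
    have i: "independent {x, e, f}" using ef that independent_insertI by blast
    have c: "card {x, e, f} = 3" using ef that span_base[of _ "{e,f}"] by (auto simp: card_insert_if)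
    have "span {x, e, f} = E" using has_dimension_full[OF E3 i] that e f c by auto
    moreover have "{x, e, f} = {e, f, x}" by auto
    ultimately show ?thesis using i c by simp
  qed
  \<comment> \<open>Otherwise \<open>g\<close> is orthogonal to \<open>e\<close>, \<open>f\<close>
    and itself, hence to all of \<open>E\<close>, and isotropic: it would lie in the
    radical.\<close>
  have "q g \<noteq> 0"
  proof
    assume z: "q g = 0"
    have bgg: "?b g g = 0" using two g z by blast
    have "?b g u = 0" if "u \<in> E" for u
    proof -
      have "u \<in> span {e, f, g}" using full[OF g(1) gn] that by simp
      then obtain x y z where "u = scale x e + scale y f + scale z g" unfolding span_3 by blast
      then show ?thesis using e f g bgg by (simp add: br brs cl)
    qed
    then have "g = 0" using nd z g(1) unfolding nondegenerate_on_def by blast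
    then show False using gn span_zero by simp
  qed
  \<comment> \<open>\<open>q (e - c f) = - c\<close>, and \<open>g\<close> is orthogonal to
    \<open>e\<close> and \<open>f\<close>, so \<open>c = q g\<close> makes the sum
    isotropic.\<close>
  define h where "h = e + scale (- q g) f + g"
  have h: "h \<in> E" "q h = 0"
    using e f g sym[of f g] sym[of e g] unfolding h_def
    by (auto simp: qa qd bd brd bl br bs brs bm brm sq qm cl)
  have "h \<notin> span {e, f}"
  proof
    assume "h \<in> span {e, f}"
    moreover have "g = h - e - scale (- q g) f" by (simp add: h_def)
    ultimately have "g \<in> span {e, f}"
      by (metis insertCI span_base span_diff span_scale)
    then show False using gn by blast
  qed
  from full[OF h(1) this] show ?thesis using that e f h by blast
qed

section \<open>Cross-ratios on lines and on conics\<close>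

text \<open>The definition leaves the representatives \<open>a\<close>, \<open>b\<close> free.
  Matching the third point forces both to be rescaled by the same factor, and then the fourth point
  determines \<open>r\<close>.\<close>

lemma cross_ratio_iff:
  assumes "a \<noteq> 0" "b \<noteq> 0" "span {a} \<noteq> span {b}" "r0 \<noteq> 0"
  shows "cross_ratio scale (span {a}) (span {b}) (span {a + b}) (span {scale r0 a + b}) r \<longleftrightarrow> r = r0"
proof
  assume "r = r0"
  then show "cross_ratio scale (span {a}) (span {b}) (span {a + b}) (span {scale r0 a + b}) r"
    using assms unfolding cross_ratio_def by blast
next
  have ind: "x = 0 \<and> y = 0" if "scale x a + scale y b = 0" for x y
    using independent_2_iff[OF assms(1,2)] assms(3) that by blast
  have ind2: "x = x' \<and> y = y'" if "scale x a + scale y b = scale x' a + scale y' b" for x y x' y'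
  proof -
    have "scale (x - x') a + scale (y - y') b = 0" using that by (simp add: algebra_simps)
    then show ?thesis using ind by force
  qed
  assume "cross_ratio scale (span {a}) (span {b}) (span {a + b}) (span {scale r0 a + b}) r"
  then obtain a' b' where ab: "a' \<noteq> 0" "b' \<noteq> 0" "span {a} = span {a'}" "span {b} = span {b'}"
    "span {a + b} = span {a' + b'}" "span {scale r0 a + b} = span {scale r a' + b'}"
    unfolding cross_ratio_def by metis
  have n: "a + b \<noteq> 0" "scale r0 a + b \<noteq> 0" using ind[of 1 1] ind[of r0 1] by auto
  obtain x where x: "x \<noteq> 0" "a' = scale x a" using ab(3) span_singleton_eq_iff[OF assms(1)] by blast
  obtain y where y: "y \<noteq> 0" "b' = scale y b" using ab(4) span_singleton_eq_iff[OF assms(2)] by blast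
  obtain z where z: "z \<noteq> 0" "a' + b' = scale z (a + b)" using ab(5) span_singleton_eq_iff[OF n(1)] by blast
  obtain t where t: "scale r a' + b' = scale t (scale r0 a + b)" using ab(6) span_singleton_eq_iff[OF n(2)] by blast
  have "x = z \<and> y = z" using z x y ind2[of x y z z] by (simp add: scale_right_distrib)
  moreover have "r * x = t * r0 \<and> y = t" using t x y ind2[of "r * x" y "t * r0" t] by (simp add: scale_right_distrib)
  ultimately show "r = r0" using x by auto
qed

end

lemma quadratic_zero_coeffs:
  fixes A B C x y z :: "'k::field"
  assumes "A * x\<^sup>2 + B * x + C = 0" "A * y\<^sup>2 + B * y + C = 0" "A * z\<^sup>2 + B * z + C = 0"
    "x \<noteq> y" "x \<noteq> z" "y \<noteq> z"
  shows "A = 0 \<and> B = 0 \<and> C = 0"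
proof -
  have "(x - y) * (A * (x + y) + B) = 0" "(x - z) * (A * (x + z) + B) = 0"
    using assms(1-3) by algebra+
  then have 1: "A * (x + y) + B = 0" and 2: "A * (x + z) + B = 0" using assms by auto
  then have "A * (y - z) = 0" by algebra
  then have "A = 0" using assms by simp
  then show ?thesis using 1 assms by simp
qed

definition conic_vector ::
  "('k::field \<Rightarrow> 'v::ab_group_add \<Rightarrow> 'v) \<Rightarrow> 'v \<Rightarrow> 'v \<Rightarrow> 'v \<Rightarrow> 'k \<times> 'k \<Rightarrow> 'v" where
  "conic_vector s e\<^sub>1 e\<^sub>2 e\<^sub>3 u =
     s ((fst u)\<^sup>2) e\<^sub>1 + s (fst u * snd u) e\<^sub>2 + s ((snd u)\<^sup>2) e\<^sub>3"

lemma (in vector_space) conic_vector_scale: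
  "conic_vector scale e\<^sub>1 e\<^sub>2 e\<^sub>3 (c * x, c * y) = scale (c\<^sup>2) (conic_vector scale e\<^sub>1 e\<^sub>2 e\<^sub>3 (x, y))"
  by (simp add: conic_vector_def algebra_simps power2_eq_square)

lemma prod_scale_eq: "module_prod.scale (*) (*) (c::'k::field) u = (c * fst u, c * snd u)"
proof -
  interpret module_prod "(*) :: 'k \<Rightarrow> 'k \<Rightarrow> 'k" "(*) :: 'k \<Rightarrow> 'k \<Rightarrow> 'k"
    by unfold_locales (auto simp: algebra_simps)
  show ?thesis by (simp add: scale_def)
qed

lemma vector_space_prod_scale: "vector_space (module_prod.scale (*) (*) :: 'k::field \<Rightarrow> _)"
  by unfold_locales (auto simp: prod_scale_eq algebra_simps)

context vector_space
begin

text \<open>Independence of the parametrisation. Any competing one, rewritten in the basis of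
  parameters that belongs to the first two points, has outer coefficient vectors
  \<open>l e\<^sub>1\<close> and \<open>m e\<^sub>3\<close>, and its value at parameter 1 is
  \<open>k\<close> times \<open>e\<^sub>1 + e\<^sub>2 + e\<^sub>3\<close>. That it runs inside the
  same conic forces \<open>k = l = m\<close> as soon as the field is large enough, and then the
  fourth point gives \<open>r = r0\<close>.\<close>

lemma conic_cross_ratio_iff:
  assumes e: "card {e\<^sub>1, e\<^sub>2, e\<^sub>3} = 3" "independent {e\<^sub>1, e\<^sub>2, e\<^sub>3}"
    and C: "C = (\<lambda>u. span {conic_vector scale e\<^sub>1 e\<^sub>2 e\<^sub>3 u}) ` (UNIV - {0})"
    and r0: "r0 \<noteq> 0" "r0 \<noteq> 1"
  shows "conic_cross_ratio scale C (span {e\<^sub>1}) (span {e\<^sub>3}) (span {e\<^sub>1 + e\<^sub>2 + e\<^sub>3})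
           (span {scale (r0\<^sup>2) e\<^sub>1 + scale r0 e\<^sub>2 + e\<^sub>3}) r \<longleftrightarrow> r = r0" (is "?L \<longleftrightarrow> _")
proof -
  let ?s = "module_prod.scale (*) (*) :: 'a \<Rightarrow> _"
  interpret K: vector_space ?s by (rule vector_space_prod_scale)
  have cc: "conic_cross_ratio scale C p1 p2 p3 p4 r' \<longleftrightarrow>
     (\<exists>f\<^sub>1 f\<^sub>2 f\<^sub>3. card {f\<^sub>1, f\<^sub>2, f\<^sub>3} = 3 \<and> independent {f\<^sub>1, f\<^sub>2, f\<^sub>3} \<and>
       C = (\<lambda>u. span {conic_vector scale f\<^sub>1 f\<^sub>2 f\<^sub>3 u}) ` (UNIV - {0}) \<and>
       (\<exists>u\<^sub>1 u\<^sub>2 u\<^sub>3 u\<^sub>4. u\<^sub>1 \<noteq> 0 \<and> u\<^sub>2 \<noteq> 0 \<and> u\<^sub>3 \<noteq> 0 \<and> u\<^sub>4 \<noteq> 0 \<and>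
          p1 = span {conic_vector scale f\<^sub>1 f\<^sub>2 f\<^sub>3 u\<^sub>1} \<and> p2 = span {conic_vector scale f\<^sub>1 f\<^sub>2 f\<^sub>3 u\<^sub>2} \<and>
          p3 = span {conic_vector scale f\<^sub>1 f\<^sub>2 f\<^sub>3 u\<^sub>3} \<and> p4 = span {conic_vector scale f\<^sub>1 f\<^sub>2 f\<^sub>3 u\<^sub>4} \<and>
          cross_ratio ?s (K.span {u\<^sub>1}) (K.span {u\<^sub>2}) (K.span {u\<^sub>3}) (K.span {u\<^sub>4}) r'))"
    for p1 p2 p3 p4 r'
    unfolding conic_cross_ratio_def Let_def conic_vector_def by simp
  have ind0: "scale x e\<^sub>1 + scale y e\<^sub>2 + scale z e\<^sub>3 = 0 \<Longrightarrow> x = 0 \<and> y = 0 \<and> z = 0" for x y z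
    using independent_3_iff e by blast
  have ind: "x = x' \<and> y = y' \<and> z = z'"
    if "scale x e\<^sub>1 + scale y e\<^sub>2 + scale z e\<^sub>3 = scale x' e\<^sub>1 + scale y' e\<^sub>2 + scale z' e\<^sub>3" for x y z x' y' z'
  proof -
    have "scale (x - x') e\<^sub>1 + scale (y - y') e\<^sub>2 + scale (z - z') e\<^sub>3 = 0"
      using that by (simp add: algebra_simps)
    then show ?thesis using ind0 by force
  qed
  show ?thesis
  proof
    assume r: "r = r0"
    have "cross_ratio ?s (K.span {(1, 0)}) (K.span {(0, 1)}) (K.span {(1, 1)}) (K.span {(r0, 1)}) r0"
      unfolding cross_ratio_def
      by (rule exI[of _ "(1, 0)"], rule exI[of _ "(0, 1)"])
         (auto simp: prod_scale_eq K.span_singleton_eq_iff zero_prod_def)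
    then have "\<exists>u\<^sub>1 u\<^sub>2 u\<^sub>3 u\<^sub>4. u\<^sub>1 \<noteq> 0 \<and> u\<^sub>2 \<noteq> 0 \<and> u\<^sub>3 \<noteq> 0 \<and> u\<^sub>4 \<noteq> 0 \<and>
          span {e\<^sub>1} = span {conic_vector scale e\<^sub>1 e\<^sub>2 e\<^sub>3 u\<^sub>1} \<and>
          span {e\<^sub>3} = span {conic_vector scale e\<^sub>1 e\<^sub>2 e\<^sub>3 u\<^sub>2} \<and>
          span {e\<^sub>1 + e\<^sub>2 + e\<^sub>3} = span {conic_vector scale e\<^sub>1 e\<^sub>2 e\<^sub>3 u\<^sub>3} \<and>
          span {scale (r0\<^sup>2) e\<^sub>1 + scale r0 e\<^sub>2 + e\<^sub>3} = span {conic_vector scale e\<^sub>1 e\<^sub>2 e\<^sub>3 u\<^sub>4} \<and>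
          cross_ratio ?s (K.span {u\<^sub>1}) (K.span {u\<^sub>2}) (K.span {u\<^sub>3}) (K.span {u\<^sub>4}) r0"
      by - (rule exI[of _ "(1,0)"], rule exI[of _ "(0,1)"], rule exI[of _ "(1,1)"], rule exI[of _ "(r0,1)"],
          simp add: conic_vector_def zero_prod_def)
    then show ?L unfolding r cc using e C by blast
  next
    assume ?L
    then obtain f\<^sub>1 f\<^sub>2 f\<^sub>3 u\<^sub>1 u\<^sub>2 u\<^sub>3 u\<^sub>4 where
      Cf: "C = (\<lambda>u. span {conic_vector scale f\<^sub>1 f\<^sub>2 f\<^sub>3 u}) ` (UNIV - {0})" and
      f: "card {f\<^sub>1, f\<^sub>2, f\<^sub>3} = 3" "independent {f\<^sub>1, f\<^sub>2, f\<^sub>3}" and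
      un: "u\<^sub>1 \<noteq> 0" "u\<^sub>2 \<noteq> 0" "u\<^sub>3 \<noteq> 0" "u\<^sub>4 \<noteq> 0" and
      pu: "span {e\<^sub>1} = span {conic_vector scale f\<^sub>1 f\<^sub>2 f\<^sub>3 u\<^sub>1}" "span {e\<^sub>3} = span {conic_vector scale f\<^sub>1 f\<^sub>2 f\<^sub>3 u\<^sub>2}"
        "span {e\<^sub>1 + e\<^sub>2 + e\<^sub>3} = span {conic_vector scale f\<^sub>1 f\<^sub>2 f\<^sub>3 u\<^sub>3}"
        "span {scale (r0\<^sup>2) e\<^sub>1 + scale r0 e\<^sub>2 + e\<^sub>3} = span {conic_vector scale f\<^sub>1 f\<^sub>2 f\<^sub>3 u\<^sub>4}" and
      cr: "cross_ratio ?s (K.span {u\<^sub>1}) (K.span {u\<^sub>2}) (K.span {u\<^sub>3}) (K.span {u\<^sub>4}) r"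
      unfolding cc by metis
    have f0: "scale x f\<^sub>1 + scale y f\<^sub>2 + scale z f\<^sub>3 = 0 \<Longrightarrow> x = 0 \<and> y = 0 \<and> z = 0" for x y z
      using independent_3_iff f by blast
    have cn: "conic_vector scale f\<^sub>1 f\<^sub>2 f\<^sub>3 u \<noteq> 0" if "u \<noteq> 0" for u
      using f0[of "(fst u)\<^sup>2" "fst u * snd u" "(snd u)\<^sup>2"] that
      by (cases u) (auto simp: conic_vector_def zero_prod_def)
    from cr obtain a b where ab: "a \<noteq> 0" "b \<noteq> 0" "K.span {a} \<noteq> K.span {b}"
      "K.span {u\<^sub>1} = K.span {a}" "K.span {u\<^sub>2} = K.span {b}" "K.span {u\<^sub>3} = K.span {a + b}"
      "K.span {u\<^sub>4} = K.span {?s r a + b}"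
      unfolding cross_ratio_def by metis
    have sp: "span {conic_vector scale f\<^sub>1 f\<^sub>2 f\<^sub>3 u} = span {conic_vector scale f\<^sub>1 f\<^sub>2 f\<^sub>3 w}"
      if eq: "K.span {u} = K.span {w}" and u: "u \<noteq> 0" for u w
    proof -
      obtain c where c: "c \<noteq> 0" "w = ?s c u" using K.span_singleton_eq_iff[OF u] eq by blast
      then have "conic_vector scale f\<^sub>1 f\<^sub>2 f\<^sub>3 w = scale (c\<^sup>2) (conic_vector scale f\<^sub>1 f\<^sub>2 f\<^sub>3 u)"
        by (cases u) (simp add: prod_scale_eq conic_vector_scale)
      then show ?thesis using c span_singleton_eq_iff[OF cn[OF u]] by (metis power_not_zero)
    qed
    \<comment> \<open>\<open>conic_vector\<close> is quadratic in the parameters, so substituting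
      the basis \<open>a\<close>, \<open>b\<close> of the parameter plane gives a parametrisation of
      the same shape with new coefficient vectors.\<close>
    define g1 where "g1 = conic_vector scale f\<^sub>1 f\<^sub>2 f\<^sub>3 a"
    define g3 where "g3 = conic_vector scale f\<^sub>1 f\<^sub>2 f\<^sub>3 b"
    define g2 where "g2 = conic_vector scale f\<^sub>1 f\<^sub>2 f\<^sub>3 (a + b) - g1 - g3"
    have par: "conic_vector scale f\<^sub>1 f\<^sub>2 f\<^sub>3 (?s x a + ?s y b) = scale (x\<^sup>2) g1 + scale (x * y) g2 + scale (y\<^sup>2) g3" for x y
      by (cases a; cases b) (simp add: g1_def g2_def g3_def prod_scale_eq conic_vector_def algebra_simps power2_eq_square)
    have e1n: "e\<^sub>1 \<noteq> 0" using ind0[of 1 0 0] by auto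
    have e3n: "e\<^sub>3 \<noteq> 0" using ind0[of 0 0 1] by auto
    have e123: "e\<^sub>1 + e\<^sub>2 + e\<^sub>3 \<noteq> 0" using ind0[of 1 1 1] by auto
    have e4: "scale (r0\<^sup>2) e\<^sub>1 + scale r0 e\<^sub>2 + e\<^sub>3 \<noteq> 0" using ind0[of "r0\<^sup>2" r0 1] by auto
    have p: "span {e\<^sub>1} = span {g1}" "span {e\<^sub>3} = span {g3}" "span {e\<^sub>1 + e\<^sub>2 + e\<^sub>3} = span {g1 + g2 + g3}"
      "span {scale (r0\<^sup>2) e\<^sub>1 + scale r0 e\<^sub>2 + e\<^sub>3} = span {scale (r\<^sup>2) g1 + scale r g2 + g3}"
      using pu sp[OF ab(4) un(1)] sp[OF ab(5) un(2)] sp[OF ab(6) un(3)] sp[OF ab(7) un(4)]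
        par[of r 1] by (simp_all add: g1_def g2_def g3_def prod_scale_eq)
    obtain l where l: "l \<noteq> 0" "g1 = scale l e\<^sub>1" using p(1) span_singleton_eq_iff[OF e1n] by blast
    obtain m where m: "m \<noteq> 0" "g3 = scale m e\<^sub>3" using p(2) span_singleton_eq_iff[OF e3n] by blast
    obtain k where k: "k \<noteq> 0" "g1 + g2 + g3 = scale k (e\<^sub>1 + e\<^sub>2 + e\<^sub>3)"
      using p(3) span_singleton_eq_iff[OF e123] by blast
    obtain t where t: "t \<noteq> 0" "scale (r\<^sup>2) g1 + scale r g2 + g3 = scale t (scale (r0\<^sup>2) e\<^sub>1 + scale r0 e\<^sub>2 + e\<^sub>3)"
      using p(4) span_singleton_eq_iff[OF e4] by blast
    have g2: "g2 = scale (k - l) e\<^sub>1 + scale k e\<^sub>2 + scale (k - m) e\<^sub>3"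
    proof -
      have "g2 = scale k (e\<^sub>1 + e\<^sub>2 + e\<^sub>3) - g1 - g3" using k(2) by (simp add: algebra_simps)
      then show ?thesis using l m by (simp add: algebra_simps)
    qed
    have gx: "scale (x\<^sup>2) g1 + scale x g2 + g3
        = scale (x\<^sup>2 * l + x * (k - l)) e\<^sub>1 + scale (x * k) e\<^sub>2 + scale (x * (k - m) + m) e\<^sub>3" for x
      unfolding g2 l(2) m(2) by (simp add: algebra_simps)
    have req: "r\<^sup>2 * l + r * (k - l) = t * r0\<^sup>2 \<and> r * k = t * r0 \<and> r * (k - m) + m = t"
      by (rule ind, use t(2) gx[of r] in \<open>simp add: algebra_simps\<close>)
    \<comment> \<open>On the conic, the product of the outer coordinates is the square of the middle
      one. For the point with parameter \<open>x\<close> this is a polynomial identity with a factor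
      \<open>x\<close>, which is cancelled.\<close>
    have poly: "l * (k - m) * x\<^sup>2 + (l * m + (k - l) * (k - m) - k\<^sup>2) * x + m * (k - l) = 0" if x: "x \<noteq> 0" for x
    proof -
      have xb: "?s x a + b \<noteq> 0"
        using K.independent_2_iff[OF ab(1,2)] ab(3) by (metis K.scale_one one_neq_zero)
      have "conic_vector scale f\<^sub>1 f\<^sub>2 f\<^sub>3 (?s x a + b) = scale (x\<^sup>2) g1 + scale x g2 + g3"
        using par[of x 1] by (simp add: prod_scale_eq)
      moreover have "span {conic_vector scale f\<^sub>1 f\<^sub>2 f\<^sub>3 (?s x a + b)} \<in> C"
        unfolding Cf using xb by blast
      ultimately have "span {scale (x\<^sup>2) g1 + scale x g2 + g3} \<in> C" by simp
      then obtain u where "u \<noteq> 0" "span {conic_vector scale e\<^sub>1 e\<^sub>2 e\<^sub>3 u} = span {scale (x\<^sup>2) g1 + scale x g2 + g3}"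
        unfolding C by blast
      moreover have "conic_vector scale e\<^sub>1 e\<^sub>2 e\<^sub>3 u \<noteq> 0" if "u \<noteq> 0" for u
        using ind0[of "(fst u)\<^sup>2" "fst u * snd u" "(snd u)\<^sup>2"] that
        by (cases u) (auto simp: conic_vector_def zero_prod_def)
      ultimately obtain c where "scale (x\<^sup>2) g1 + scale x g2 + g3 = scale c (conic_vector scale e\<^sub>1 e\<^sub>2 e\<^sub>3 u)"
        using span_singleton_eq_iff by metis
      then have "x\<^sup>2 * l + x * (k - l) = c * (fst u)\<^sup>2 \<and> x * k = c * (fst u * snd u) \<and> x * (k - m) + m = c * (snd u)\<^sup>2"
        by (intro ind) (use gx[of x] in \<open>simp add: algebra_simps conic_vector_def\<close>)
      then have "(x\<^sup>2 * l + x * (k - l)) * (x * (k - m) + m) = (x * k)\<^sup>2"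
        by (simp add: power2_eq_square)
      then have "x * (l * (k - m) * x\<^sup>2 + (l * m + (k - l) * (k - m) - k\<^sup>2) * x + m * (k - l)) = 0"
        by algebra
      then show ?thesis using x by simp
    qed
    \<comment> \<open>A quadratic polynomial with the three zeros 1, \<open>r0\<close> and a further
      nonzero \<open>x\<close> is zero. If there is no such \<open>x\<close>, the field is
      \<open>{0, 1, r0}\<close>, and it suffices that \<open>r\<close> is neither 0 nor 1.\<close>
    show "r = r0"
    proof (cases "\<exists>x. x \<noteq> 0 \<and> x \<noteq> 1 \<and> x \<noteq> r0")
      case True
      then obtain x where "x \<noteq> 0" "x \<noteq> 1" "x \<noteq> r0" by blast
      then have "l * (k - m) = 0 \<and> m * (k - l) = 0"
        using quadratic_zero_coeffs[OF poly[of 1] poly[of r0] poly[of x]] r0 by simp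
      then have "k = m" "k = l" using l m by auto
      then show ?thesis using req k by auto
    next
      case False
      moreover have "r \<noteq> 0" using req t r0 by auto
      moreover have "r \<noteq> 1" using req t r0 by (auto simp: power2_eq_square)
      ultimately show ?thesis by blast
    qed
  qed
qed

end

section \<open>Dimensions of images and products\<close>

lemma (in vector_space_pair) has_dimension_image:
  assumes f: "Vector_Spaces.linear s1 s2 f" and i: "inj_on f U" and U: "has_dimension s1 n U"
  shows "has_dimension s2 n (f ` U)"
proof -
  interpret f: Vector_Spaces.linear s1 s2 f by (rule f)
  obtain E where E: "finite E" "card E = n" "vs1.independent E" "vs1.span E = U"
    using U unfolding has_dimension_def by blast
  have "vs2.independent (f ` E)" using f.independent_injective_image E i by blast
  moreover have "vs2.span (f ` E) = f ` U" using f.span_image E by simp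
  moreover have "card (f ` E) = n"
    using E i by (metis card_image inj_on_subset vs1.span_superset)
  ultimately show ?thesis using E(1) unfolding has_dimension_def by blast
qed

lemma (in vector_space_prod) has_dimension_prod:
  assumes "has_dimension s1 n UNIV" "has_dimension s2 m UNIV"
  shows "has_dimension scale (n + m) UNIV"
proof -
  have l1: "Vector_Spaces.linear s1 scale (\<lambda>x. (x, 0))" and l2: "Vector_Spaces.linear s2 scale (\<lambda>y. (0, y))"
    unfolding Vector_Spaces.linear_iff
    using vs1.vector_space_axioms vs2.vector_space_axioms p.vector_space_axioms
    by (auto simp: scale_prod)
  interpret A: vector_space_pair s1 scale by unfold_locales
  interpret B: vector_space_pair s2 scale by unfold_locales
  have "has_dimension scale n (range (\<lambda>x. (x, 0)))" "has_dimension scale m (range (\<lambda>y. (0, y)))"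
    using A.has_dimension_image[OF l1 _ assms(1)] B.has_dimension_image[OF l2 _ assms(2)]
    by (auto intro: injI)
  from p.has_dimension_sum[OF this]
  have "has_dimension scale (n + m) (p.span (range (\<lambda>x. (x, 0)) \<union> range (\<lambda>y. (0, y))))"
    by (auto simp: zero_prod_def)
  moreover have "(x, y) \<in> p.span (range (\<lambda>x. (x, 0)) \<union> range (\<lambda>y. (0, y)))" for x y
    using p.span_add[of "(x, 0)" "range (\<lambda>x. (x, 0)) \<union> range (\<lambda>y. (0, y))" "(0, y)"]
    by (auto simp: p.span_base)
  then have "p.span (range (\<lambda>x. (x, 0)) \<union> range (\<lambda>y. (0, y))) = UNIV" by auto
  ultimately show ?thesis by simp
qed

lemma vector_space_scale_prod:
    "vector_space s1 \<Longrightarrow> vector_space s2 \<Longrightarrow> vector_space (module_prod.scale s1 s2)"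
  and scale_prod_Pair:
    "vector_space s1 \<Longrightarrow> vector_space s2 \<Longrightarrow> module_prod.scale s1 s2 k (a, b) = (s1 k a, s2 k b)"
  and has_dimension_scale_prod:
    "vector_space s1 \<Longrightarrow> vector_space s2 \<Longrightarrow> has_dimension s1 n UNIV \<Longrightarrow> has_dimension s2 m UNIV \<Longrightarrow>
       has_dimension (module_prod.scale s1 s2) (n + m) UNIV"
proof -
  assume "vector_space s1" "vector_space s2"
  then interpret vector_space_prod s1 s2
    by (simp add: vector_space_prod_def vector_space_pair_def)
  show "vector_space scale" by unfold_locales
  show "scale k (a, b) = (s1 k a, s2 k b)" by (simp add: scale_prod)
  show "has_dimension s1 n UNIV \<Longrightarrow> has_dimension s2 m UNIV \<Longrightarrow> has_dimension scale (n + m) UNIV"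
    by (rule has_dimension_prod)
qed

lemma linear_comp:
  "Vector_Spaces.linear s1 s2 f \<Longrightarrow> Vector_Spaces.linear s2 s3 g \<Longrightarrow> Vector_Spaces.linear s1 s3 (g \<circ> f)"
  by (simp add: Vector_Spaces.linear_iff)

section \<open>Quadratic division algebras\<close>

locale quadratic_algebra =
  fixes scl :: "'k::field \<Rightarrow> 'b::ring_1 \<Rightarrow> 'b" and T N :: "'b \<Rightarrow> 'k"
  assumes qda: "quadratic_division_algebra scl T N"
begin

sublocale B: vector_space scl
  using qda by (simp add: quadratic_division_algebra_def)

lemma scl_mult_left [simp]: "scl k a * b = scl k (a * b)"
  using qda by (simp add: quadratic_division_algebra_def)

lemma scl_mult_right [simp]: "a * scl k b = scl k (a * b)"
  using qda by (metis quadratic_division_algebra_def)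

lemma T_linear: "Vector_Spaces.linear scl (*) T"
  using qda by (simp add: quadratic_division_algebra_def)

lemma T_add: "T (a + b) = T a + T b" and T_scl: "T (scl k a) = k * T a"
  using T_linear by (simp_all add: Vector_Spaces.linear_iff)

lemma T_one [simp]: "T 1 = 2"
  using qda by (simp add: quadratic_division_algebra_def)

lemma T_zero [simp]: "T 0 = 0"
  using T_scl[of 0 0] by simp

lemma T_minus: "T (- a) = - T a"
  using T_add[of a "- a"] by (simp add: eq_neg_iff_add_eq_0 add.commute)

lemma T_diff: "T (a - b) = T a - T b"
  using T_add[of a "- b"] by (simp add: T_minus)

lemma N_form: "quadratic_form_on scl UNIV N"
  using qda by (simp add: quadratic_division_algebra_def)

lemma N_scl: "N (scl k a) = k\<^sup>2 * N a"
  using N_form by (simp add: quadratic_form_on_def)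

lemma N_one [simp]: "N 1 = 1"
  using qda by (simp add: quadratic_division_algebra_def)

lemma N_zero [simp]: "N 0 = 0"
  using N_scl[of 0 0] by simp

lemma N_eq_0_iff [simp]: "N a = 0 \<longleftrightarrow> a = 0"
  using qda N_zero by (auto simp: quadratic_division_algebra_def)

lemma scl_one_inject [simp]: "scl k 1 = scl l 1 \<longleftrightarrow> k = l"
  by simp

definition cnj :: "'b \<Rightarrow> 'b" where "cnj a = scl (T a) 1 - a"

lemma mult_cnj: "a * cnj a = scl (N a) 1" and cnj_mult_self: "cnj a * a = scl (N a) 1"
proof -
  have "a\<^sup>2 - scl (T a) a + scl (N a) 1 = 0"
    using qda by (simp add: quadratic_division_algebra_def)
  then have "scl (N a) 1 = scl (T a) a - a * a"
    by (simp add: power2_eq_square algebra_simps)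
  then show "a * cnj a = scl (N a) 1" "cnj a * a = scl (N a) 1"
    by (simp_all add: cnj_def algebra_simps)
qed

lemma cnj_add: "cnj (a + b) = cnj a + cnj b"
  by (simp add: cnj_def T_add algebra_simps)

lemma cnj_scl: "cnj (scl k a) = scl k (cnj a)"
  by (simp add: cnj_def T_scl algebra_simps)

lemma cnj_one [simp]: "cnj 1 = 1"
  using B.scale_left_distrib[of 1 1 1] by (simp add: cnj_def)

lemma cnj_zero [simp]: "cnj 0 = 0"
  by (simp add: cnj_def)

lemma cnj_minus: "cnj (- a) = - cnj a"
  by (simp add: cnj_def T_minus)

lemma cnj_diff: "cnj (a - b) = cnj a - cnj b"
  by (simp add: cnj_def T_diff algebra_simps)

lemma T_cnj [simp]: "T (cnj a) = T a"
  by (simp add: cnj_def T_diff T_scl)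

lemma cnj_cnj [simp]: "cnj (cnj a) = a"
  by (simp add: cnj_def T_diff T_scl)

lemma cnj_eq_0_iff [simp]: "cnj a = 0 \<longleftrightarrow> a = 0"
  using cnj_cnj[of a] by fastforce

lemma N_cnj [simp]: "N (cnj a) = N a"
  using mult_cnj[of "cnj a"] cnj_mult_self[of a] by simp

definition binv :: "'b \<Rightarrow> 'b" where "binv a = scl (inverse (N a)) (cnj a)"

lemma binv_right [simp]: "a \<noteq> 0 \<Longrightarrow> a * binv a = 1" and binv_left [simp]: "a \<noteq> 0 \<Longrightarrow> binv a * a = 1"
  by (simp_all add: binv_def mult_cnj cnj_mult_self)

lemma binv_right' [simp]: "a \<noteq> 0 \<Longrightarrow> a * (binv a * b) = b" and binv_left' [simp]: "a \<noteq> 0 \<Longrightarrow> binv a * (a * b) = b"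
  by (simp_all flip: mult.assoc)

lemma B_mult_eq_0_iff [simp]: "(a :: 'b) * b = 0 \<longleftrightarrow> a = 0 \<or> b = 0"
  by (metis binv_left' mult_zero_left mult_zero_right)

lemma mult_cnj_left: "a * (cnj a * b) = scl (N a) b" and cnj_mult_left: "cnj a * (a * b) = scl (N a) b"
  by (simp_all add: mult_cnj cnj_mult_self flip: mult.assoc)

lemma polar_N: "scl (polar_form N a b) 1 = a * cnj b + b * cnj a"
proof -
  have "scl (N (a + b)) 1 = scl (N a) 1 + scl (N b) 1 + (a * cnj b + b * cnj a)"
    by (simp add: mult_cnj[symmetric] cnj_add algebra_simps)
  then show ?thesis by (simp add: polar_form_def algebra_simps)
qed

text \<open>Multiplicativity of the norm is not among the axioms, so it cannot be used here. With
  \<open>k\<close> as defined below, \<open>a * b\<close> satisfies one quadratic equation with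
  linear coefficient \<open>k\<close> and, by the axiom, another with \<open>T (a * b)\<close>. If
  these differ, subtracting makes \<open>a * b\<close> a scalar, hence \<open>b\<close> a scalar
  multiple of \<open>cnj a\<close>, and for such \<open>b\<close> the two coefficients agree by
  computation.\<close>

lemma cnj_mult: "cnj (a * b) = cnj b * cnj a"
proof -
  define k where "k = T a * T b - polar_form N a b"
  have k: "cnj b * cnj a = scl k 1 - a * b"
    unfolding k_def B.scale_left_diff_distrib polar_N by (simp add: cnj_def algebra_simps)
  have "T (a * b) = k"
  proof (cases "a = 0")
    case True
    then have "scl k 1 = 0" using k by simp
    then show ?thesis using True by simp
  next
    case a: False
    have e1: "scl k (a * b) - a * b * (a * b) = scl (N a * N b) 1"
    proof -
      have "a * b * (cnj b * cnj a) = scl (N a * N b) 1"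
        by (simp add: mult.assoc mult_cnj_left mult_cnj mult.commute)
      then show ?thesis unfolding k by (simp add: algebra_simps)
    qed
    have e2: "scl (T (a * b)) (a * b) - a * b * (a * b) = scl (N (a * b)) 1"
      using mult_cnj[of "a * b"] by (simp add: cnj_def algebra_simps)
    have e3: "scl (T (a * b) - k) (a * b) = scl (N (a * b) - N a * N b) 1"
      using e1 e2 by (simp add: algebra_simps)
    show ?thesis
    proof (rule ccontr)
      assume ne: "T (a * b) \<noteq> k"
      define l where "l = (N (a * b) - N a * N b) / (T (a * b) - k)"
      have "scl (inverse (T (a * b) - k)) (scl (T (a * b) - k) (a * b)) = scl l 1"
        unfolding e3 l_def by (simp only: B.scale_scale divide_inverse mult.commute)
      then have ab: "a * b = scl l 1" using ne by simp
      then have "binv a * (a * b) = scl l (binv a)" by simp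
      then have "b = scl l (binv a)" using a by simp
      then have b: "b = scl (l / N a) (cnj a)" by (simp add: binv_def divide_inverse)
      have "scl k 1 = scl (2 * l) 1"
      proof -
        have "cnj b * cnj a = scl (l / N a) (a * cnj a)" using b by (simp add: cnj_scl)
        then have "cnj b * cnj a = scl l 1" using a by (simp add: mult_cnj)
        then show ?thesis using k ab by (simp add: algebra_simps flip: B.scale_left_distrib)
      qed
      then show False using ne ab by (simp add: T_scl)
    qed
  qed
  then show ?thesis using k by (simp add: cnj_def)
qed

lemma N_mult: "N (a * b) = N a * N b"
proof -
  have "scl (N (a * b)) 1 = scl (N a * N b) 1"
    using mult_cnj[of "a * b"] by (simp add: cnj_mult mult.assoc mult_cnj_left mult_cnj mult.commute)
  then show ?thesis by simp
qed

lemma T_eq: "scl (T a) 1 = a + cnj a"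
  by (simp add: cnj_def)

lemma N_add: "N (a + b) = N a + N b + T (a * cnj b)"
proof -
  have "scl (polar_form N a b) 1 = scl (T (a * cnj b)) 1"
    unfolding polar_N T_eq by (simp add: cnj_mult)
  then have "polar_form N a b = T (a * cnj b)" by (simp only: scl_one_inject)
  then show ?thesis by (simp add: polar_form_def algebra_simps)
qed

lemmas cnj_simps = cnj_add cnj_diff cnj_minus cnj_mult cnj_scl

section \<open>The projective line and plane over a quadratic division algebra\<close>

text \<open>Elimination for the matrix with columns \<open>(a\<^sub>1, a\<^sub>2)\<close> and
  \<open>(b\<^sub>1, b\<^sub>2)\<close>, which are right independent; \<open>(p, q)\<close> and
  \<open>(p', q')\<close> are the rows of the inverse. The pivot \<open>\<delta>\<close> is the
  Schur complement: if it were zero, the second column would be a right multiple of the first. For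
  \<open>a\<^sub>1 = 0\<close> the matrix is triangular after a row exchange.\<close>

lemma matrix_2_inverse:
  fixes a\<^sub>1 a\<^sub>2 b\<^sub>1 b\<^sub>2 :: 'b
  assumes "a\<^sub>1 \<noteq> 0 \<or> a\<^sub>2 \<noteq> 0" and "\<nexists>r. b\<^sub>1 = a\<^sub>1 * r \<and> b\<^sub>2 = a\<^sub>2 * r"
  obtains p q p' q' where
    "p * a\<^sub>1 + q * a\<^sub>2 = 1" "p * b\<^sub>1 + q * b\<^sub>2 = 0" "p' * a\<^sub>1 + q' * a\<^sub>2 = 0" "p' * b\<^sub>1 + q' * b\<^sub>2 = 1"
    "a\<^sub>1 * p + b\<^sub>1 * p' = 1" "a\<^sub>1 * q + b\<^sub>1 * q' = 0" "a\<^sub>2 * p + b\<^sub>2 * p' = 0" "a\<^sub>2 * q + b\<^sub>2 * q' = 1"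
proof (cases "a\<^sub>1 = 0")
  case False
  define i where "i = binv a\<^sub>1"
  define \<delta> where "\<delta> = b\<^sub>2 - a\<^sub>2 * i * b\<^sub>1"
  define j where "j = binv \<delta>"
  have i: "a\<^sub>1 * i = 1" "i * a\<^sub>1 = 1" "\<And>x. a\<^sub>1 * (i * x) = x" "\<And>x. i * (a\<^sub>1 * x) = x"
    using False by (simp_all add: i_def)
  have "\<delta> \<noteq> 0"
  proof
    assume "\<delta> = 0"
    then have "b\<^sub>1 = a\<^sub>1 * (i * b\<^sub>1) \<and> b\<^sub>2 = a\<^sub>2 * (i * b\<^sub>1)"
      by (simp add: \<delta>_def mult.assoc i)
    then show False using assms(2) by blast
  qed
  then have j: "\<delta> * j = 1" "j * \<delta> = 1" by (simp_all add: j_def)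
  then have jb: "j * b\<^sub>2 = 1 + j * (a\<^sub>2 * (i * b\<^sub>1))" "b\<^sub>2 * j = 1 + a\<^sub>2 * (i * (b\<^sub>1 * j))"
    by (simp_all add: \<delta>_def algebra_simps)
  have jb': "b\<^sub>2 * (j * x) = x + a\<^sub>2 * (i * (b\<^sub>1 * (j * x)))" for x
    using arg_cong[OF jb(2), of "\<lambda>z. z * x"] by (simp add: algebra_simps)
  show thesis
    by (rule that[of "i + i * b\<^sub>1 * j * a\<^sub>2 * i" "- i * b\<^sub>1 * j" "- j * a\<^sub>2 * i" j])
       (simp_all add: algebra_simps i jb jb')
next
  case True
  then have a2: "a\<^sub>2 \<noteq> 0" using assms by simp
  have b1: "b\<^sub>1 \<noteq> 0"
  proof
    assume "b\<^sub>1 = 0"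
    then have "b\<^sub>1 = a\<^sub>1 * (binv a\<^sub>2 * b\<^sub>2) \<and> b\<^sub>2 = a\<^sub>2 * (binv a\<^sub>2 * b\<^sub>2)" using True a2 by simp
    then show False using assms(2) by blast
  qed
  show thesis
    by (rule that[of "- binv a\<^sub>2 * b\<^sub>2 * binv b\<^sub>1" "binv a\<^sub>2" "binv b\<^sub>1" 0])
       (use True a2 b1 in \<open>simp_all add: mult.assoc\<close>)
qed

section \<open>The Hermitian product and frames of lines\<close>

definition rmul :: "'b \<times> 'b \<times> 'b \<Rightarrow> 'b \<Rightarrow> 'b \<times> 'b \<times> 'b" where
  "rmul u r = (fst u * r, fst (snd u) * r, snd (snd u) * r)"

definition hprod :: "'b \<times> 'b \<times> 'b \<Rightarrow> 'b \<times> 'b \<times> 'b \<Rightarrow> 'b" where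
  "hprod u w = cnj (fst u) * fst w + cnj (fst (snd u)) * fst (snd w) + cnj (snd (snd u)) * snd (snd w)"

lemma rmul_Pair [simp]: "rmul (x, y, z) r = (x * r, y * r, z * r)"
  by (simp add: rmul_def)

lemma hprod_Pair [simp]: "hprod (x, y, z) (x', y', z') = cnj x * x' + cnj y * y' + cnj z * z'"
  by (simp add: hprod_def)

lemma rmul_rmul [simp]: "rmul (rmul u r) r' = rmul u (r * r')"
  by (simp add: rmul_def mult.assoc)

lemma rmul_one [simp]: "rmul u 1 = u" and rmul_zero [simp]: "rmul u 0 = 0" "rmul 0 r = 0"
  by (simp_all add: rmul_def zero_prod_def)

lemma rmul_add: "rmul (u + w) r = rmul u r + rmul w r" and rmul_add_right: "rmul u (r + r') = rmul u r + rmul u r'"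
  by (simp_all add: rmul_def algebra_simps)

lemma rmul_eq_0_iff [simp]: "rmul u r = 0 \<longleftrightarrow> u = 0 \<or> r = 0"
  by (cases u) (auto simp: zero_prod_def)

lemma hprod_add: "hprod (u + u') w = hprod u w + hprod u' w" and
  hprod_add_right: "hprod u (w + w') = hprod u w + hprod u w'"
  by (simp_all add: hprod_def cnj_simps algebra_simps)

lemma hprod_diff_right: "hprod u (w - w') = hprod u w - hprod u w'"
  by (simp_all add: hprod_def cnj_simps algebra_simps)

lemma hprod_zero [simp]: "hprod 0 w = 0" "hprod u 0 = 0"
  by (simp_all add: hprod_def)

lemma hprod_rmul: "hprod (rmul u r) w = cnj r * hprod u w" and
  hprod_rmul_right: "hprod u (rmul w r) = hprod u w * r"
  by (simp_all add: hprod_def rmul_def cnj_simps algebra_simps)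

lemma cnj_hprod: "cnj (hprod u w) = hprod w u"
  by (simp add: hprod_def cnj_simps)

lemma hprod_eq_0_commute: "hprod u w = 0 \<longleftrightarrow> hprod w u = 0"
  by (metis cnj_eq_0_iff cnj_hprod)

lemma hprod_nondegenerate: "u \<noteq> 0 \<Longrightarrow> \<exists>t. hprod u t \<noteq> 0"
proof -
  assume "u \<noteq> 0"
  then obtain x y z where u: "u = (x, y, z)" "x \<noteq> 0 \<or> y \<noteq> 0 \<or> z \<noteq> 0"
    by (cases u) (auto simp: zero_prod_def)
  have "hprod u (1, 0, 0) = cnj x" "hprod u (0, 1, 0) = cnj y" "hprod u (0, 0, 1) = cnj z"
    using u by simp_all
  then show ?thesis using u(2) by (metis cnj_eq_0_iff)
qed

text \<open>\<open>u\<close>, \<open>w\<close> is a basis of the line with row \<open>m*\<close>,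
  and \<open>t\<close>, \<open>t'\<close> are dual vectors that read off its coordinates. The basis
  cannot be its own dual in general: \<open>hprod\<close> may have isotropic vectors, such as
  \<open>(1, i, 0)\<close> over the complex numbers with trivial conjugation.\<close>

definition frame ::
  "'b \<times> 'b \<times> 'b \<Rightarrow> 'b \<times> 'b \<times> 'b \<Rightarrow> 'b \<times> 'b \<times> 'b \<Rightarrow> 'b \<times> 'b \<times> 'b \<Rightarrow> 'b \<times> 'b \<times> 'b \<Rightarrow> bool" where
  "frame m u w t t' \<longleftrightarrow> m \<noteq> 0 \<and> hprod t u = 1 \<and> hprod t w = 0 \<and> hprod t' u = 0 \<and> hprod t' w = 1 \<and>
     (\<forall>p. hprod m p = 0 \<longleftrightarrow> (\<exists>\<alpha> \<beta>. p = rmul u \<alpha> + rmul w \<beta>))"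

lemma frameD:
  assumes "frame m u w t t'"
  shows "m \<noteq> 0" "hprod t u = 1" "hprod t w = 0" "hprod t' u = 0" "hprod t' w = 1"
    "hprod u t = 1" "hprod w t = 0" "hprod u t' = 0" "hprod w t' = 1"
    "hprod m p = 0 \<longleftrightarrow> (\<exists>\<alpha> \<beta>. p = rmul u \<alpha> + rmul w \<beta>)"
    "hprod m u = 0" "hprod m w = 0" "hprod u m = 0" "hprod w m = 0"
proof -
  have f: "m \<noteq> 0" "hprod t u = 1" "hprod t w = 0" "hprod t' u = 0" "hprod t' w = 1"
    "\<And>p. hprod m p = 0 \<longleftrightarrow> (\<exists>\<alpha> \<beta>. p = rmul u \<alpha> + rmul w \<beta>)"
    using assms unfolding frame_def by blast+
  have "\<exists>\<alpha> \<beta>. u = rmul u \<alpha> + rmul w \<beta>" by (rule exI[of _ 1], rule exI[of _ 0]) simp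
  then have u: "hprod m u = 0" using f by blast
  have "\<exists>\<alpha> \<beta>. w = rmul u \<alpha> + rmul w \<beta>" by (rule exI[of _ 0], rule exI[of _ 1]) simp
  then have w: "hprod m w = 0" using f by blast
  show "m \<noteq> 0" "hprod t u = 1" "hprod t w = 0" "hprod t' u = 0" "hprod t' w = 1"
    "hprod u t = 1" "hprod w t = 0" "hprod u t' = 0" "hprod w t' = 1"
    "hprod m p = 0 \<longleftrightarrow> (\<exists>\<alpha> \<beta>. p = rmul u \<alpha> + rmul w \<beta>)"
    "hprod m u = 0" "hprod m w = 0" "hprod u m = 0" "hprod w m = 0"
    using f(1-5) u w cnj_hprod[of t u] cnj_hprod[of t w] cnj_hprod[of t' u] cnj_hprod[of t' w]
      hprod_eq_0_commute[of m u] hprod_eq_0_commute[of m w] f(6)[of p]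
    by simp_all
qed

text \<open>This and the next two are the normal forms of lines in \<open>G2_lines\<close>.
  Conjugates appear because the coordinates of a line are the row \<open>m*\<close>.\<close>

lemma frame_normal_1: "frame (a, 1, c) (1, - cnj a, 0) (0, - cnj c, 1) (1, 0, 0) (0, 0, 1)"
proof -
  have "hprod (a, 1, c) p = 0 \<longleftrightarrow> (\<exists>\<alpha> \<beta>. p = rmul (1, - cnj a, 0) \<alpha> + rmul (0, - cnj c, 1) \<beta>)" for p
    by (cases p) (auto simp: algebra_simps eq_neg_iff_add_eq_0)
  then show ?thesis by (simp add: frame_def zero_prod_def)
qed

lemma frame_normal_2: "frame (1, 0, c) (0, 1, 0) (- cnj c, 0, 1) (0, 1, 0) (0, 0, 1)"
proof -
  have "hprod (1, 0, c) p = 0 \<longleftrightarrow> (\<exists>\<alpha> \<beta>. p = rmul (0, 1, 0) \<alpha> + rmul (- cnj c, 0, 1) \<beta>)" for p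
    by (cases p) (auto simp: algebra_simps eq_neg_iff_add_eq_0)
  then show ?thesis by (simp add: frame_def zero_prod_def)
qed

lemma frame_normal_3: "frame (0, 0, 1) (0, 1, 0) (1, 0, 0) (0, 1, 0) (1, 0, 0)"
proof -
  have "hprod (0, 0, 1) p = 0 \<longleftrightarrow> (\<exists>\<alpha> \<beta>. p = rmul (0, 1, 0) \<alpha> + rmul (1, 0, 0) \<beta>)" for p
    by (cases p) auto
  then show ?thesis by (simp add: frame_def zero_prod_def)
qed

lemma normal_form_line:
  assumes "m \<noteq> 0"
  obtains (1) a c r where "m = rmul (a, 1, c) r" "r \<noteq> 0"
    | (2) c r where "m = rmul (1, 0, c) r" "r \<noteq> 0"
    | (3) r where "m = rmul (0, 0, 1) r" "r \<noteq> 0"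
proof -
  obtain x y z where m: "m = (x, y, z)" by (cases m)
  consider "y \<noteq> 0" | "y = 0" "x \<noteq> 0" | "y = 0" "x = 0" "z \<noteq> 0"
    using assms m by (auto simp: zero_prod_def)
  then show thesis
  proof cases
    case 1
    then have "m = rmul (x * binv y, 1, z * binv y) y" by (simp add: m mult.assoc)
    then show thesis using that(1) 1 by blast
  next
    case 2
    then have "m = rmul (1, 0, z * binv x) x" by (simp add: m mult.assoc)
    then show thesis using that(2) 2 by blast
  next
    case 3
    then have "m = rmul (0, 0, 1) z" by (simp add: m)
    then show thesis using that(3) 3 by blast
  qed
qed

lemma normal_form_point:
  assumes "p \<noteq> 0"
  obtains (1) x y r where "p = rmul (x, y, 1) r" "r \<noteq> 0"
    | (2) y r where "p = rmul (1, y, 0) r" "r \<noteq> 0"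
    | (3) r where "p = rmul (0, 1, 0) r" "r \<noteq> 0"
proof -
  obtain x y z where m: "p = (x, y, z)" by (cases p)
  consider "z \<noteq> 0" | "z = 0" "x \<noteq> 0" | "z = 0" "x = 0" "y \<noteq> 0"
    using assms m by (auto simp: zero_prod_def)
  then show thesis
  proof cases
    case 1
    then have "p = rmul (x * binv z, y * binv z, 1) z" by (simp add: m mult.assoc)
    then show thesis using that(1) 1 by blast
  next
    case 2
    then have "p = rmul (1, y * binv x, 0) x" by (simp add: m mult.assoc)
    then show thesis using that(2) 2 by blast
  next
    case 3
    then have "p = rmul (0, 1, 0) y" by (simp add: m)
    then show thesis using that(3) 3 by blast
  qed
qed

lemma frame_rmul: "frame m u w t t' \<Longrightarrow> r \<noteq> 0 \<Longrightarrow> frame (rmul m r) u w t t'"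
  by (simp add: frame_def hprod_rmul)

lemma frame_exists:
  assumes "m \<noteq> 0" obtains u w t t' where "frame m u w t t'"
  using assms
  by (cases rule: normal_form_line) (metis frame_rmul frame_normal_1 frame_normal_2 frame_normal_3)+

text \<open>In normal form, \<open>m\<close> has two explicit orthogonal vectors; orthogonality of
  \<open>\<tau>\<close> to these two expresses all its entries through one of them, which yields the
  factor.\<close>

lemma perp_perp:
  assumes m: "m \<noteq> 0" and \<tau>: "\<And>p. hprod m p = 0 \<Longrightarrow> hprod p \<tau> = 0"
  obtains r where "\<tau> = rmul m r"
proof -
  obtain x y z where t: "\<tau> = (x, y, z)" by (cases \<tau>)
  from m show thesis
  proof (cases rule: normal_form_line)
    case (1 a c r)
    have "hprod m (1, - cnj a, 0) = 0" "hprod m (0, - cnj c, 1) = 0"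
      using 1 by (simp_all only: hprod_rmul frameD[OF frame_normal_1]) simp_all
    then have "hprod (1, - cnj a, 0) \<tau> = 0" "hprod (0, - cnj c, 1) \<tau> = 0" using \<tau> by blast+
    then have "\<tau> = rmul m (binv r * y)" using 1 by (simp add: t cnj_simps mult.assoc)
    then show thesis by (rule that)
  next
    case (2 c r)
    have "hprod m (0, 1, 0) = 0" "hprod m (- cnj c, 0, 1) = 0"
      using 2 by (simp_all only: hprod_rmul frameD[OF frame_normal_2]) simp_all
    then have "hprod (0, 1, 0) \<tau> = 0" "hprod (- cnj c, 0, 1) \<tau> = 0" using \<tau> by blast+
    then have "\<tau> = rmul m (binv r * x)" using 2 by (simp add: t cnj_simps mult.assoc)
    then show thesis by (rule that)
  next
    case (3 r)
    have "hprod m (1, 0, 0) = 0" "hprod m (0, 1, 0) = 0"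
      using 3 by (simp_all only: hprod_rmul frameD[OF frame_normal_3]) simp_all
    then have "hprod (1, 0, 0) \<tau> = 0" "hprod (0, 1, 0) \<tau> = 0" using \<tau> by blast+
    then have "\<tau> = rmul m (binv r * z)" using 3 by (simp add: t mult.assoc)
    then show thesis by (rule that)
  qed
qed

lemma frame_kernel:
  assumes f: "frame m u w t t'" and "hprod u \<tau> = 0" "hprod w \<tau> = 0"
  obtains r where "\<tau> = rmul m r"
proof -
  have "hprod p \<tau> = 0" if "hprod m p = 0" for p
    using that assms by (auto simp: frameD(10)[OF f] hprod_add hprod_rmul)
  then show thesis using perp_perp frameD(1)[OF f] that by blast
qed

lemma frame_unique:
  assumes f: "frame m u w t t'" and e: "rmul u \<alpha> + rmul w \<beta> = rmul u \<alpha>' + rmul w \<beta>'"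
  shows "\<alpha> = \<alpha>' \<and> \<beta> = \<beta>'"
  using arg_cong[OF e, of "hprod t"] arg_cong[OF e, of "hprod t'"]
  by (simp add: frameD[OF f] hprod_add_right hprod_rmul_right)

text \<open>Any two independent points of a line can serve as the basis of a frame, since their
  coordinate matrix in a given frame is invertible.\<close>

lemma frame_of_points:
  assumes m: "m \<noteq> 0" and u: "hprod m u = 0" "u \<noteq> 0" and w: "hprod m w = 0" "\<nexists>r. w = rmul u r"
  obtains t t' where "frame m u w t t'"
proof -
  obtain u0 w0 t0 t0' where f: "frame m u0 w0 t0 t0'" using frame_exists m by blast
  obtain a1 a2 where ua: "u = rmul u0 a1 + rmul w0 a2" using u frameD(10)[OF f] by blast
  obtain b1 b2 where wb: "w = rmul u0 b1 + rmul w0 b2" using w frameD(10)[OF f] by blast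
  have 1: "a1 \<noteq> 0 \<or> a2 \<noteq> 0" using u ua by auto
  have 2: "\<nexists>r. b1 = a1 * r \<and> b2 = a2 * r"
  proof
    assume "\<exists>r. b1 = a1 * r \<and> b2 = a2 * r"
    then obtain r where "b1 = a1 * r" "b2 = a2 * r" by blast
    then have "w = rmul u r" using ua wb by (simp add: rmul_add)
    then show False using w by blast
  qed
  obtain p q p' q' where inv:
    "p * a1 + q * a2 = 1" "p * b1 + q * b2 = 0" "p' * a1 + q' * a2 = 0" "p' * b1 + q' * b2 = 1"
    "a1 * p + b1 * p' = 1" "a1 * q + b1 * q' = 0" "a2 * p + b2 * p' = 0" "a2 * q + b2 * q' = 1"
    using matrix_2_inverse[OF 1 2] by blast
  have "hprod m x = 0 \<longleftrightarrow> (\<exists>\<alpha> \<beta>. x = rmul u \<alpha> + rmul w \<beta>)" for x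
  proof
    assume "hprod m x = 0"
    then obtain \<alpha> \<beta> where x: "x = rmul u0 \<alpha> + rmul w0 \<beta>" using frameD(10)[OF f] by blast
    have "rmul u (p * \<alpha> + q * \<beta>) + rmul w (p' * \<alpha> + q' * \<beta>)
      = rmul u0 ((a1 * p + b1 * p') * \<alpha> + (a1 * q + b1 * q') * \<beta>)
        + rmul w0 ((a2 * p + b2 * p') * \<alpha> + (a2 * q + b2 * q') * \<beta>)"
      unfolding ua wb by (simp add: rmul_add rmul_add_right algebra_simps)
    also have "\<dots> = x" by (simp add: inv x)
    finally show "\<exists>\<alpha> \<beta>. x = rmul u \<alpha> + rmul w \<beta>" by metis
  next
    assume "\<exists>\<alpha> \<beta>. x = rmul u \<alpha> + rmul w \<beta>"
    then show "hprod m x = 0" using u w by (auto simp: hprod_add_right hprod_rmul_right)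
  qed
  \<comment> \<open>The dual basis transforms by the inverse matrix; its entries are conjugated
    because \<open>hprod\<close> is conjugate linear in the first argument.\<close>
  then have "frame m u w (rmul t0 (cnj p) + rmul t0' (cnj q)) (rmul t0 (cnj p') + rmul t0' (cnj q'))"
    using m unfolding frame_def ua wb
    by (simp add: hprod_add_right hprod_add hprod_rmul hprod_rmul_right frameD[OF f] inv)
  then show thesis by (rule that)
qed

text \<open>The solutions of the first equation have a basis with two vectors, on which the second
  is a single equation in two unknowns and has a nonzero solution. By symmetry of orthogonality this
  serves for joining points as well as for intersecting lines.\<close>

lemma line_through:
  assumes "p \<noteq> 0"
  obtains m where "m \<noteq> 0" "hprod p m = 0" "hprod p' m = 0"
proof -
  obtain u w t t' where f: "frame p u w t t'" using frame_exists assms by blast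
  define x y where "x = hprod p' u" and "y = hprod p' w"
  obtain \<alpha> \<beta> where ab: "\<alpha> \<noteq> 0 \<or> \<beta> \<noteq> 0" "x * \<alpha> + y * \<beta> = 0"
  proof (cases "y = 0")
    case True
    show thesis by (rule that[of 0 1]) (use True in auto)
  next
    case False
    show thesis by (rule that[of 1 "- binv y * x"]) (use False in auto)
  qed
  let ?m = "rmul u \<alpha> + rmul w \<beta>"
  have "?m \<noteq> 0" using frame_unique[OF f, of \<alpha> \<beta> 0 0] ab by auto
  moreover have "hprod p ?m = 0" using frameD(10)[OF f] by blast
  moreover have "hprod p' ?m = 0" using ab by (simp add: hprod_add_right hprod_rmul_right x_def y_def)
  ultimately show thesis by (rule that)
qed

end

section \<open>Regular spreads from the projective line over a quadratic division algebra\<close>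

locale quadratic_algebra_dim = quadratic_algebra scl T N
  for scl :: "'k::field \<Rightarrow> 'b::ring_1 \<Rightarrow> 'b" and T N :: "'b \<Rightarrow> 'k" +
  fixes d :: nat
  assumes dim_B: "has_dimension scl d UNIV"
begin

text \<open>Needed wherever \<open>d - 1\<close> occurs: it excludes that the subtraction is
  truncated.\<close>

lemma d_pos: "d > 0"
proof (rule ccontr)
  assume "\<not> d > 0"
  then have "(UNIV :: 'b set) = {0}" using dim_B by (auto simp: has_dimension_def)
  then have "(1 :: 'b) = 0" by blast
  then show False by simp
qed

sublocale B2: vector_space_prod scl scl by unfold_locales

sublocale B3: vector_space_prod scl "module_prod.scale scl scl"
  by unfold_locales

abbreviation scl2 where "scl2 \<equiv> module_prod.scale scl scl"
abbreviation scl3 where "scl3 \<equiv> module_prod.scale scl (module_prod.scale scl scl)"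

lemma dim_B2: "has_dimension scl2 (2 * d) UNIV"
  using B2.has_dimension_prod[OF dim_B dim_B] by (simp add: mult_2)

lemma dim_B3: "has_dimension scl3 (3 * d) UNIV"
  using B3.has_dimension_prod[OF dim_B dim_B2] by simp

abbreviation sclQ where "sclQ \<equiv> module_prod.scale (*) (module_prod.scale (*) scl)"

lemma scl2_Pair [simp]: "scl2 k (a, b) = (scl k a, scl k b)"
  by (simp add: B2.scale_prod)

lemma scl3_Pair [simp]: "scl3 k (a, b, c) = (scl k a, scl k b, scl k c)"
  by (simp add: B3.scale_prod)

text \<open>An interpretation of \<open>vector_space (*)\<close> is kept local to proofs: its simplification rules
  reassociate products.\<close>

lemma vector_space_mult: "vector_space ((*) :: 'k \<Rightarrow> 'k \<Rightarrow> 'k)"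
  by unfold_locales (auto simp: algebra_simps)

lemma vector_space_sclQ: "vector_space sclQ"
  and sclQ_Pair [simp]: "sclQ k (a, b, c) = (k * a, k * b, scl k c)"
proof -
  interpret K: vector_space "(*) :: 'k \<Rightarrow> 'k \<Rightarrow> 'k" by (rule vector_space_mult)
  interpret Q1: vector_space_prod "(*) :: 'k \<Rightarrow> 'k \<Rightarrow> 'k" scl by unfold_locales
  interpret Q: vector_space_prod "(*) :: 'k \<Rightarrow> 'k \<Rightarrow> 'k" "module_prod.scale (*) scl" by unfold_locales
  show "vector_space sclQ" by unfold_locales
  show "sclQ k (a, b, c) = (k * a, k * b, scl k c)" by (simp add: Q.scale_prod Q1.scale_prod)
qed

section \<open>The quadratic form of a line\<close>

definition isotropic :: "'k \<times> 'k \<times> 'b \<Rightarrow> bool" where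
  "isotropic k \<longleftrightarrow> fst k * fst (snd k) = N (snd (snd k))"

lemma isotropic_Pair [simp]: "isotropic (x, y, \<gamma>) \<longleftrightarrow> x * y = N \<gamma>"
  by (simp add: isotropic_def)

definition conic_form :: "'k \<times> 'k \<times> 'b \<Rightarrow> 'k" where
  "conic_form k = fst k * fst (snd k) - N (snd (snd k))"

lemma conic_form_Pair [simp]: "conic_form (x, y, \<gamma>) = x * y - N \<gamma>"
  by (simp add: conic_form_def)

lemma polar_conic_form: "polar_form conic_form (x, y, \<gamma>) (x', y', \<gamma>') = x * y' + x' * y - T (\<gamma> * cnj \<gamma>')"
  by (simp add: polar_form_def N_add algebra_simps)

lemma conic_form_scale: "conic_form (sclQ c k) = c\<^sup>2 * conic_form k"
  by (cases k) (simp add: N_scl power2_eq_square algebra_simps)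

lemma polar_conic_form_add:
  "polar_form conic_form (a + b) c = polar_form conic_form a c + polar_form conic_form b c"
  by (cases a; cases b; cases c) (simp add: polar_conic_form T_add algebra_simps)

lemma polar_conic_form_scale: "polar_form conic_form (sclQ k a) b = k * polar_form conic_form a b"
  by (cases a; cases b) (simp add: polar_conic_form T_scl right_diff_distrib distrib_left mult.assoc)

end

locale quadratic_algebra_space = quadratic_algebra_dim scl T N d + V: vector_space s
  for scl :: "'k::field \<Rightarrow> 'b::ring_1 \<Rightarrow> 'b" and T N :: "'b \<Rightarrow> 'k" and d
    and s :: "'k \<Rightarrow> 'v::ab_group_add \<Rightarrow> 'v"
begin

sublocale VP1: vector_space_pair scl s by unfold_locales
sublocale VP2: vector_space_pair scl2 s by unfold_locales

section \<open>Spreads and reguli in coordinates\<close>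

text \<open>The point \<open>(a, b)\<close> of the projective line over B, regarded as a K-subspace
  of a space with coordinates \<open>\<theta>\<close>.\<close>

definition spread_line :: "('b \<times> 'b \<Rightarrow> 'v) \<Rightarrow> 'b \<Rightarrow> 'b \<Rightarrow> 'v set" where
  "spread_line \<theta> a b = range (\<lambda>r. \<theta> (a * r, b * r))"

context
  fixes \<theta> :: "'b \<times> 'b \<Rightarrow> 'v"
  assumes \<theta>: "Vector_Spaces.linear scl2 s \<theta>" and inj: "inj \<theta>"
begin

interpretation \<theta>: Vector_Spaces.linear scl2 s \<theta> by (rule \<theta>)

lemma \<theta>_eq_0: "\<theta> x = 0 \<longleftrightarrow> x = 0"
  using inj \<theta>.zero by (metis injD)

lemma dim_range: "has_dimension s (2 * d) (range \<theta>)"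
  using VP2.has_dimension_image[OF \<theta> inj dim_B2] .

lemma linear_spread_line: "Vector_Spaces.linear scl s (\<lambda>r. \<theta> (a * r, b * r))"
proof -
  have "\<theta> (a * (r + r'), b * (r + r')) = \<theta> (a * r, b * r) + \<theta> (a * r', b * r')" for r r'
    using \<theta>.add[of "(a * r, b * r)" "(a * r', b * r')"] by (simp add: algebra_simps)
  moreover have "\<theta> (a * scl k r, b * scl k r) = s k (\<theta> (a * r, b * r))" for k r
    using \<theta>.scale[of k "(a * r, b * r)"] by simp
  ultimately show ?thesis
    unfolding Vector_Spaces.linear_iff using B.vector_space_axioms V.vector_space_axioms by blast
qed

lemma inj_spread_line:
  assumes "a \<noteq> 0 \<or> b \<noteq> 0" shows "inj (\<lambda>r. \<theta> (a * r, b * r))"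
proof (rule injI)
  fix r r'
  assume "\<theta> (a * r, b * r) = \<theta> (a * r', b * r')"
  then have "(a * r, b * r) = (a * r', b * r')" using inj injD by metis
  then have "a * (r - r') = 0" "b * (r - r') = 0" by (simp_all only: prod.inject right_diff_distrib diff_self)
  then show "r = r'" using assms by auto
qed

lemma dim_spread_line:
  assumes "a \<noteq> 0 \<or> b \<noteq> 0" shows "has_dimension s d (spread_line \<theta> a b)"
  unfolding spread_line_def
  using VP1.has_dimension_image[OF linear_spread_line _ dim_B] inj_spread_line[OF assms] by blast

lemma spread_line_subset: "spread_line \<theta> a b \<subseteq> range \<theta>"
  by (auto simp: spread_line_def)

lemma mem_spread_line: "\<theta> (x, y) \<in> spread_line \<theta> a b \<longleftrightarrow> (\<exists>r. x = a * r \<and> y = b * r)"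
proof -
  have "\<theta> (x, y) = \<theta> z \<longleftrightarrow> (x, y) = z" for z using inj injD by metis
  then show ?thesis by (auto simp: spread_line_def image_iff)
qed

lemma spread_line_rmul: "r \<noteq> 0 \<Longrightarrow> spread_line \<theta> (a * r) (b * r) = spread_line \<theta> a b"
proof -
  assume r: "r \<noteq> 0"
  have "(\<lambda>x. \<theta> (a * r * x, b * r * x)) = (\<lambda>x. \<theta> (a * x, b * x)) \<circ> (\<lambda>x. r * x)"
    by (simp add: fun_eq_iff mult.assoc)
  moreover have "range (\<lambda>x. r * x) = UNIV" using r by (intro surjI[of _ "\<lambda>x. binv r * x"]) simp
  ultimately show ?thesis unfolding spread_line_def by (simp only: image_comp[symmetric])
qed

lemma spread_line_eq_iff:
  assumes "a \<noteq> 0 \<or> b \<noteq> 0" "a' \<noteq> 0 \<or> b' \<noteq> 0"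
  shows "spread_line \<theta> a b = spread_line \<theta> a' b' \<longleftrightarrow> (\<exists>r. a' = a * r \<and> b' = b * r)"
proof
  assume "spread_line \<theta> a b = spread_line \<theta> a' b'"
  moreover have "\<theta> (a', b') \<in> spread_line \<theta> a' b'"
    unfolding mem_spread_line by (metis mult.right_neutral)
  ultimately show "\<exists>r. a' = a * r \<and> b' = b * r" using mem_spread_line by metis
next
  assume "\<exists>r. a' = a * r \<and> b' = b * r"
  then obtain r where "a' = a * r" "b' = b * r" by blast
  then show "spread_line \<theta> a b = spread_line \<theta> a' b'"
    using spread_line_rmul[of r a b] assms(2) by auto
qed

lemma spread_line_0: "0 \<in> spread_line \<theta> a b"
  using mem_spread_line[of 0 0 a b] \<theta>.zero by (auto simp: zero_prod_def)

text \<open>The vectors \<open>\<theta> (scl \<alpha> a, scl \<beta> a)\<close> are the pure tensors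
  of the product of \<open>K\<^sup>2\<close> with B. They form a Segre variety, whose two families
  of subspaces are \<open>\<kappa>_line\<close> (fixed \<open>a\<close>) and
  \<open>\<kappa>_member\<close> (fixed \<open>(\<alpha>, \<beta>)\<close>).\<close>

definition \<kappa>_line :: "'b \<Rightarrow> 'v set" where
  "\<kappa>_line a = {\<theta> (scl \<alpha> a, scl \<beta> a) | \<alpha> \<beta>. True}"

lemma \<theta>_scl: "\<theta> (scl \<alpha> a, scl \<beta> b) = s \<alpha> (\<theta> (a, 0)) + s \<beta> (\<theta> (0, b))"
  using \<theta>.add[of "(scl \<alpha> a, 0)" "(0, scl \<beta> b)"] \<theta>.scale[of \<alpha> "(a, 0)"] \<theta>.scale[of \<beta> "(0, b)"] by simp

lemma span_2_eq: "V.span {\<theta> (a, 0), \<theta> (0, b)} = {\<theta> (scl \<alpha> a, scl \<beta> b) | \<alpha> \<beta>. True}"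
proof -
  have "V.span {\<theta> (a, 0), \<theta> (0, b)} = {s \<alpha> (\<theta> (a, 0)) + s \<beta> (\<theta> (0, b)) | \<alpha> \<beta>. True}"
    using V.span_3[of "\<theta> (a, 0)" "\<theta> (0, b)" 0] by (simp add: insert_commute)
  then show ?thesis by (simp add: \<theta>_scl)
qed

lemma independent_2:
  assumes "a \<noteq> 0" "b \<noteq> 0"
  shows "V.independent {\<theta> (a, 0), \<theta> (0, b)} \<and> card {\<theta> (a, 0), \<theta> (0, b)} = 2"
proof -
  have n: "\<theta> (0, b) \<noteq> 0" using assms \<theta>_eq_0 by (simp add: zero_prod_def)
  have "\<theta> (a, 0) \<notin> V.span {\<theta> (0, b)}"
  proof
    assume "\<theta> (a, 0) \<in> V.span {\<theta> (0, b)}"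
    then obtain k where "\<theta> (a, 0) = s k (\<theta> (0, b))" unfolding V.span_singleton by blast
    then have "\<theta> (a, 0) = \<theta> (0, scl k b)" using \<theta>.scale[of k "(0, b)"] by simp
    then have "(a, 0) = (0, scl k b)" using inj injD by metis
    then show False using assms by simp
  qed
  then show ?thesis
    using n V.independent_insertI[of "\<theta> (a, 0)" "{\<theta> (0, b)}"] V.span_base[of _ "{\<theta> (0, b)}"]
    by (auto simp: card_insert_if)
qed

lemma dim_\<kappa>_line: "a \<noteq> 0 \<Longrightarrow> has_dimension s 2 (\<kappa>_line a)"
  unfolding has_dimension_def \<kappa>_line_def span_2_eq[symmetric]
  using independent_2[of a a] by (intro exI[of _ "{\<theta> (a, 0), \<theta> (0, a)}"]) simp

lemma \<kappa>_line_subset: "\<kappa>_line a \<subseteq> range \<theta>"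
  by (auto simp: \<kappa>_line_def)

definition \<kappa>_member :: "'k \<Rightarrow> 'k \<Rightarrow> 'v set" where
  "\<kappa>_member \<alpha> \<beta> = range (\<lambda>r. \<theta> (scl \<alpha> r, scl \<beta> r))"

lemma \<kappa>_member_eq: "\<kappa>_member \<alpha> \<beta> = spread_line \<theta> (scl \<alpha> 1) (scl \<beta> 1)"
  by (simp add: \<kappa>_member_def spread_line_def)

lemma \<kappa>_line_Int_member:
  assumes "\<alpha> \<noteq> 0 \<or> \<beta> \<noteq> 0" "a \<noteq> 0"
  shows "\<kappa>_line a \<inter> \<kappa>_member \<alpha> \<beta> = V.span {\<theta> (scl \<alpha> a, scl \<beta> a)}"
proof
  show "\<kappa>_line a \<inter> \<kappa>_member \<alpha> \<beta> \<subseteq> V.span {\<theta> (scl \<alpha> a, scl \<beta> a)}"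
  proof
    fix x assume "x \<in> \<kappa>_line a \<inter> \<kappa>_member \<alpha> \<beta>"
    then obtain y z c where x: "x = \<theta> (scl y a, scl z a)" "x = \<theta> (scl \<alpha> c, scl \<beta> c)"
      by (auto simp: \<kappa>_line_def \<kappa>_member_def)
    then have "(scl y a, scl z a) = (scl \<alpha> c, scl \<beta> c)" using inj injD by metis
    then have e: "scl y a = scl \<alpha> c" "scl z a = scl \<beta> c" by auto
    obtain k where k: "c = scl k a"
    proof (cases "\<alpha> = 0")
      case False
      have "scl (inverse \<alpha>) (scl y a) = c" using e(1) False by simp
      then show thesis using that[of "inverse \<alpha> * y"] by simp
    next
      case True
      then have b: "\<beta> \<noteq> 0" using assms by simp
      have "scl (inverse \<beta>) (scl z a) = c" using e(2) b by simp
      then show thesis using that[of "inverse \<beta> * z"] by simp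
    qed
    then have "x = s k (\<theta> (scl \<alpha> a, scl \<beta> a))"
      using x \<theta>.scale[of k "(scl \<alpha> a, scl \<beta> a)"] by (simp add: mult.commute)
    then show "x \<in> V.span {\<theta> (scl \<alpha> a, scl \<beta> a)}" unfolding V.span_singleton by blast
  qed
  have "s k (\<theta> (scl \<alpha> a, scl \<beta> a)) = \<theta> (scl (k * \<alpha>) a, scl (k * \<beta>) a)"
    "s k (\<theta> (scl \<alpha> a, scl \<beta> a)) = \<theta> (scl \<alpha> (scl k a), scl \<beta> (scl k a))" for k
    using \<theta>.scale[of k "(scl \<alpha> a, scl \<beta> a)"] by (simp_all add: mult.commute)
  then show "V.span {\<theta> (scl \<alpha> a, scl \<beta> a)} \<subseteq> \<kappa>_line a \<inter> \<kappa>_member \<alpha> \<beta>"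
    unfolding V.span_singleton \<kappa>_line_def \<kappa>_member_def by blast
qed

lemma \<kappa>_line_meets_member:
  assumes "\<alpha> \<noteq> 0 \<or> \<beta> \<noteq> 0" "a \<noteq> 0"
  shows "meets (\<kappa>_line a) (\<kappa>_member \<alpha> \<beta>)"
proof -
  have "\<theta> (scl \<alpha> a, scl \<beta> a) \<noteq> 0" using assms by (auto simp: \<theta>_eq_0 zero_prod_def)
  then show ?thesis unfolding meets_def \<kappa>_line_Int_member[OF assms]
    using V.span_base[of "\<theta> (scl \<alpha> a, scl \<beta> a)" "{\<theta> (scl \<alpha> a, scl \<beta> a)}"] by blast
qed

text \<open>A line meeting the first two members is spanned by some \<open>\<theta> (a, 0)\<close>
  and \<open>\<theta> (0, b)\<close>. It meets the third in a point \<open>\<theta> (c, c)\<close>,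
  which makes \<open>c\<close> a scalar multiple of both, so \<open>a\<close> and \<open>b\<close>
  can be replaced by \<open>c\<close>.\<close>

lemma transversal_iff:
  "transversal s {\<kappa>_member 1 0, \<kappa>_member 0 1, \<kappa>_member 1 1} l \<longleftrightarrow> (\<exists>a. a \<noteq> 0 \<and> l = \<kappa>_line a)"
proof
  assume "\<exists>a. a \<noteq> 0 \<and> l = \<kappa>_line a"
  then show "transversal s {\<kappa>_member 1 0, \<kappa>_member 0 1, \<kappa>_member 1 1} l"
    using dim_\<kappa>_line \<kappa>_line_meets_member by (auto simp: transversal_def n_space_def numeral_2_eq_2)
next
  assume t: "transversal s {\<kappa>_member 1 0, \<kappa>_member 0 1, \<kappa>_member 1 1} l"
  then have l: "has_dimension s 2 l" by (simp add: transversal_def n_space_def numeral_2_eq_2)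
  then have sl: "V.subspace l" by (rule V.has_dimension_subspace)
  have m: "meets l (\<kappa>_member 1 0)" "meets l (\<kappa>_member 0 1)" "meets l (\<kappa>_member 1 1)"
    using t by (auto simp: transversal_def)
  have z: "0 \<in> l \<inter> \<kappa>_member x y" for x y
    using sl V.subspace_0 spread_line_0 by (simp add: \<kappa>_member_eq)
  obtain a where a: "\<theta> (a, 0) \<in> l" "\<theta> (a, 0) \<noteq> 0"
    using m(1) z[of 1 0] unfolding meets_def \<kappa>_member_def by auto
  obtain b where b: "\<theta> (0, b) \<in> l" "\<theta> (0, b) \<noteq> 0"
    using m(2) z[of 0 1] unfolding meets_def \<kappa>_member_def by auto
  obtain c where c: "\<theta> (c, c) \<in> l" "\<theta> (c, c) \<noteq> 0"
    using m(3) z[of 1 1] unfolding meets_def \<kappa>_member_def by auto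
  have n: "a \<noteq> 0" "b \<noteq> 0" "c \<noteq> 0" using a b c \<theta>_eq_0 by (auto simp: zero_prod_def)
  have "V.span {\<theta> (a, 0), \<theta> (0, b)} = l"
    using V.has_dimension_full[OF l] independent_2[OF n(1,2)] a b by simp
  then obtain x y where "\<theta> (c, c) = \<theta> (scl x a, scl y b)"
    using c(1) unfolding span_2_eq by blast
  then have "(c, c) = (scl x a, scl y b)" using inj injD by metis
  then have xy: "c = scl x a" "c = scl y b" by auto
  have "\<theta> (c, 0) = s x (\<theta> (a, 0))" "\<theta> (0, c) = s y (\<theta> (0, b))"
    using \<theta>_scl[of x a y 0] \<theta>_scl[of x 0 y b] xy \<theta>.zero by (simp_all add: zero_prod_def)
  then have "\<theta> (c, 0) \<in> l" "\<theta> (0, c) \<in> l" using a b sl V.subspace_scale by simp_all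
  then have "V.span {\<theta> (c, 0), \<theta> (0, c)} = l"
    using V.has_dimension_full[OF l] independent_2[OF n(3,3)] by simp
  then show "\<exists>a. a \<noteq> 0 \<and> l = \<kappa>_line a" using n(3) unfolding span_2_eq \<kappa>_line_def by blast
qed

lemma dim_\<kappa>_member: "\<alpha> \<noteq> 0 \<or> \<beta> \<noteq> 0 \<Longrightarrow> has_dimension s d (\<kappa>_member \<alpha> \<beta>)"
  unfolding \<kappa>_member_eq by (rule dim_spread_line) simp

lemma n_space_range: "n_space s (2 * (d - 1) + 1) (range \<theta>)"
proof -
  have "2 * (d - 1) + 1 + 1 = 2 * d" using d_pos by simp
  then show ?thesis using dim_range unfolding n_space_def by metis
qed

lemma n_space_d_iff: "n_space s (d - 1) U \<longleftrightarrow> has_dimension s d U"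
  using d_pos by (simp add: n_space_def)

text \<open>A member \<open>U\<close> of the regulus picks a scalar direction \<open>(\<alpha>\<^sub>a, \<beta>\<^sub>a)\<close> on the transversal through each
  basis vector \<open>a\<close>; comparing with the transversal through the sum of the basis forces all these
  directions to agree.\<close>

lemma regulus_eq:
  "regulus s (d - 1) (range \<theta>) (\<kappa>_member 1 0) (\<kappa>_member 0 1) (\<kappa>_member 1 1) =
     {\<kappa>_member \<alpha> \<beta> | \<alpha> \<beta>. \<alpha> \<noteq> 0 \<or> \<beta> \<noteq> 0}" (is "?R = ?S")
proof
  show "?S \<subseteq> ?R"
  proof
    fix U assume "U \<in> ?S"
    then obtain \<alpha> \<beta> where U: "U = \<kappa>_member \<alpha> \<beta>" "\<alpha> \<noteq> 0 \<or> \<beta> \<noteq> 0" by blast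
    then show "U \<in> ?R"
      unfolding regulus_def n_space_d_iff transversal_iff
      using dim_\<kappa>_member \<kappa>_line_meets_member spread_line_subset by (auto simp: \<kappa>_member_eq)
  qed
  show "?R \<subseteq> ?S"
  proof
    fix U assume "U \<in> ?R"
    then have "has_dimension s d U \<and> U \<subseteq> range \<theta> \<and>
        (\<forall>l\<subseteq>range \<theta>. (\<exists>a. a \<noteq> 0 \<and> l = \<kappa>_line a) \<longrightarrow> meets l U)"
      unfolding regulus_def n_space_d_iff transversal_iff by blast
    then have U: "has_dimension s d U" "U \<subseteq> range \<theta>" "\<And>a. a \<noteq> 0 \<Longrightarrow> meets (\<kappa>_line a) U"
      using \<kappa>_line_subset by blast+
    have sU: "V.subspace U" using U(1) by (rule V.has_dimension_subspace)
    have ex: "\<exists>\<alpha> \<beta>. (\<alpha> \<noteq> 0 \<or> \<beta> \<noteq> 0) \<and> \<theta> (scl \<alpha> a, scl \<beta> a) \<in> U" if a0: "a \<noteq> 0" for a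
    proof -
      have "0 \<in> \<kappa>_line a \<inter> U"
        using dim_\<kappa>_line[OF a0] U(1) V.has_dimension_subspace V.subspace_0 by blast
      then obtain x where "x \<in> \<kappa>_line a" "x \<in> U" "x \<noteq> 0" using U(3)[OF a0] unfolding meets_def by blast
      then obtain \<alpha> \<beta> where "\<theta> (scl \<alpha> a, scl \<beta> a) \<in> U" "\<theta> (scl \<alpha> a, scl \<beta> a) \<noteq> 0"
        unfolding \<kappa>_line_def by blast
      then show ?thesis using \<theta>_eq_0[of "(scl \<alpha> a, scl \<beta> a)"] by (force simp: zero_prod_def)
    qed
    obtain E where E: "finite E" "card E = d" "B.independent E" "B.span E = UNIV"
      using dim_B unfolding has_dimension_def by blast
    have nE: "a \<noteq> 0" if "a \<in> E" for a using E(3) that B.dependent_zero by blast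
    then obtain \<alpha> \<beta> where ab: "\<And>a. a \<in> E \<Longrightarrow> (\<alpha> a \<noteq> 0 \<or> \<beta> a \<noteq> 0) \<and> \<theta> (scl (\<alpha> a) a, scl (\<beta> a) a) \<in> U"
      using ex by metis
    \<comment> \<open>\<open>h\<close> extends the directions chosen on the basis linearly. The
      image of \<open>\<theta> \<circ> h\<close> lies in \<open>U\<close> and has the same
      dimension, so it is \<open>U\<close>.\<close>
    obtain h where h: "Vector_Spaces.linear scl scl2 h" "\<And>a. a \<in> E \<Longrightarrow> h a = (scl (\<alpha> a) a, scl (\<beta> a) a)"
      using B3.linear_independent_extend[OF E(3), of "\<lambda>a. (scl (\<alpha> a) a, scl (\<beta> a) a)"] by blast
    interpret h: Vector_Spaces.linear scl scl2 h by (rule h(1))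
    have coeffs: "\<exists>c. x = (\<Sum>a\<in>E. scl (c a) a)" for x
      using B.span_finite[OF E(1)] E(4) by (metis (no_types, lifting) UNIV_I image_iff)
    have hsum: "h (\<Sum>a\<in>E. scl (c a) a) = (\<Sum>a\<in>E. scl (c a * \<alpha> a) a, \<Sum>a\<in>E. scl (c a * \<beta> a) a)" for c
    proof -
      have "h (\<Sum>a\<in>E. scl (c a) a) = (\<Sum>a\<in>E. scl2 (c a) (scl (\<alpha> a) a, scl (\<beta> a) a))"
        by (simp add: h.sum h.scale h(2) cong: sum.cong)
      also have "\<dots> = (\<Sum>a\<in>E. (scl (c a * \<alpha> a) a, scl (c a * \<beta> a) a))" by simp
      finally show ?thesis by (simp add: sum_prod)
    qed
    have zero: "c a = 0" if "(\<Sum>a\<in>E. scl (c a) a) = 0" "a \<in> E" for c a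
      using B.independentD[OF E(3) E(1) subset_refl] that by blast
    have uniq: "c a = c' a" if "(\<Sum>a\<in>E. scl (c a) a) = (\<Sum>a\<in>E. scl (c' a) a)" "a \<in> E" for c c' a
      using zero[of "\<lambda>a. c a - c' a" a] that by (simp add: B.scale_left_diff_distrib sum_subtractf)
    have "inj h"
      unfolding h.inj_iff_eq_0
    proof (intro allI impI)
      fix x assume hx: "h x = 0"
      obtain c where c: "x = (\<Sum>a\<in>E. scl (c a) a)" using coeffs by blast
      have "c a = 0" if "a \<in> E" for a
        using hx zero[of "\<lambda>a. c a * \<alpha> a" a] zero[of "\<lambda>a. c a * \<beta> a" a] ab[OF that] that
        unfolding c hsum by (auto simp: zero_prod_def)
      then show "x = 0" by (simp add: c)
    qed
    then have dh: "has_dimension s d (range (\<theta> \<circ> h))"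
      using VP1.has_dimension_image[OF linear_comp[OF h(1) \<theta>] _ dim_B] inj inj_compose by blast
    have sub: "range (\<theta> \<circ> h) \<subseteq> U"
    proof -
      have "(\<theta> \<circ> h) ` E \<subseteq> U" using ab h(2) by auto
      then have "V.span ((\<theta> \<circ> h) ` E) \<subseteq> U" using sU V.span_minimal by blast
      moreover have "V.span ((\<theta> \<circ> h) ` E) = range (\<theta> \<circ> h)"
        using Vector_Spaces.linear.axioms(3)[OF linear_comp[OF h(1) \<theta>]] module_hom.span_image E(4) by metis
      ultimately show ?thesis by simp
    qed
    then have Ueq: "range (\<theta> \<circ> h) = U" using V.has_dimension_subset_eq[OF dh U(1)] by blast
    \<comment> \<open>The sum of the basis involves every basis vector, so comparing coefficients on
      the transversal through it gives one direction \<open>(\<mu>, \<nu>)\<close> proportional to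
      all of them. The trivial factor 1 gives it the shape of the other coefficient sums.\<close>
    define b where "b = (\<Sum>a\<in>E. scl 1 a)"
    have "E \<noteq> {}" using E(2) d_pos by auto
    then have "b \<noteq> 0" using zero[of "\<lambda>_. 1"] unfolding b_def by auto
    then obtain \<mu> \<nu> where mn: "\<mu> \<noteq> 0 \<or> \<nu> \<noteq> 0" "\<theta> (scl \<mu> b, scl \<nu> b) \<in> U" using ex by blast
    then obtain x where "\<theta> (scl \<mu> b, scl \<nu> b) = \<theta> (h x)" using Ueq by auto
    then have hx: "h x = (scl \<mu> b, scl \<nu> b)" using inj injD by metis
    obtain c where c: "x = (\<Sum>a\<in>E. scl (c a) a)" using coeffs by blast
    have bs: "scl k b = (\<Sum>a\<in>E. scl k a)" for k unfolding b_def by (simp add: B.scale_sum_right)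
    have dir: "c a * \<alpha> a = \<mu> \<and> c a * \<beta> a = \<nu>" if "a \<in> E" for a
      using hx uniq[of "\<lambda>a. c a * \<alpha> a" "\<lambda>_. \<mu>" a] uniq[of "\<lambda>a. c a * \<beta> a" "\<lambda>_. \<nu>" a] that
      unfolding c hsum bs by simp
    have "range (\<theta> \<circ> h) \<subseteq> \<kappa>_member \<mu> \<nu>"
    proof
      fix y assume "y \<in> range (\<theta> \<circ> h)"
      then obtain x where "y = \<theta> (h x)" by auto
      moreover obtain c' where c': "x = (\<Sum>a\<in>E. scl (c' a) a)" using coeffs by blast
      moreover have "h x = (scl \<mu> (\<Sum>a\<in>E. scl (c' a / c a) a), scl \<nu> (\<Sum>a\<in>E. scl (c' a / c a) a))"
      proof -
        have "c' a * \<alpha> a = \<mu> * (c' a / c a) \<and> c' a * \<beta> a = \<nu> * (c' a / c a)" if "a \<in> E" for a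
        proof -
          have "c a \<noteq> 0" using dir[OF that] mn(1) by auto
          then show ?thesis using dir[OF that] by (auto simp: field_simps)
        qed
        then show ?thesis unfolding c' hsum by (simp add: B.scale_sum_right)
      qed
      ultimately show "y \<in> \<kappa>_member \<mu> \<nu>" unfolding \<kappa>_member_def by auto
    qed
    then have "U = \<kappa>_member \<mu> \<nu>"
      using V.has_dimension_subset_eq[OF U(1) dim_\<kappa>_member[OF mn(1)]] Ueq by blast
    then show "U \<in> ?S" using mn(1) by blast
  qed
qed

lemma members_disjoint:
  assumes "\<alpha> * \<delta> \<noteq> \<beta> * \<gamma>"
  shows "\<not> meets (\<kappa>_member \<alpha> \<beta>) (\<kappa>_member \<gamma> \<delta>)"
proof -
  have "x = 0" if x: "x \<in> \<kappa>_member \<alpha> \<beta>" "x \<in> \<kappa>_member \<gamma> \<delta>" for x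
  proof -
    obtain r r' where r: "x = \<theta> (scl \<alpha> r, scl \<beta> r)" "x = \<theta> (scl \<gamma> r', scl \<delta> r')"
      using x unfolding \<kappa>_member_def by blast
    then have "(scl \<alpha> r, scl \<beta> r) = (scl \<gamma> r', scl \<delta> r')" using inj injD by metis
    then have e: "scl \<alpha> r = scl \<gamma> r'" "scl \<beta> r = scl \<delta> r'" by auto
    have "scl (\<alpha> * \<delta>) r = scl \<delta> (scl \<gamma> r')" unfolding e(1)[symmetric] by (simp add: mult.commute)
    also have "\<dots> = scl \<gamma> (scl \<beta> r)" using e(2) by (simp add: B.scale_left_commute)
    finally have "scl (\<alpha> * \<delta> - \<beta> * \<gamma>) r = 0" by (simp add: B.scale_left_diff_distrib mult.commute)
    then have "r = 0" using assms by simp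
    then show ?thesis using r \<theta>.zero by (simp add: zero_prod_def)
  qed
  moreover have "0 \<in> \<kappa>_member \<alpha> \<beta> \<inter> \<kappa>_member \<gamma> \<delta>" using spread_line_0 by (simp add: \<kappa>_member_eq)
  ultimately show ?thesis unfolding meets_def by blast
qed

lemma is_regulus_members: "is_regulus s (d - 1) (range \<theta>) {\<kappa>_member \<alpha> \<beta> | \<alpha> \<beta>. \<alpha> \<noteq> 0 \<or> \<beta> \<noteq> 0}"
proof -
  have "n_space s (d - 1) (\<kappa>_member \<alpha> \<beta>) \<and> \<kappa>_member \<alpha> \<beta> \<subseteq> range \<theta>" if "\<alpha> \<noteq> 0 \<or> \<beta> \<noteq> 0" for \<alpha> \<beta>
    using dim_\<kappa>_member[OF that] n_space_d_iff spread_line_subset by (simp add: \<kappa>_member_eq)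
  then have "\<forall>V\<in>{\<kappa>_member 1 0, \<kappa>_member 0 1, \<kappa>_member 1 1}. n_space s (d - 1) V \<and> V \<subseteq> range \<theta>" by simp
  moreover have "\<not> meets (\<kappa>_member 1 0) (\<kappa>_member 0 1)" "\<not> meets (\<kappa>_member 1 0) (\<kappa>_member 1 1)"
    "\<not> meets (\<kappa>_member 0 1) (\<kappa>_member 1 1)"
    by (rule members_disjoint, simp)+
  ultimately show ?thesis unfolding is_regulus_def regulus_eq[symmetric] using n_space_range by blast
qed

text \<open>Every transversal is some \<open>\<kappa>_line a\<close>, and it meets the four members
  in points with parameters infinity, 0, 1 and \<open>r0\<close>, whatever \<open>a\<close> is. So
  the choice of the transversal does not matter.\<close>

lemma regulus_cross_ratio_iff:
  assumes r0: "r0 \<noteq> 0"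
  shows "regulus_cross_ratio s (\<kappa>_member 1 0) (\<kappa>_member 0 1) (\<kappa>_member 1 1) (\<kappa>_member r0 1) r \<longleftrightarrow> r = r0"
proof -
  have cr: "cross_ratio s (\<kappa>_line a \<inter> \<kappa>_member 1 0) (\<kappa>_line a \<inter> \<kappa>_member 0 1)
       (\<kappa>_line a \<inter> \<kappa>_member 1 1) (\<kappa>_line a \<inter> \<kappa>_member r0 1) r \<longleftrightarrow> r = r0" if a: "a \<noteq> 0" for a
  proof -
    have n: "\<theta> (a, 0) \<noteq> 0" "\<theta> (0, a) \<noteq> 0" using a \<theta>_eq_0 by (simp_all add: zero_prod_def)
    have "V.span {\<theta> (a, 0)} \<noteq> V.span {\<theta> (0, a)}"
      unfolding V.independent_2_iff[OF n] \<theta>_scl[symmetric] \<theta>_eq_0 using a by (simp add: zero_prod_def)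
    then show ?thesis
      using a V.cross_ratio_iff[OF n _ r0] \<theta>_scl[of 1 a 1 a] \<theta>_scl[of r0 a 1 a]
      by (simp add: \<kappa>_line_Int_member)
  qed
  show ?thesis
  proof
    assume "regulus_cross_ratio s (\<kappa>_member 1 0) (\<kappa>_member 0 1) (\<kappa>_member 1 1) (\<kappa>_member r0 1) r"
    then obtain l where l: "transversal s {\<kappa>_member 1 0, \<kappa>_member 0 1, \<kappa>_member 1 1, \<kappa>_member r0 1} l"
      "cross_ratio s (l \<inter> \<kappa>_member 1 0) (l \<inter> \<kappa>_member 0 1) (l \<inter> \<kappa>_member 1 1) (l \<inter> \<kappa>_member r0 1) r"
      unfolding regulus_cross_ratio_def by blast
    then have "transversal s {\<kappa>_member 1 0, \<kappa>_member 0 1, \<kappa>_member 1 1} l" by (simp add: transversal_def)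
    then obtain a where "a \<noteq> 0" "l = \<kappa>_line a" using transversal_iff by blast
    then show "r = r0" using cr l(2) by blast
  next
    assume "r = r0"
    moreover have "transversal s {\<kappa>_member 1 0, \<kappa>_member 0 1, \<kappa>_member 1 1, \<kappa>_member r0 1} (\<kappa>_line 1)"
      using dim_\<kappa>_line \<kappa>_line_meets_member by (auto simp: transversal_def n_space_def numeral_2_eq_2)
    ultimately show "regulus_cross_ratio s (\<kappa>_member 1 0) (\<kappa>_member 0 1) (\<kappa>_member 1 1) (\<kappa>_member r0 1) r"
      unfolding regulus_cross_ratio_def using cr[of 1] by auto
  qed
qed

end

text \<open>The group \<open>GL(2, B)\<close> is transitive on triples of distinct points of the
  projective line. A change of coordinates \<open>M\<close> carries the standard triple to the given
  one, and the regulus becomes the image of the subline over K, whose members are again points of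
  the line over B.\<close>

lemma regular_spread_lines:
  assumes \<theta>: "Vector_Spaces.linear scl2 s \<theta>" and inj: "inj \<theta>"
  shows "regular_spread_line s (d - 1) (range \<theta>) {spread_line \<theta> a b | a b. a \<noteq> 0 \<or> b \<noteq> 0}" (is "regular_spread_line s _ _ ?S")
  unfolding regular_spread_line_def
proof (intro conjI ballI impI)
  show "n_space s (2 * (d - 1) + 1) (range \<theta>)" by (rule n_space_range[OF \<theta> inj])
  interpret \<theta>: Vector_Spaces.linear scl2 s \<theta> by (rule \<theta>)
  show "is_spread s (d - 1) (range \<theta>) ?S"
    unfolding is_spread_def
  proof (intro conjI ballI)
    fix V assume "V \<in> ?S"
    then show "n_space s (d - 1) V" "V \<subseteq> range \<theta>"
      using n_space_d_iff[OF \<theta> inj] dim_spread_line[OF \<theta> inj] spread_line_subset[OF \<theta> inj] by blast+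
  next
    fix p assume "p \<in> points s (range \<theta>)"
    then obtain x y where p: "p = V.span {\<theta> (x, y)}" "\<theta> (x, y) \<noteq> 0" unfolding points_def by force
    then have xy: "x \<noteq> 0 \<or> y \<noteq> 0" using \<theta>.zero by (auto simp: zero_prod_def)
    have iff: "p \<subseteq> spread_line \<theta> a b \<longleftrightarrow> (\<exists>r. x = a * r \<and> y = b * r)" if "a \<noteq> 0 \<or> b \<noteq> 0" for a b
      using V.span_singleton_subset_iff[OF V.has_dimension_subspace[OF dim_spread_line[OF \<theta> inj that]]]
        mem_spread_line[OF \<theta> inj] unfolding p(1) by blast
    show "\<exists>!V. V \<in> ?S \<and> p \<subseteq> V"
    proof (rule ex1I[of _ "spread_line \<theta> x y"])
      have "\<exists>r. x = x * r \<and> y = y * r" by (metis mult.right_neutral)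
      then show "spread_line \<theta> x y \<in> ?S \<and> p \<subseteq> spread_line \<theta> x y" using xy iff by blast
      fix V assume "V \<in> ?S \<and> p \<subseteq> V"
      then obtain a b where ab: "V = spread_line \<theta> a b" "a \<noteq> 0 \<or> b \<noteq> 0" "p \<subseteq> spread_line \<theta> a b" by blast
      then have "\<exists>r. x = a * r \<and> y = b * r" using iff by blast
      then show "V = spread_line \<theta> x y" using ab spread_line_eq_iff[OF \<theta> inj ab(2) xy] by simp
    qed
  qed
  fix V1 V2 V3
  assume V: "V1 \<in> ?S" "V2 \<in> ?S" "V3 \<in> ?S" and ne: "V1 \<noteq> V2 \<and> V1 \<noteq> V3 \<and> V2 \<noteq> V3"
  obtain a1 a2 where a: "V1 = spread_line \<theta> a1 a2" "a1 \<noteq> 0 \<or> a2 \<noteq> 0" using V(1) by blast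
  obtain b1 b2 where b: "V2 = spread_line \<theta> b1 b2" "b1 \<noteq> 0 \<or> b2 \<noteq> 0" using V(2) by blast
  obtain c1 c2 where c: "V3 = spread_line \<theta> c1 c2" "c1 \<noteq> 0 \<or> c2 \<noteq> 0" using V(3) by blast
  have "\<nexists>r. b1 = a1 * r \<and> b2 = a2 * r"
    using ne a b spread_line_eq_iff[OF \<theta> inj a(2) b(2)] by blast
  then obtain p q p' q' where inv:
    "p * a1 + q * a2 = 1" "p * b1 + q * b2 = 0" "p' * a1 + q' * a2 = 0" "p' * b1 + q' * b2 = 1"
    "a1 * p + b1 * p' = 1" "a1 * q + b1 * q' = 0" "a2 * p + b2 * p' = 0" "a2 * q + b2 * q' = 1"
    using matrix_2_inverse[OF a(2)] by metis
  \<comment> \<open>Coordinates of the third point in the basis given by the first two; both are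
    nonzero because the three points are distinct.\<close>
  define g where "g = p * c1 + q * c2"
  define h where "h = p' * c1 + q' * c2"
  have c': "c1 = a1 * g + b1 * h" "c2 = a2 * g + b2 * h"
  proof -
    have "a1 * g + b1 * h = (a1 * p + b1 * p') * c1 + (a1 * q + b1 * q') * c2" by (simp add: g_def h_def algebra_simps)
    then show "c1 = a1 * g + b1 * h" using inv by simp
    have "a2 * g + b2 * h = (a2 * p + b2 * p') * c1 + (a2 * q + b2 * q') * c2" by (simp add: g_def h_def algebra_simps)
    then show "c2 = a2 * g + b2 * h" using inv by simp
  qed
  have h0: "h \<noteq> 0"
    using ne a c c' spread_line_eq_iff[OF \<theta> inj a(2) c(2)] by auto
  have g0: "g \<noteq> 0"
    using ne b c c' spread_line_eq_iff[OF \<theta> inj b(2) c(2)] by auto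
  \<comment> \<open>The columns are the first two points, rescaled so that their sum represents the
    third.\<close>
  define M where "M = (\<lambda>z :: 'b \<times> 'b. (a1 * g * fst z + b1 * h * snd z, a2 * g * fst z + b2 * h * snd z))"
  have M: "Vector_Spaces.linear scl2 scl2 M"
    unfolding Vector_Spaces.linear_iff using B2.p.vector_space_axioms
    by (auto simp: M_def algebra_simps)
  define M' where "M' = (\<lambda>z :: 'b \<times> 'b. (binv g * (p * fst z + q * snd z), binv h * (p' * fst z + q' * snd z)))"
  have MM': "M (M' z) = z" for z
  proof -
    have "M (M' z) = ((a1 * p + b1 * p') * fst z + (a1 * q + b1 * q') * snd z, (a2 * p + b2 * p') * fst z + (a2 * q + b2 * q') * snd z)"
      using g0 h0 by (simp add: M_def M'_def mult.assoc) (simp add: algebra_simps)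
    then show ?thesis using inv by simp
  qed
  have M'M: "M' (M z) = z" for z
  proof -
    have "M' (M z) = (binv g * ((p * a1 + q * a2) * (g * fst z) + (p * b1 + q * b2) * (h * snd z)),
      binv h * ((p' * a1 + q' * a2) * (g * fst z) + (p' * b1 + q' * b2) * (h * snd z)))"
      by (simp add: M_def M'_def algebra_simps)
    then show ?thesis using inv g0 h0 by simp
  qed
  define \<theta>' where "\<theta>' = \<theta> \<circ> M"
  have \<theta>': "Vector_Spaces.linear scl2 s \<theta>'" unfolding \<theta>'_def using linear_comp[OF M \<theta>] .
  have inj': "inj \<theta>'" unfolding \<theta>'_def using inj M'M by (metis inj_compose inj_on_def)
  have range': "range \<theta>' = range \<theta>" unfolding \<theta>'_def using MM' by (metis image_comp surjI)
  have member: "\<kappa>_member \<theta>' \<alpha> \<beta> = spread_line \<theta> (a1 * scl \<alpha> g + b1 * scl \<beta> h) (a2 * scl \<alpha> g + b2 * scl \<beta> h)" for \<alpha> \<beta>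
    unfolding \<kappa>_member_def[OF \<theta>' inj'] spread_line_def by (simp add: \<theta>'_def M_def algebra_simps)
  have "\<kappa>_member \<theta>' 1 0 = V1" "\<kappa>_member \<theta>' 0 1 = V2" "\<kappa>_member \<theta>' 1 1 = V3"
    using spread_line_rmul[OF \<theta> inj] g0 h0 by (simp_all add: member a b c c')
  then have "regulus s (d - 1) (range \<theta>) V1 V2 V3 = {\<kappa>_member \<theta>' \<alpha> \<beta> | \<alpha> \<beta>. \<alpha> \<noteq> 0 \<or> \<beta> \<noteq> 0}"
    using regulus_eq[OF \<theta>' inj'] range' by simp
  also have "\<dots> \<subseteq> ?S"
  proof
    fix U assume "U \<in> {\<kappa>_member \<theta>' \<alpha> \<beta> | \<alpha> \<beta>. \<alpha> \<noteq> 0 \<or> \<beta> \<noteq> 0}"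
    then obtain \<alpha> \<beta> where U: "U = \<kappa>_member \<theta>' \<alpha> \<beta>" "\<alpha> \<noteq> 0 \<or> \<beta> \<noteq> 0" by blast
    have eq: "M (scl \<alpha> 1, scl \<beta> 1) = (a1 * scl \<alpha> g + b1 * scl \<beta> h, a2 * scl \<alpha> g + b2 * scl \<beta> h)"
      by (simp add: M_def)
    have "M (scl \<alpha> 1, scl \<beta> 1) \<noteq> 0"
    proof
      assume "M (scl \<alpha> 1, scl \<beta> 1) = 0"
      then have "(scl \<alpha> 1, scl \<beta> 1) = M' 0" using M'M by metis
      then show False using U(2) by (simp add: M'_def)
    qed
    then show "U \<in> ?S" unfolding U member eq by (auto simp: zero_prod_def)
  qed
  finally show "regulus s (d - 1) (range \<theta>) V1 V2 V3 \<subseteq> ?S" .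
qed

section \<open>Cones over a quadric of Witt index 1\<close>

text \<open>\<open>conic_form\<close> is the sum of a hyperbolic plane and the anisotropic form
  \<open>- N\<close>, which is why its Witt index is 1. The maps \<open>\<psi>\<close> and
  \<open>\<eta>\<close> carry the base quadric and the vertex into the ambient space.\<close>

lemma is_vertex_range:
  assumes \<psi>: "Vector_Spaces.linear sclQ s \<psi>" and \<eta>: "Vector_Spaces.linear scl s \<eta>"
    and inj: "\<And>k r. \<psi> k + \<eta> r = 0 \<Longrightarrow> k = 0 \<and> r = 0"
    and \<xi>: "\<xi> = {\<psi> k + \<eta> r | k r. True}"
    and X: "\<And>k r. V.span {\<psi> k + \<eta> r} \<in> X \<longleftrightarrow> k \<noteq> 0 \<and> isotropic k"
  shows "is_vertex s X \<xi> (range \<eta>)"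
proof -
  interpret \<psi>: Vector_Spaces.linear sclQ s \<psi> by (rule \<psi>)
  interpret \<eta>: Vector_Spaces.linear scl s \<eta> by (rule \<eta>)
  have inj\<psi>: "inj \<psi>"
    unfolding \<psi>.inj_iff_eq_0 using inj[of _ 0] \<eta>.zero by simp
  define W where "W = range \<psi>"
  define q where "q = (\<lambda>w. conic_form (inv \<psi> w))"
  have q: "q (\<psi> k) = conic_form k" for k by (simp add: q_def inj\<psi>)
  have pq: "polar_form q (\<psi> k) (\<psi> k') = polar_form conic_form k k'" for k k'
    using q[of "k + k'"] by (simp add: polar_form_def q \<psi>.add)
  have sub: "V.subspace W" "V.subspace (range \<eta>)"
    using \<psi>.subspace_image[of UNIV] \<eta>.subspace_image[of UNIV] by (simp_all add: W_def)
  have compl: "complement_in s \<xi> (range \<eta>) W"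
    unfolding complement_in_def
  proof (intro conjI sub)
    have "x = 0" if x: "x \<in> range \<eta> \<inter> W" for x
    proof -
      obtain k r where "x = \<psi> k" "x = \<eta> r" using x unfolding W_def by blast
      then show ?thesis using inj[of k "- r"] \<eta>.neg[of r] \<psi>.zero by auto
    qed
    moreover have "0 \<in> range \<eta> \<inter> W" using sub V.subspace_0 by blast
    ultimately show "range \<eta> \<inter> W = {0}" by blast
    have "V.span (range \<eta> \<union> W) = {x + y | x y. x \<in> range \<eta> \<and> y \<in> W}"
      unfolding V.span_Un V.span_eq_iff[THEN iffD2, OF sub(1)] V.span_eq_iff[THEN iffD2, OF sub(2)] ..
    moreover have "\<dots> = {\<eta> r + \<psi> k | k r. True}" unfolding W_def by blast
    ultimately show "V.span (range \<eta> \<union> W) = \<xi>" unfolding \<xi> by (simp add: add.commute)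
  qed
  have qf: "quadratic_form_on s W q"
    unfolding quadratic_form_on_def
  proof (intro conjI ballI allI)
    fix c w assume "w \<in> W"
    then obtain k where k: "w = \<psi> k" by (auto simp: W_def)
    have "q (s c w) = conic_form (sclQ c k)" unfolding k using q[of "sclQ c k"] by (simp add: \<psi>.scale)
    then show "q (s c w) = c\<^sup>2 * q w" by (simp add: conic_form_scale k q)
  next
    fix u v w assume "u \<in> W" "v \<in> W" "w \<in> W"
    then obtain a b c where w: "u = \<psi> a" "v = \<psi> b" "w = \<psi> c" by (auto simp: W_def)
    have "polar_form q (u + v) w = polar_form conic_form (a + b) c"
      unfolding w using pq[of "a + b" c] by (simp add: \<psi>.add)
    then show "polar_form q (u + v) w = polar_form q u w + polar_form q v w"
      unfolding w pq polar_conic_form_add .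
  next
    fix k u w assume "u \<in> W" "w \<in> W"
    then obtain a b where w: "u = \<psi> a" "w = \<psi> b" by (auto simp: W_def)
    have "polar_form q (s k u) w = polar_form conic_form (sclQ k a) b"
      unfolding w using pq[of "sclQ k a" b] by (simp add: \<psi>.scale)
    then show "polar_form q (s k u) w = k * polar_form q u w"
      unfolding w pq polar_conic_form_scale .
  qed
  have nd: "nondegenerate_on W q"
    unfolding nondegenerate_on_def
  proof (intro ballI impI)
    fix w assume w: "w \<in> W" "q w = 0 \<and> (\<forall>u\<in>W. polar_form q w u = 0)"
    then obtain x y \<gamma> where k: "w = \<psi> (x, y, \<gamma>)" by (auto simp: W_def)
    \<comment> \<open>Pairing with the two hyperbolic vectors kills \<open>x\<close> and
      \<open>y\<close>, and then \<open>q w = 0\<close> kills \<open>\<gamma>\<close> because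
      \<open>N\<close> is anisotropic. The polar form of \<open>N\<close> would not do: it may
      vanish in characteristic 2.\<close>
    have "\<And>k. polar_form conic_form (x, y, \<gamma>) k = 0" using w(2) pq unfolding k W_def by auto
    from this[of "(1, 0, 0)"] this[of "(0, 1, 0)"] have "x = 0" "y = 0"
      by (simp_all add: polar_conic_form)
    moreover have "conic_form (x, y, \<gamma>) = 0" using w(2) q k by metis
    ultimately have "(x, y, \<gamma>) = 0" by (simp add: zero_prod_def)
    then show "w = 0" using k \<psi>.zero by metis
  qed
  have wi: "witt_index s W q 1"
    unfolding witt_index_def
  proof (intro conjI allI impI)
    let ?e = "\<psi> (1, 0, 0)"
    have ne: "?e \<noteq> 0" using inj[of "(1, 0, 0)" 0] \<eta>.zero by (auto simp: zero_prod_def)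
    have "V.span {?e} \<subseteq> W" using sub(1) V.span_singleton_subset_iff by (auto simp: W_def)
    moreover have "q u = 0" if u: "u \<in> V.span {?e}" for u
    proof -
      obtain c where "u = s c ?e" using u unfolding V.span_singleton by blast
      then have "u = \<psi> (c, 0, 0)" using \<psi>.scale[of c "(1, 0, 0)"] by simp
      then show ?thesis by (simp add: q)
    qed
    ultimately show "\<exists>U\<subseteq>W. has_dimension s 1 U \<and> (\<forall>u\<in>U. q u = 0)"
      using V.has_dimension_1[OF ne] by blast
  next
    fix U m assume "U \<subseteq> W \<and> has_dimension s m U \<and> (\<forall>u\<in>U. q u = 0)"
    then have U: "U \<subseteq> W" "has_dimension s m U" "\<And>u. u \<in> U \<Longrightarrow> q u = 0" by blast+
    have sU: "V.subspace U" using U(2) V.has_dimension_subspace by blast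
    have iso: "x * y = N \<gamma>" if "\<psi> (x, y, \<gamma>) \<in> U" for x y \<gamma>
      using U(3)[OF that] by (simp add: q)
    have comb: "\<psi> (sclQ a k - sclQ b k') \<in> U" if "\<psi> k \<in> U" "\<psi> k' \<in> U" for a b k k'
      using that sU by (simp add: \<psi>.diff \<psi>.scale V.subspace_diff V.subspace_scale)
    \<comment> \<open>A totally singular \<open>U\<close> is at most a point. Given a vector with
      \<open>x \<noteq> 0\<close>, subtracting a multiple of it from another one leaves
      \<open>(0, y2, \<gamma>2)\<close>, where singularity gives \<open>\<gamma>2 = 0\<close>;
      adding this back to the given vector gives \<open>y2 = 0\<close>.\<close>
    obtain u where sp: "U \<subseteq> V.span {u}"
    proof (cases "\<exists>x y \<gamma>. \<psi> (x, y, \<gamma>) \<in> U \<and> x \<noteq> 0")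
      case False
      have "U \<subseteq> V.span {\<psi> (0, 1, 0)}"
      proof
        fix w assume w: "w \<in> U"
        then obtain x y \<gamma> where k: "w = \<psi> (x, y, \<gamma>)" using U(1) by (auto simp: W_def)
        then have x: "x = 0" using False w by blast
        then have "\<gamma> = 0" using iso[of x y \<gamma>] w k by simp
        then have "w = s y (\<psi> (0, 1, 0))" using k x \<psi>.scale[of y "(0, 1, 0)"] by simp
        then show "w \<in> V.span {\<psi> (0, 1, 0)}" unfolding V.span_singleton by blast
      qed
      then show thesis by (rule that)
    next
      case True
      then obtain x y \<gamma> where e: "\<psi> (x, y, \<gamma>) \<in> U" "x \<noteq> 0" by blast
      have "U \<subseteq> V.span {\<psi> (x, y, \<gamma>)}"
      proof
        fix w assume w: "w \<in> U"
        then obtain x' y' \<gamma>' where k: "w = \<psi> (x', y', \<gamma>')" using U(1) by (auto simp: W_def)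
        define t where "t = x' / x"
        have c1: "\<psi> (sclQ 1 (x', y', \<gamma>') - sclQ t (x, y, \<gamma>)) \<in> U" using comb w k e(1) by metis
        define y2 \<gamma>2 where "y2 = y' - t * y" and "\<gamma>2 = \<gamma>' - scl t \<gamma>"
        have c1': "\<psi> (0, y2, \<gamma>2) \<in> U" using c1 e(2) by (simp add: t_def y2_def \<gamma>2_def)
        then have g2: "\<gamma>2 = 0" using iso by force
        have "\<psi> (sclQ 1 (x, y, \<gamma>) - sclQ (-1) (0, y2, \<gamma>2)) \<in> U" using comb c1' e(1) by metis
        then have "x * (y + y2) = N \<gamma>" using iso g2 by simp
        then have "y2 = 0" using iso[OF e(1)] e(2) by (simp add: algebra_simps)
        then have "(x', y', \<gamma>') = sclQ t (x, y, \<gamma>)"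
          using g2 e(2) by (simp add: y2_def \<gamma>2_def t_def)
        then have "w = s t (\<psi> (x, y, \<gamma>))" using k \<psi>.scale by metis
        then show "w \<in> V.span {\<psi> (x, y, \<gamma>)}" unfolding V.span_singleton by blast
      qed
      then show thesis by (rule that)
    qed
    obtain E where E: "finite E" "card E = m" "V.independent E" "V.span E = U"
      using U(2) unfolding has_dimension_def by blast
    then have "E \<subseteq> V.span {u}" using sp V.span_superset by blast
    then have "card E \<le> card {u}" using V.independent_span_bound[of "{u}" E] E(3) by simp
    then show "m \<le> 1" using E(2) by simp
  qed
  have "X \<inter> points s \<xi> = cone s (range \<eta>) (quadric s W q) - points s (range \<eta>)"
  proof -
    have iff: "V.span {\<psi> k + \<eta> r} \<in> X \<longleftrightarrow>
      V.span {\<psi> k + \<eta> r} \<in> cone s (range \<eta>) (quadric s W q) - points s (range \<eta>)" for k r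
    proof -
      have "V.span {\<eta> r + \<psi> k} \<in> cone s (range \<eta>) (quadric s W q) - points s (range \<eta>)
          \<longleftrightarrow> \<psi> k \<noteq> 0 \<and> q (\<psi> k) = 0"
        by (rule V.cone_minus_vertex_iff[OF compl qf]) (auto simp: W_def)
      also have "\<dots> \<longleftrightarrow> k \<noteq> 0 \<and> isotropic k"
        using inj\<psi> \<psi>.zero injD[OF inj\<psi>, of k 0] by (cases k) (auto simp: q)
      finally show ?thesis using X by (simp add: add.commute)
    qed
    have "\<exists>k r. p = V.span {\<psi> k + \<eta> r}" if "p \<in> points s \<xi>" for p
      using that unfolding points_def \<xi> by blast
    moreover have "p \<in> points s \<xi>" if p: "p \<in> cone s (range \<eta>) (quadric s W q)" for p
    proof -
      obtain w where "w \<in> W" "p \<in> points s (V.span (range \<eta> \<union> V.span {w}))"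
        using p unfolding cone_def quadric_def by blast
      moreover have "V.span (range \<eta> \<union> V.span {w}) \<subseteq> \<xi>"
        using V.complement_in_subset[OF compl] \<open>w \<in> W\<close> V.span_minimal
        by (metis Un_least V.span_singleton_subset_iff subsetD)
      ultimately show ?thesis unfolding points_def by blast
    qed
    ultimately show ?thesis using iff by blast
  qed
  then show ?thesis unfolding is_vertex_def using compl qf nd wi by blast
qed

text \<open>If \<open>V\<close> is any vertex, the set of vectors spanning points of \<open>X\<close> is invariant under translation by
  \<open>V\<close> and disjoint from it. Over a field with more than two elements this identifies \<open>V\<close> immediately;
  the field with two elements needs the sum of two points of the quadric.\<close>

lemma is_vertex_unique:
  assumes \<psi>: "Vector_Spaces.linear sclQ s \<psi>" and \<eta>: "Vector_Spaces.linear scl s \<eta>"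
    and inj: "\<And>k r. \<psi> k + \<eta> r = 0 \<Longrightarrow> k = 0 \<and> r = 0"
    and \<xi>: "\<xi> = {\<psi> k + \<eta> r | k r. True}"
    and X: "\<And>k r. V.span {\<psi> k + \<eta> r} \<in> X \<longleftrightarrow> k \<noteq> 0 \<and> isotropic k"
    and vertex: "is_vertex s X \<xi> U"
  shows "U = range \<eta>"
proof -
  interpret \<psi>: Vector_Spaces.linear sclQ s \<psi> by (rule \<psi>)
  interpret \<eta>: Vector_Spaces.linear scl s \<eta> by (rule \<eta>)
  obtain W q where compl: "complement_in s \<xi> U W" and qf: "quadratic_form_on s W q"
    and cone: "X \<inter> points s \<xi> = cone s U (quadric s W q) - points s U"
    using vertex unfolding is_vertex_def by blast
  have sub: "V.subspace U" "V.subspace W" using compl by (simp_all add: complement_in_def)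
  have s\<xi>: "V.subspace \<xi>" and U\<xi>: "U \<subseteq> \<xi>" and W\<xi>: "W \<subseteq> \<xi>" using V.complement_in_subset[OF compl] by blast+
  define C where "C = (\<lambda>x. x \<in> \<xi> \<and> x \<noteq> 0 \<and> V.span {x} \<in> X)"
  have C1: "C (\<psi> k + \<eta> r) \<longleftrightarrow> k \<noteq> 0 \<and> isotropic k" for k r
  proof -
    have "\<psi> k + \<eta> r \<in> \<xi>" unfolding \<xi> by blast
    then show ?thesis using X inj[of k r] unfolding C_def by blast
  qed
  have C2: "C (v + w) \<longleftrightarrow> w \<noteq> 0 \<and> q w = 0" if "v \<in> U" "w \<in> W" for v w
  proof -
    have "C (v + w) \<longleftrightarrow> V.span {v + w} \<in> X \<inter> points s \<xi>"
      unfolding C_def using V.span_singleton_in_points_iff[OF s\<xi>] by blast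
    then show ?thesis unfolding cone using V.cone_minus_vertex_iff[OF compl qf that] by blast
  qed
  have nC: "\<not> C v" if "v \<in> U" for v
    using C2[OF that V.subspace_0[OF sub(2)]] by simp
  have transl: "C (p + v)" if p: "C p" and v: "v \<in> U" for p v
  proof -
    have "p \<in> \<xi>" using p by (simp add: C_def)
    then obtain a b where ab: "a \<in> U" "b \<in> W" "p = a + b" using V.complement_decomposition[OF compl] by metis
    then have "C ((a + v) + b) \<longleftrightarrow> C (a + b)" using C2 v sub(1) V.subspace_add by simp
    then show ?thesis using p ab(3) by (simp add: algebra_simps)
  qed
  have sub1: "U \<subseteq> range \<eta>"
  proof
    fix v assume v: "v \<in> U"
    then obtain c a w r where k: "v = \<psi> (c, a, w) + \<eta> r" using U\<xi> unfolding \<xi> by fastforce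
    \<comment> \<open>Translation by \<open>v\<close> preserves the vectors spanning points of X,
      and on the quadric coordinates it is the shift by \<open>(c, a, w)\<close>.\<close>
    have tr: "isotropic ((x, y, \<gamma>) + (c, a, w))" if "isotropic (x, y, \<gamma>)" "(x, y, \<gamma>) \<noteq> 0" for x y \<gamma>
    proof -
      have "C (\<psi> (x, y, \<gamma>) + \<eta> 0)" using C1 that by blast
      then have "C (\<psi> ((x, y, \<gamma>) + (c, a, w)) + \<eta> r)"
        using transl[OF _ v] by (simp only: k \<psi>.add \<eta>.zero add_0_right add.assoc)
      then show ?thesis using C1 by blast
    qed
    have "(c, a, w) = 0"
    proof (rule ccontr)
      assume n: "(c, a, w) \<noteq> 0"
      define e where "e = N w - c * a"
      have e0: "e \<noteq> 0" using nC[OF v] n unfolding k C1 e_def by simp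
      \<comment> \<open>Shifting \<open>(1, 0, 0)\<close> and \<open>(0, 1, 0)\<close> gives
        \<open>a = c = e\<close>; shifting the further isotropic vectors \<open>(1, N y, y)\<close>
        expresses \<open>e * N y\<close> linearly in \<open>y\<close>.\<close>
      have a: "a = e" using tr[of 1 0 0] by (simp add: e_def algebra_simps zero_prod_def)
      have c: "c = e" using tr[of 0 1 0] by (simp add: e_def algebra_simps zero_prod_def)
      have y: "e * N y = T (w * cnj y)" for y
      proof -
        have "(1 + c) * (N y + a) = N (w + y)" using tr[of 1 "N y" y] by (simp add: zero_prod_def add.commute)
        then have "c * a + c * N y + a = N w + T (w * cnj y)" by (simp add: N_add algebra_simps)
        moreover from a have "a = N w - c * a" unfolding e_def .
        ultimately show ?thesis using c by algebra
      qed
      \<comment> \<open>So \<open>e * N\<close> is additive and its polar form vanishes; evaluated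
        at 1 and \<open>z\<close> this is the claim. It contradicts \<open>e = T w\<close>, the case
        \<open>y = 1\<close> of the preceding identity.\<close>
      have "e * T z = 0" for z
      proof -
        have "e * N (1 + z) = e * N 1 + e * N z" unfolding y by (simp add: cnj_add distrib_left T_add)
        then show ?thesis by (simp add: N_add algebra_simps)
      qed
      then have "T w = 0" using e0 by simp
      then show False using y[of 1] e0 by simp
    qed
    then show "v \<in> range \<eta>" using k \<psi>.zero by simp
  qed
  have "range \<eta> \<subseteq> U"
  proof
    fix v assume v: "v \<in> range \<eta>"
    then obtain r where r: "v = \<eta> r" by blast
    have v\<xi>: "v \<in> \<xi>" unfolding \<xi> r using \<psi>.zero by (metis (mono_tags, lifting) add_0 mem_Collect_eq)
    show "v \<in> U"
    proof (rule ccontr)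
      assume nv: "v \<notin> U"
      obtain a b where ab: "a \<in> U" "b \<in> W" "v = a + b" using V.complement_decomposition[OF compl v\<xi>] by metis
      have b0: "b \<noteq> 0" using ab nv by auto
      have "\<not> C v" using C1[of 0 r] r \<psi>.zero by simp
      then have e0: "q b \<noteq> 0" using C2[OF ab(1,2)] b0 ab(3) by simp
      \<comment> \<open>Translation by \<open>v\<close> also preserves the vectors spanning points
        of X, because \<open>v\<close> lies in the range of \<open>\<eta>\<close>. In the
        coordinates of the unknown cone it shifts \<open>p\<close> by \<open>b\<close>, so
        \<open>q p\<close> and \<open>q (p + b)\<close> both vanish.\<close>
      have pol: "polar_form q p b = - q b" if xp: "x \<in> U" "p \<in> W" "C (x + p)" for x p
      proof -
        have "x + p \<in> \<xi>" using xp(3) by (simp add: C_def)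
        then obtain k r' where k: "x + p = \<psi> k + \<eta> r'" unfolding \<xi> by blast
        then have "C (\<psi> k + \<eta> (r' + r))" using C1 xp(3) by simp
        then have "C ((x + a) + (p + b))"
          using k ab(3) r by (simp add: \<eta>.add algebra_simps)
        then have "q (p + b) = 0" using C2[of "x + a" "p + b"] xp ab sub V.subspace_add by simp
        moreover have "q p = 0" using C2 xp by simp
        ultimately show ?thesis by (simp add: polar_form_def)
      qed
      define k1 k2 :: "'k \<times> 'k \<times> 'b" where "k1 = (1, 0, 0)" and "k2 = (0, 1, 0)"
      have Ck: "C (\<psi> k1)" "C (\<psi> k2)"
        using C1[of k1 0] C1[of k2 0] \<eta>.zero by (simp_all add: k1_def k2_def zero_prod_def)
      obtain a1 p1 where 1: "a1 \<in> U" "p1 \<in> W" "\<psi> k1 = a1 + p1"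
        using V.complement_decomposition[OF compl] Ck(1) C_def by metis
      obtain a2 p2 where 2: "a2 \<in> U" "p2 \<in> W" "\<psi> k2 = a2 + p2"
        using V.complement_decomposition[OF compl] Ck(2) C_def by metis
      have p: "polar_form q p1 b = - q b" "polar_form q p2 b = - q b"
        using pol 1 2 Ck by auto
      \<comment> \<open>The polar form in \<open>pol\<close> is linear in \<open>p\<close>, while
        the right-hand side stays the same when \<open>p\<close> is scaled by
        \<open>c\<close>.\<close>
      have F2: "c = 1" if c: "c \<noteq> 0" for c :: 'k
      proof -
        have "C (s c (\<psi> k1))"
          using C1[of "sclQ c k1" 0] c \<eta>.zero by (simp add: \<psi>.scale[symmetric] k1_def zero_prod_def)
        then have "C (s c a1 + s c p1)" using 1 by (simp add: V.scale_right_distrib)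
        then have "polar_form q (s c p1) b = - q b"
          using pol[OF V.subspace_scale[OF sub(1) 1(1)] V.subspace_scale[OF sub(2) 1(2)]] by blast
        moreover have "polar_form q (s c p1) b = c * polar_form q p1 b"
          using qf 1 ab by (simp add: quadratic_form_on_def)
        ultimately show ?thesis using p e0 by simp
      qed
      have two: "(1 :: 'k) + 1 = 0" using F2[of "- 1"] by (simp add: eq_neg_iff_add_eq_0)
      have q1: "q x = 1" if "\<not> C (y + x)" "y \<in> U" "x \<in> W" "y + x \<notin> U" for x y
      proof -
        have "x \<noteq> 0" using that by auto
        then show ?thesis using that C2 F2 by blast
      qed
      \<comment> \<open>Over the field with two elements, neither \<open>p1 + p2\<close> nor its
        shift by \<open>b\<close> is isotropic, so \<open>q\<close> is 1 on both; it is 1 on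
        \<open>b\<close> as well. The polar forms of \<open>p1\<close> and \<open>p2\<close> with
        \<open>b\<close> add up to zero, and \<open>1 = 1 + 1\<close> results.\<close>
      have notU: "\<psi> (k1 + k2) + \<eta> r' \<notin> U" for r'
      proof
        assume "\<psi> (k1 + k2) + \<eta> r' \<in> U"
        then obtain r'' where "\<psi> (k1 + k2) + \<eta> r' = \<eta> r''" using sub1 by blast
        then have "\<psi> (k1 + k2) + \<eta> (r' - r'') = 0" by (simp add: \<eta>.diff add_diff_eq)
        then have "k1 + k2 = 0" using inj by blast
        then show False by (simp add: k1_def k2_def zero_prod_def)
      qed
      have notC: "\<not> C (\<psi> (k1 + k2) + \<eta> r')" for r'
        unfolding C1 by (simp add: k1_def k2_def zero_prod_def)
      have eq: "\<psi> (k1 + k2) + \<eta> 0 = (a1 + a2) + (p1 + p2)" "\<psi> (k1 + k2) + \<eta> r = (a1 + a2 + a) + (p1 + p2 + b)"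
        using 1 2 ab r by (simp_all add: \<psi>.add \<eta>.zero algebra_simps)
      have "q (p1 + p2) = 1"
        using q1[of "a1 + a2" "p1 + p2"] notC[of 0] notU[of 0] 1 2 sub V.subspace_add unfolding eq by simp
      moreover have "q (p1 + p2 + b) = 1"
        using q1[of "a1 + a2 + a" "p1 + p2 + b"] notC[of r] notU[of r] 1 2 ab sub V.subspace_add unfolding eq by simp
      moreover have "q b = 1" using F2 e0 by blast
      moreover have "polar_form q (p1 + p2) b = polar_form q p1 b + polar_form q p2 b"
        using qf 1 2 ab by (simp add: quadratic_form_on_def)
      ultimately show False using p two by (simp add: polar_form_def algebra_simps)
    qed
  qed
  with sub1 show ?thesis by blast
qed

end

section \<open>The ambient spaces\<close>

context quadratic_algebra_dim
begin

abbreviation s\<^sub>0 where "s\<^sub>0 \<equiv> ambient_scale (base_algebra scl T)"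
abbreviation s\<^sub>A where "s\<^sub>A \<equiv> ambient_scale (CD_zero scl T)"

lemma vector_space_scl2: "vector_space scl2" and vector_space_scl3: "vector_space scl3"
  by unfold_locales

lemma has_dimension_field: "has_dimension ((*) :: 'k \<Rightarrow> 'k \<Rightarrow> 'k) 1 UNIV"
proof -
  interpret K: vector_space "(*) :: 'k \<Rightarrow> 'k \<Rightarrow> 'k" by (rule vector_space_mult)
  have "K.span {1} = UNIV" unfolding K.span_singleton by auto
  then show ?thesis using K.has_dimension_1[of 1] by simp
qed

lemmas vs_intros = vector_space_scale_prod vector_space_mult B.vector_space_axioms vector_space_scl2

lemma vector_space_s0: "vector_space s\<^sub>0"
  and s0_Pair [simp]: "s\<^sub>0 k ((x, y, z), (a, b, c)) = ((k * x, k * y, k * z), (scl k a, scl k b, scl k c))"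
proof -
  show "vector_space s\<^sub>0"
    by (simp add: ambient_scale_def base_algebra_def vs_intros)
  show "s\<^sub>0 k ((x, y, z), (a, b, c)) = ((k * x, k * y, k * z), (scl k a, scl k b, scl k c))"
    by (simp add: ambient_scale_def base_algebra_def vs_intros scale_prod_Pair)
qed

lemma scal_A: "scal (CD_zero scl T) = scl2"
  by (simp add: CD_zero_def Let_def)

lemma vector_space_sA: "vector_space s\<^sub>A"
  and sA_Pair [simp]: "s\<^sub>A k ((x, y, z), (a, b, c)) = ((k * x, k * y, k * z), (scl2 k a, scl2 k b, scl2 k c))"
  and dim_sA: "has_dimension s\<^sub>A (6 * d + 3) UNIV"
proof -
  show "vector_space s\<^sub>A"
    by (simp add: ambient_scale_def scal_A vs_intros)
  show "s\<^sub>A k ((x, y, z), (a, b, c)) = ((k * x, k * y, k * z), (scl2 k a, scl2 k b, scl2 k c))"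
    by (simp only: ambient_scale_def scal_A vs_intros scale_prod_Pair)
  have "has_dimension s\<^sub>A ((1 + (1 + 1)) + (2 * d + (2 * d + 2 * d))) UNIV"
    unfolding ambient_scale_def scal_A
    by (intro has_dimension_scale_prod vs_intros has_dimension_field dim_B2)
  moreover have "(1 + (1 + 1)) + (2 * d + (2 * d + 2 * d)) = 6 * d + 3" by simp
  ultimately show "has_dimension s\<^sub>A (6 * d + 3) UNIV" by metis
qed

sublocale M: vector_space s\<^sub>0 by (rule vector_space_s0)
sublocale Amb: quadratic_algebra_space scl T N d s\<^sub>A
  by (intro quadratic_algebra_space.intro quadratic_algebra_dim_axioms vector_space_sA)

definition emb :: "('k, 'b) ambient \<Rightarrow> 'b \<times> 'b \<times> 'b \<Rightarrow> ('k, 'b \<times> 'b) ambient" where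
  "emb M t = (case (M, t) of ((k, a, b, c), (t\<^sub>1, t\<^sub>2, t\<^sub>3)) \<Rightarrow> (k, (a, t\<^sub>1), (b, t\<^sub>2), (c, t\<^sub>3)))"

lemma emb_Pair [simp]: "emb (k, a, b, c) (t\<^sub>1, t\<^sub>2, t\<^sub>3) = (k, (a, t\<^sub>1), (b, t\<^sub>2), (c, t\<^sub>3))"
  by (simp add: emb_def)

lemma emb_add: "emb M t + emb M' t' = emb (M + M') (t + t')"
  by (cases M; cases t; cases M'; cases t') simp

lemma emb_diff: "emb M t - emb M' t' = emb (M - M') (t - t')"
  by (cases M; cases t; cases M'; cases t') simp

lemma emb_scale: "s\<^sub>A k (emb M t) = emb (s\<^sub>0 k M) (scl3 k t)"
  by (cases M; cases t) auto

lemma emb_zero: "emb 0 0 = 0"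
  by (simp add: zero_prod_def)

lemma emb_inject [simp]: "emb M t = emb M' t' \<longleftrightarrow> M = M' \<and> t = t'"
  by (cases M; cases t; cases M'; cases t') auto

lemma emb_eq_0_iff [simp]: "emb M t = 0 \<longleftrightarrow> M = 0 \<and> t = 0"
  using emb_inject[of M t 0 0] by (simp add: emb_zero)

lemma emb_surj: obtains M t where "v = emb M t"
proof -
  obtain k a t\<^sub>1 b t\<^sub>2 c t\<^sub>3 where "v = (k, (a, t\<^sub>1), (b, t\<^sub>2), (c, t\<^sub>3))"
    by (metis surj_pair)
  then have "v = emb (k, a, b, c) (t\<^sub>1, t\<^sub>2, t\<^sub>3)" by simp
  then show thesis by (rule that)
qed

lemma linear_emb_left: "Vector_Spaces.linear s\<^sub>0 s\<^sub>A (\<lambda>M. emb M 0)"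
  unfolding Vector_Spaces.linear_iff
  by (simp add: vector_space_s0 vector_space_sA emb_add emb_scale)

lemma linear_emb_right: "Vector_Spaces.linear scl3 s\<^sub>A (\<lambda>t. emb 0 t)"
  unfolding Vector_Spaces.linear_iff
  by (simp add: vector_space_scl3 vector_space_sA emb_add emb_scale)

section \<open>Hermitian matrices\<close>

text \<open>An element \<open>((k\<^sub>1, k\<^sub>2, k\<^sub>3), (a, b, c))\<close> is read as the Hermitian matrix with diagonal
  \<open>k\<^sub>1, k\<^sub>2, k\<^sub>3\<close> and entries \<open>a\<close>, \<open>b\<close>, \<open>c\<close> in the positions \<open>(2, 3)\<close>, \<open>(3, 1)\<close>, \<open>(1, 2)\<close>. Then \<open>rho p\<close> is
  \<open>p p\<^sup>*\<close>, \<open>herm u w \<gamma>\<close> is \<open>u \<gamma> w\<^sup>* + w \<gamma>\<^sup>* u\<^sup>*\<close>, and \<open>ev t t' M\<close> is \<open>t\<^sup>* M t'\<close>.\<close>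

definition rho :: "'b \<times> 'b \<times> 'b \<Rightarrow> ('k, 'b) ambient" where
  "rho = (\<lambda>(x, y, z). ((N x, N y, N z), (y * cnj z, z * cnj x, x * cnj y)))"

definition herm :: "'b \<times> 'b \<times> 'b \<Rightarrow> 'b \<times> 'b \<times> 'b \<Rightarrow> 'b \<Rightarrow> ('k, 'b) ambient" where
  "herm = (\<lambda>(u\<^sub>1, u\<^sub>2, u\<^sub>3) (w\<^sub>1, w\<^sub>2, w\<^sub>3) \<gamma>.
     ((T (u\<^sub>1 * \<gamma> * cnj w\<^sub>1), T (u\<^sub>2 * \<gamma> * cnj w\<^sub>2), T (u\<^sub>3 * \<gamma> * cnj w\<^sub>3)),
      (u\<^sub>2 * \<gamma> * cnj w\<^sub>3 + w\<^sub>2 * cnj \<gamma> * cnj u\<^sub>3, u\<^sub>3 * \<gamma> * cnj w\<^sub>1 + w\<^sub>3 * cnj \<gamma> * cnj u\<^sub>1,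
       u\<^sub>1 * \<gamma> * cnj w\<^sub>2 + w\<^sub>1 * cnj \<gamma> * cnj u\<^sub>2)))"

definition ev :: "'b \<times> 'b \<times> 'b \<Rightarrow> 'b \<times> 'b \<times> 'b \<Rightarrow> ('k, 'b) ambient \<Rightarrow> 'b" where
  "ev = (\<lambda>(t\<^sub>1, t\<^sub>2, t\<^sub>3) (r\<^sub>1, r\<^sub>2, r\<^sub>3) ((k\<^sub>1, k\<^sub>2, k\<^sub>3), (a, b, c)).
     cnj t\<^sub>1 * (scl k\<^sub>1 r\<^sub>1 + c * r\<^sub>2 + cnj b * r\<^sub>3)
     + cnj t\<^sub>2 * (cnj c * r\<^sub>1 + scl k\<^sub>2 r\<^sub>2 + a * r\<^sub>3)
     + cnj t\<^sub>3 * (b * r\<^sub>1 + cnj a * r\<^sub>2 + scl k\<^sub>3 r\<^sub>3))"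

definition line_map :: "'b \<times> 'b \<times> 'b \<Rightarrow> 'b \<times> 'b \<times> 'b \<Rightarrow> 'k \<times> 'k \<times> 'b \<Rightarrow> ('k, 'b) ambient" where
  "line_map u w k = s\<^sub>0 (fst k) (rho u) + s\<^sub>0 (fst (snd k)) (rho w) + herm u w (snd (snd k))"

lemma rho_Pair [simp]: "rho (x, y, z) = ((N x, N y, N z), (y * cnj z, z * cnj x, x * cnj y))"
  by (simp add: rho_def)

lemma herm_Pair [simp]: "herm (u\<^sub>1, u\<^sub>2, u\<^sub>3) (w\<^sub>1, w\<^sub>2, w\<^sub>3) \<gamma> =
     ((T (u\<^sub>1 * \<gamma> * cnj w\<^sub>1), T (u\<^sub>2 * \<gamma> * cnj w\<^sub>2), T (u\<^sub>3 * \<gamma> * cnj w\<^sub>3)),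
      (u\<^sub>2 * \<gamma> * cnj w\<^sub>3 + w\<^sub>2 * cnj \<gamma> * cnj u\<^sub>3, u\<^sub>3 * \<gamma> * cnj w\<^sub>1 + w\<^sub>3 * cnj \<gamma> * cnj u\<^sub>1,
       u\<^sub>1 * \<gamma> * cnj w\<^sub>2 + w\<^sub>1 * cnj \<gamma> * cnj u\<^sub>2))"
  by (simp add: herm_def)

lemma ev_Pair [simp]: "ev (t\<^sub>1, t\<^sub>2, t\<^sub>3) (r\<^sub>1, r\<^sub>2, r\<^sub>3) ((k\<^sub>1, k\<^sub>2, k\<^sub>3), (a, b, c)) =
     cnj t\<^sub>1 * (scl k\<^sub>1 r\<^sub>1 + c * r\<^sub>2 + cnj b * r\<^sub>3)
     + cnj t\<^sub>2 * (cnj c * r\<^sub>1 + scl k\<^sub>2 r\<^sub>2 + a * r\<^sub>3)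
     + cnj t\<^sub>3 * (b * r\<^sub>1 + cnj a * r\<^sub>2 + scl k\<^sub>3 r\<^sub>3)"
  by (simp add: ev_def)

lemma line_map_Pair: "line_map u w (x, y, \<gamma>) = s\<^sub>0 x (rho u) + s\<^sub>0 y (rho w) + herm u w \<gamma>"
  by (simp add: line_map_def)

lemma scl_T: "scl (T a) b = a * b + cnj a * b"
proof -
  have "scl (T a) b = scl (T a) 1 * b" by simp
  then show ?thesis unfolding T_eq by (simp add: distrib_right)
qed

lemma ev_add: "ev t t' (M + M') = ev t t' M + ev t t' M'"
proof -
  obtain k1 k2 k3 a b c where M: "M = ((k1, k2, k3), (a, b, c))" by (metis surj_pair)
  obtain l1 l2 l3 a' b' c' where M': "M' = ((l1, l2, l3), (a', b', c'))" by (metis surj_pair)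
  show ?thesis unfolding M M' by (cases t; cases t') (simp add: cnj_simps algebra_simps)
qed

lemma ev_scale: "ev t t' (s\<^sub>0 k M) = scl k (ev t t' M)"
proof -
  obtain k1 k2 k3 a b c where M: "M = ((k1, k2, k3), (a, b, c))" by (metis surj_pair)
  show ?thesis unfolding M by (cases t; cases t') (simp add: cnj_simps algebra_simps)
qed

lemma ev_rho: "ev t t' (rho p) = hprod t p * hprod p t'"
  by (cases t; cases t'; cases p) (simp add: cnj_simps algebra_simps mult_cnj_left)

lemma ev_herm: "ev t t' (herm u w \<gamma>) = hprod t u * \<gamma> * hprod w t' + hprod t w * cnj \<gamma> * hprod u t'"
  by (cases t; cases t'; cases u; cases w) (simp add: scl_T cnj_simps algebra_simps)

lemma ev_line_map:
  "ev t t' (line_map u w (x, y, \<gamma>)) = scl x (hprod t u * hprod u t') + scl y (hprod t w * hprod w t')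
     + (hprod t u * \<gamma> * hprod w t' + hprod t w * cnj \<gamma> * hprod u t')"
  by (simp add: line_map_Pair ev_add ev_scale ev_rho ev_herm)

lemma rho_rmul: "rho (rmul p r) = s\<^sub>0 (N r) (rho p)"
  by (cases p) (simp add: N_mult cnj_mult mult.assoc mult_cnj_left mult.commute)

section \<open>Points of a line and its quadric\<close>

lemma rho_combination:
  "rho (rmul u \<alpha> + rmul w \<beta>) = line_map u w (N \<alpha>, N \<beta>, \<alpha> * cnj \<beta>)"
  by (cases u; cases w)
     (simp add: line_map_Pair N_add N_mult cnj_simps algebra_simps mult_cnj_left)

lemma rho_add: "rho (u + w) = line_map u w (1, 1, 1)"
  using rho_combination[of u 1 w 1] by simp

lemma linear_line_map: "Vector_Spaces.linear sclQ s\<^sub>0 (line_map u w)"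
proof -
  obtain u1 u2 u3 where u: "u = (u1, u2, u3)" by (cases u)
  obtain w1 w2 w3 where w: "w = (w1, w2, w3)" by (cases w)
  have "line_map u w ((x, y, \<gamma>) + (x', y', \<gamma>')) = line_map u w (x, y, \<gamma>) + line_map u w (x', y', \<gamma>')" for x y \<gamma> x' y' \<gamma>'
    by (simp add: u w line_map_Pair cnj_simps T_add algebra_simps)
  moreover have "line_map u w (sclQ k (x, y, \<gamma>)) = s\<^sub>0 k (line_map u w (x, y, \<gamma>))" for k x y \<gamma>
    by (simp add: u w line_map_Pair cnj_simps T_add T_scl algebra_simps)
  ultimately show ?thesis
    unfolding Vector_Spaces.linear_iff using vector_space_sclQ vector_space_s0 by (metis surj_pair)
qed

lemma rho_nonzero: "p \<noteq> 0 \<Longrightarrow> rho p \<noteq> 0"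
  by (cases p) (auto simp: zero_prod_def)

lemma line_map_inject:
  assumes f: "frame m u w t t'" and e: "line_map u w k = line_map u w k'"
  shows "k = k'"
proof -
  obtain x y \<gamma> x' y' \<gamma>' where k: "k = (x, y, \<gamma>)" "k' = (x', y', \<gamma>')" by (cases k; cases k')
  show ?thesis
    using arg_cong[OF e, of "ev t t"] arg_cong[OF e, of "ev t' t'"] arg_cong[OF e, of "ev t t'"]
    unfolding k ev_line_map by (simp add: frameD[OF f])
qed

lemma line_map_eq_0_iff:
  assumes f: "frame m u w t t'" shows "line_map u w k = 0 \<longleftrightarrow> k = 0"
proof -
  interpret L: Vector_Spaces.linear sclQ s\<^sub>0 "line_map u w" by (rule linear_line_map)
  have "line_map u w 0 = 0" by (rule L.zero)
  then show ?thesis using line_map_inject[OF f] by metis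
qed

text \<open>Every matrix in the range of \<open>line_map\<close> is annihilated by \<open>m*\<close>
  from the left. For \<open>p p*\<close> this says that \<open>hprod m p * hprod p \<tau>\<close>
  vanishes for all \<open>\<tau>\<close>, and nondegeneracy puts \<open>p\<close> on the
  line.\<close>

lemma line_map_eq_rho:
  assumes f: "frame m u w t t'" and p: "p \<noteq> 0" and c: "c \<noteq> 0" and e: "line_map u w k = s\<^sub>0 c (rho p)"
  obtains \<alpha> \<beta> where "p = rmul u \<alpha> + rmul w \<beta>" "k = sclQ c (N \<alpha>, N \<beta>, \<alpha> * cnj \<beta>)"
proof -
  obtain x y \<gamma> where k: "k = (x, y, \<gamma>)" by (cases k)
  have "hprod m p * hprod p \<tau> = 0" for \<tau>
    using arg_cong[OF e, of "ev m \<tau>"] c unfolding k ev_line_map ev_scale ev_rho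
    by (simp add: frameD[OF f])
  then have "hprod m p = 0" using hprod_nondegenerate[OF p] by auto
  then obtain \<alpha> \<beta> where p': "p = rmul u \<alpha> + rmul w \<beta>" using frameD(10)[OF f] by blast
  have "line_map u w k = line_map u w (sclQ c (N \<alpha>, N \<beta>, \<alpha> * cnj \<beta>))"
    using linear_line_map unfolding e p' rho_combination by (simp add: Vector_Spaces.linear_iff)
  then show thesis using that p' line_map_inject[OF f] by blast
qed

text \<open>Each vector orthogonal to \<open>p\<close> annihilates \<open>p p*\<close>, hence also
  \<open>p' p'*\<close>, hence is orthogonal to \<open>p'\<close>. The double orthogonal of
  \<open>p\<close> then supplies the factor.\<close>

lemma rho_proportional:
  assumes p: "p \<noteq> 0" "p' \<noteq> 0" and e: "rho p' = s\<^sub>0 c (rho p)"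
  obtains r where "p' = rmul p r"
proof -
  have "hprod \<tau> p' = 0" if "hprod p \<tau> = 0" for \<tau>
  proof -
    have "hprod \<tau> p' * hprod p' \<sigma> = 0" for \<sigma>
      using arg_cong[OF e, of "ev \<tau> \<sigma>"] that hprod_eq_0_commute[of p \<tau>]
      unfolding ev_scale ev_rho by simp
    then show ?thesis using hprod_nondegenerate[OF p(2)] by auto
  qed
  then show thesis using perp_perp[OF p(1)] that by blast
qed

text \<open>Surjectivity of the parametrisation of the quadric by the projective line over B: for
  \<open>y \<noteq> 0\<close> the point is \<open>\<gamma> / y\<close> relative to 1, and for
  \<open>y = 0\<close> anisotropy of \<open>N\<close> leaves only a multiple of
  \<open>(1, 0, 0)\<close>.\<close>

lemma isotropic_parametrization:
  assumes "isotropic k" "k \<noteq> 0"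
  obtains c \<alpha> \<beta> where "c \<noteq> 0" "\<alpha> \<noteq> 0 \<or> \<beta> \<noteq> 0" "k = sclQ c (N \<alpha>, N \<beta>, \<alpha> * cnj \<beta>)"
proof -
  obtain x y \<gamma> where k: "k = (x, y, \<gamma>)" by (cases k)
  have iso: "x * y = N \<gamma>" using assms(1) k by simp
  show thesis
  proof (cases "y = 0")
    case True
    then have "\<gamma> = 0" using iso by simp
    then have "x \<noteq> 0" using assms(2) k True by (auto simp: zero_prod_def)
    then show thesis using that[of x 1 0] \<open>\<gamma> = 0\<close> True k by simp
  next
    case False
    have "x = y * N (scl (inverse y) \<gamma>)"
      using False iso[symmetric] by (simp add: N_scl power2_eq_square field_simps)
    then have "k = sclQ y (N (scl (inverse y) \<gamma>), N 1, scl (inverse y) \<gamma> * cnj 1)"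
      using False k by simp
    then show thesis using that[of y "scl (inverse y) \<gamma>" 1] False by simp
  qed
qed

lemma isotropic_rank_1: "isotropic (sclQ c (N \<alpha>, N \<beta>, \<alpha> * cnj \<beta>))"
  by (simp add: N_scl N_mult power2_eq_square)

definition line_space :: "'b \<times> 'b \<times> 'b \<Rightarrow> ('k, 'b) ambient set" where
  "line_space m = M.span (rho ` {p. hprod m p = 0})"

lemma line_space_eq:
  assumes f: "frame m u w t t'"
  shows "line_space m = range (line_map u w)"
proof
  interpret L: Vector_Spaces.linear sclQ s\<^sub>0 "line_map u w" by (rule linear_line_map)
  have "rho ` {p. hprod m p = 0} \<subseteq> range (line_map u w)"
  proof (intro image_subsetI)
    fix p assume "p \<in> {p. hprod m p = 0}"
    then obtain \<alpha> \<beta> where "p = rmul u \<alpha> + rmul w \<beta>" using frameD(10)[OF f] by blast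
    then show "rho p \<in> range (line_map u w)" by (simp add: rho_combination)
  qed
  then show "line_space m \<subseteq> range (line_map u w)"
    unfolding line_space_def by (rule M.span_minimal) (rule L.subspace_image[OF L.vs1.subspace_UNIV])
  have mem: "line_map u w (N \<alpha>, N \<beta>, \<alpha> * cnj \<beta>) \<in> line_space m" for \<alpha> \<beta>
    unfolding line_space_def rho_combination[symmetric] using frameD(10)[OF f]
    by (intro M.span_base imageI) blast
  show "range (line_map u w) \<subseteq> line_space m"
  proof
    fix M assume "M \<in> range (line_map u w)"
    then obtain x y \<gamma> where M: "M = line_map u w (x, y, \<gamma>)" by auto
    \<comment> \<open>The images of \<open>u\<close>, \<open>w\<close> and
      \<open>u \<gamma> + w\<close> suffice to span the vector; only the last carries the entry
      \<open>\<gamma>\<close>.\<close>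
    have "(x, y, \<gamma>) = sclQ (x - N \<gamma>) (1, 0, 0) + sclQ (y - 1) (0, 1, 0) + (N \<gamma>, 1, \<gamma>)" by simp
    then have "M = s\<^sub>0 (x - N \<gamma>) (line_map u w (1, 0, 0)) + s\<^sub>0 (y - 1) (line_map u w (0, 1, 0)) + line_map u w (N \<gamma>, 1, \<gamma>)"
      unfolding M by (metis L.add L.scale)
    then show "M \<in> line_space m"
      using mem[of 1 0] mem[of 0 1] mem[of \<gamma> 1]
      unfolding line_space_def by (simp add: M.span_add M.span_scale)
  qed
qed

lemma subspace_line_space: "M.subspace (line_space m)"
  by (simp add: line_space_def)

lemma rho_in_line_space_iff:
  assumes m: "m \<noteq> 0" and p: "p \<noteq> 0"
  shows "rho p \<in> line_space m \<longleftrightarrow> hprod m p = 0"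
proof
  assume r: "rho p \<in> line_space m"
  obtain u w t t' where f: "frame m u w t t'" using frame_exists m by blast
  obtain k where k: "line_map u w k = s\<^sub>0 1 (rho p)" using r line_space_eq[OF f] by auto
  obtain \<alpha> \<beta> where "p = rmul u \<alpha> + rmul w \<beta>" using line_map_eq_rho[OF f p one_neq_zero k] by blast
  then show "hprod m p = 0" using frameD(10)[OF f] by blast
qed (simp add: line_space_def M.span_base)

section \<open>The Veronese representations\<close>

lemma CD_zero_simps [simp]:
  "mul (CD_zero scl T) (a, b) (c, e) = (a * c, cnj a * e + c * b)"
  "unit (CD_zero scl T) = (1, 0)"
  "conj (CD_zero scl T) (a, b) = (cnj a, - b)"
  "rad (CD_zero scl T) = range (\<lambda>b. (0, b))"
  by (simp_all add: CD_zero_def base_algebra_def Let_def cnj_def)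

lemma base_algebra_simps [simp]:
  "mul (base_algebra scl T) = (*)" "unit (base_algebra scl T) = 1" "conj (base_algebra scl T) = cnj"
  "rad (base_algebra scl T) = {0}" "scal (base_algebra scl T) = scl"
  by (simp_all add: base_algebra_def cnj_def fun_eq_iff)

lemma to_scalar_A: "to_scalar (CD_zero scl T) (scl k 1, 0) = k"
  unfolding to_scalar_def scal_A by (rule the_equality) auto

lemma to_scalar_base: "to_scalar (base_algebra scl T) (scl k 1) = k"
  unfolding to_scalar_def by (rule the_equality) auto

lemma veronese_map_base: "veronese_map (base_algebra scl T) p = M.span {rho p}"
  by (cases p) (simp add: mult_cnj to_scalar_base)

text \<open>The t-parts are those of the products \<open>y * conj z\<close>,
  \<open>z * conj x\<close>, \<open>x * conj y\<close> in \<open>CD_zero\<close>: a cross product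
  with conjugates in it.\<close>

lemma veronese_map_A:
  "veronese_map (CD_zero scl T) ((x, x'), (y, y'), (z, z')) =
     Amb.V.span {emb (rho (x, y, z)) (cnj z * y' - cnj y * z', cnj x * z' - cnj z * x', cnj y * x' - cnj x * y')}"
  by (simp add: mult_cnj to_scalar_A)

lemma span_rho_rmul:
  assumes "r \<noteq> 0" shows "Amb.V.span {emb (rho (rmul p r)) \<tau>} = Amb.V.span {emb (rho p) (scl3 (inverse (N r)) \<tau>)}"
proof -
  have "emb (rho (rmul p r)) \<tau> = s\<^sub>A (N r) (emb (rho p) (scl3 (inverse (N r)) \<tau>))"
    using assms by (cases \<tau>) (simp add: rho_rmul emb_scale)
  then show ?thesis
    using assms Amb.V.span_image_scale[of "{emb (rho p) (scl3 (inverse (N r)) \<tau>)}" "\<lambda>_. N r"] by simp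
qed

lemma hprod_scl3: "hprod p (scl3 k \<tau>) = scl k (hprod p \<tau>)"
  by (cases p; cases \<tau>) (simp add: algebra_simps)

text \<open>The cross product is orthogonal to \<open>(x, y, z)\<close> for points in normal form,
  where a coordinate equals 1; with three noncommuting coordinates this may fail. Conversely, each
  vector orthogonal to a normal form is such a cross product.\<close>

lemma veronese_points:
  "fst (veronese (CD_zero scl T)) = {Amb.V.span {emb (rho p) \<tau>} | p \<tau>. p \<noteq> 0 \<and> hprod p \<tau> = 0}" (is "?L = ?R")
proof
  show "?L \<subseteq> ?R"
  proof
    fix \<pi> assume "\<pi> \<in> ?L"
    then obtain p where p: "p \<in> G2_points (CD_zero scl T)" "\<pi> = veronese_map (CD_zero scl T) p"
      unfolding veronese_def by auto
    from p(1) consider x x' y y' where "p = ((x, x'), (y, y'), (1, 0))"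
      | y y' z' where "p = ((1, 0), (y, y'), (0, z'))" | x' z' where "p = ((0, x'), (1, 0), (0, z'))"
      unfolding G2_points_def by auto
    then obtain q \<tau> where "\<pi> = Amb.V.span {emb (rho q) \<tau>}" "q \<noteq> 0" "hprod q \<tau> = 0"
    proof cases
      case 1
      show thesis
        by (rule that[of "(x, y, 1)" "(y', - x', cnj y * x' - cnj x * y')"])
           (simp_all add: p(2) 1 veronese_map_A zero_prod_def algebra_simps del: veronese_map.simps)
    next
      case 2
      show thesis
        by (rule that[of "(1, y, 0)" "(- (cnj y * z'), z', - y')"])
           (simp_all add: p(2) 2 veronese_map_A zero_prod_def algebra_simps del: veronese_map.simps)
    next
      case 3
      show thesis
        by (rule that[of "(0, 1, 0)" "(- z', 0, x')"])
           (simp_all add: p(2) 3 veronese_map_A zero_prod_def algebra_simps del: veronese_map.simps)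
    qed
    then show "\<pi> \<in> ?R" by blast
  qed
  have normal: "Amb.V.span {emb (rho p) \<tau>} \<in> ?L"
    if "p = (x, y, 1) \<or> p = (1, y, 0) \<or> p = (0, 1, 0)" "hprod p \<tau> = 0" for p \<tau> x y
  proof -
    obtain t1 t2 t3 where t: "\<tau> = (t1, t2, t3)" by (cases \<tau>)
    have "\<exists>q \<in> G2_points (CD_zero scl T). veronese_map (CD_zero scl T) q = Amb.V.span {emb (rho p) \<tau>}"
      using that(1)
    proof (elim disjE)
      assume p: "p = (x, y, 1)"
      \<comment> \<open>Orthogonality fixes one entry of \<open>\<tau>\<close>; the other two are,
        up to sign, the free t-parts of the point.\<close>
      have "t3 = - (cnj y * t2) - cnj x * t1" using that(2) by (simp add: p t algebra_simps eq_neg_iff_add_eq_0)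
      then show ?thesis
        by (intro bexI[of _ "((x, - t2), (y, t1), (1, 0))"])
           (auto simp: p t veronese_map_A G2_points_def simp del: veronese_map.simps)
    next
      assume p: "p = (1, y, 0)"
      have "t1 = - (cnj y * t2)" using that(2) by (simp add: p t algebra_simps eq_neg_iff_add_eq_0)
      then show ?thesis
        by (intro bexI[of _ "((1, 0), (y, - t3), (0, t2))"])
           (auto simp: p t veronese_map_A G2_points_def simp del: veronese_map.simps)
    next
      assume p: "p = (0, 1, 0)"
      have "t2 = 0" using that(2) by (simp add: p t)
      then show ?thesis
        by (intro bexI[of _ "((0, t3), (1, 0), (0, - t1))"])
           (auto simp: p t veronese_map_A G2_points_def simp del: veronese_map.simps)
    qed
    then show ?thesis unfolding veronese_def fst_conv by (elim bexE) (simp only: image_eqI[OF sym])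
  qed
  show "?R \<subseteq> ?L"
  proof
    fix \<pi> assume "\<pi> \<in> ?R"
    then obtain p \<tau> where p: "\<pi> = Amb.V.span {emb (rho p) \<tau>}" "p \<noteq> 0" "hprod p \<tau> = 0" by blast
    \<comment> \<open>Passing to the normal form changes \<open>rho p\<close> only by the scalar
      \<open>N r\<close>, and orthogonality does not depend on the right factor.\<close>
    have step: "\<pi> \<in> ?L" if "p = rmul q r" "r \<noteq> 0" "q = (x, y, 1) \<or> q = (1, y, 0) \<or> q = (0, 1, 0)" for q r x y
    proof -
      have "hprod q \<tau> = 0" using p(3) that by (simp add: hprod_rmul)
      then have "hprod q (scl3 (inverse (N r)) \<tau>) = 0" by (simp add: hprod_scl3)
      then show ?thesis
        using normal[OF that(3)] span_rho_rmul[OF that(2)] p(1) that(1) by metis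
    qed
    from p(2) show "\<pi> \<in> ?L"
    proof (cases rule: normal_form_point)
      case (1 x y r)
      then show ?thesis using step[of "(x, y, 1)" r x y] by simp
    next
      case (2 y r)
      then show ?thesis using step[of "(1, y, 0)" r _ y] by simp
    next
      case (3 r)
      then show ?thesis using step[of "(0, 1, 0)" r] by simp
    qed
  qed
qed

section \<open>The members of \<Xi> in coordinates\<close>

text \<open>\<open>e\<close> and \<open>f\<close> are, up to sign and order, the t-parts of the
  line. The formula is linear in the quadric vector, so that the member of \<Xi> is described by a
  linear map. At the image of \<open>u \<alpha> + w \<beta>\<close> it is orthogonal to that point:
  the pairings with \<open>u\<close> and \<open>w\<close> cancel after multiplication by the
  conjugates of \<open>\<alpha>\<close> and \<open>\<beta>\<close>.\<close>

definition offset ::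
  "'b \<times> 'b \<times> 'b \<Rightarrow> 'b \<times> 'b \<times> 'b \<Rightarrow> 'b \<Rightarrow> 'b \<Rightarrow> 'k \<times> 'k \<times> 'b \<Rightarrow> 'b \<times> 'b \<times> 'b" where
  "offset t t' e f = (\<lambda>(x, y, \<gamma>). rmul t (\<gamma> * e + scl y f) - rmul t' (scl x e + cnj \<gamma> * f))"

lemma offset_Pair: "offset t t' e f (x, y, \<gamma>) = rmul t (\<gamma> * e + scl y f) - rmul t' (scl x e + cnj \<gamma> * f)"
  by (simp add: offset_def)

definition \<psi> where "\<psi> u w t t' e f k = emb (line_map u w k) (offset t t' e f k)"
definition \<eta> where "\<eta> m r = emb 0 (rmul m r)"

lemma linear_\<psi>: "Vector_Spaces.linear sclQ s\<^sub>A (\<psi> u w t t' e f)"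
proof -
  have "offset t t' e f (k + k') = offset t t' e f k + offset t t' e f k'" for k k'
    by (cases k; cases k'; cases t; cases t') (simp add: offset_Pair cnj_simps algebra_simps)
  moreover have "offset t t' e f (sclQ c k) = scl3 c (offset t t' e f k)" for c k
    by (cases k; cases t; cases t') (simp add: offset_Pair cnj_simps algebra_simps)
  ultimately show ?thesis
    using linear_line_map[of u w] unfolding Vector_Spaces.linear_iff \<psi>_def
    by (simp add: vector_space_sA emb_add emb_scale)
qed

lemma linear_\<eta>: "Vector_Spaces.linear scl s\<^sub>A (\<eta> m)"
  unfolding Vector_Spaces.linear_iff \<eta>_def
  by (cases m) (simp add: vector_space_sA B.vector_space_axioms emb_add emb_scale rmul_add_right)

definition line_points where
  "line_points m u w t t' e f =
     {Amb.V.span {\<psi> u w t t' e f (N \<alpha>, 1, \<alpha>) + \<eta> m r} | \<alpha> r. True}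
     \<union> {Amb.V.span {\<psi> u w t t' e f (1, 0, 0) + \<eta> m r} | r. True}"

lemma \<psi>\<eta>: "\<psi> u w t t' e f k + \<eta> m r = emb (line_map u w k) (offset t t' e f k + rmul m r)"
  by (simp add: \<psi>_def \<eta>_def emb_add)

text \<open>Two points with the same quadric vector differ by a vector of the vertex. Once the
  vertex is in the span, the points with \<open>r = 0\<close> supply the quadric part as in
  \<open>line_space_eq\<close>.\<close>

lemma span_line_points:
  "Amb.V.span (\<Union> (line_points m u w t t' e f)) = {\<psi> u w t t' e f k + \<eta> m r | k r. True}" (is "?S = ?R")
proof
  let ?p = "\<psi> u w t t' e f"
  interpret p: Vector_Spaces.linear sclQ s\<^sub>A ?p by (rule linear_\<psi>)
  interpret n: Vector_Spaces.linear scl s\<^sub>A "\<eta> m" by (rule linear_\<eta>)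
  have R: "?R = {x + y | x y. x \<in> range ?p \<and> y \<in> range (\<eta> m)}" by blast
  have sR: "Amb.V.subspace ?R"
    unfolding R using p.subspace_image[OF p.vs1.subspace_UNIV] n.subspace_image[OF B.subspace_UNIV]
    by (rule Amb.V.subspace_sums)
  have "\<pi> \<subseteq> ?R" if \<pi>: "\<pi> \<in> line_points m u w t t' e f" for \<pi>
  proof -
    obtain k r where "\<pi> = Amb.V.span {?p k + \<eta> m r}" using \<pi> unfolding line_points_def by blast
    then show ?thesis using Amb.V.span_singleton_subset_iff[OF sR, of "?p k + \<eta> m r"] by blast
  qed
  then show "?S \<subseteq> ?R" by (intro Amb.V.span_minimal Union_least sR)
  have S1: "?p (N \<alpha>, 1, \<alpha>) + \<eta> m r \<in> ?S" for \<alpha> r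
    by (rule Amb.V.span_base, rule UnionI[of "Amb.V.span {?p (N \<alpha>, 1, \<alpha>) + \<eta> m r}"])
       (auto simp: line_points_def intro: Amb.V.span_base)
  have S2: "?p (1, 0, 0) + \<eta> m r \<in> ?S" for r
    by (rule Amb.V.span_base, rule UnionI[of "Amb.V.span {?p (1, 0, 0) + \<eta> m r}"])
       (auto simp: line_points_def intro: Amb.V.span_base)
  have n0: "\<eta> m 0 = 0" by (rule n.zero)
  have P1: "?p (1, 0, 0) \<in> ?S" and P2: "?p (0, 1, 0) \<in> ?S" and P3: "?p (N \<gamma>, 1, \<gamma>) \<in> ?S" for \<gamma>
    using S2[of 0] S1[of 0 0] S1[of \<gamma> 0] n0 by simp_all
  have E: "\<eta> m r \<in> ?S" for r
    using Amb.V.span_diff[OF S2[of r] P1] by simp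
  show "?R \<subseteq> ?S"
  proof
    fix v assume "v \<in> ?R"
    then obtain x y \<gamma> r where v: "v = ?p (x, y, \<gamma>) + \<eta> m r" by auto
    have "(x, y, \<gamma>) = sclQ (x - N \<gamma>) (1, 0, 0) + sclQ (y - 1) (0, 1, 0) + (N \<gamma>, 1, \<gamma>)" by simp
    then have "?p (x, y, \<gamma>) = s\<^sub>A (x - N \<gamma>) (?p (1, 0, 0)) + s\<^sub>A (y - 1) (?p (0, 1, 0)) + ?p (N \<gamma>, 1, \<gamma>)"
      by (metis p.add p.scale)
    then show "v \<in> ?S" unfolding v using P1 P2 P3 E by (simp add: Amb.V.span_add Amb.V.span_scale)
  qed
qed

lemma veronese_line_point_1:
  assumes "(x, y, z) = rmul u \<alpha> + w"
    and "(cnj z * y' - cnj y * z', cnj x * z' - cnj z * x', cnj y * x' - cnj x * y')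
      = offset t t' e f (N \<alpha>, 1, \<alpha>) + rmul m r"
  shows "veronese_map (CD_zero scl T) ((x, x'), (y, y'), (z, z')) = Amb.V.span {\<psi> u w t t' e f (N \<alpha>, 1, \<alpha>) + \<eta> m r}"
  using rho_combination[of u \<alpha> w 1] unfolding veronese_map_A \<psi>\<eta> assms by simp

lemma veronese_line_point_0:
  assumes "(x, y, z) = u"
    and "(cnj z * y' - cnj y * z', cnj x * z' - cnj z * x', cnj y * x' - cnj x * y')
      = offset t t' e f (1, 0, 0) + rmul m r"
  shows "veronese_map (CD_zero scl T) ((x, x'), (y, y'), (z, z')) = Amb.V.span {\<psi> u w t t' e f (1, 0, 0) + \<eta> m r}"
  using rho_combination[of u 1 w 0] unfolding veronese_map_A \<psi>\<eta> assms by simp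

definition points_on where "points_on l = {p \<in> G2_points (CD_zero scl T). G2_incident (CD_zero scl T) p l}"

text \<open>The incidence equation splits into two. Its B-part is orthogonality to \<open>m\<close>,
  the conjugate of the B-part of the line; its t-part expresses one t-coordinate of the point
  through another, and the free one becomes, up to sign, the parameter \<open>r\<close> of the
  vertex. The next two lemmas are the same computation for the other types of lines.\<close>

lemma line_points_1:
  "veronese_map (CD_zero scl T) ` points_on ((a, a'), (1, 0), (c, c'))
    = line_points (cnj a, 1, cnj c) (1, - a, 0) (0, - c, 1) (1, 0, 0) (0, 0, 1) (- a') (- c')" (is "?L = ?R")
proof
  let ?\<psi> = "\<psi> (1, - a, 0) (0, - c, 1) (1, 0, 0) (0, 0, 1) (- a') (- c')"
  show "?L \<subseteq> ?R"
  proof (intro image_subsetI)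
    fix p assume p: "p \<in> points_on ((a, a'), (1, 0), (c, c'))"
    then consider x x' y y' where "p = ((x, x'), (y, y'), (1, 0))"
      | y y' z' where "p = ((1, 0), (y, y'), (0, z'))" | x' z' where "p = ((0, x'), (1, 0), (0, z'))"
      unfolding points_on_def G2_points_def by auto
    then show "veronese_map (CD_zero scl T) p \<in> ?R"
    proof cases
      case 1
      have e: "y = - a * x - c" "y' = - cnj a * x' - x * a' - c'"
        using p by (simp_all add: 1 points_on_def zero_prod_def algebra_simps eq_neg_iff_add_eq_0)
      have "veronese_map (CD_zero scl T) p = Amb.V.span {?\<psi> (N x, 1, x) + \<eta> (cnj a, 1, cnj c) (- x')}"
        unfolding 1 by (rule veronese_line_point_1) (simp_all add: e offset_Pair cnj_simps algebra_simps cnj_mult_left)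
      then show ?thesis unfolding line_points_def by blast
    next
      case 2
      have e: "y = - a" "y' = - cnj c * z' - a'"
        using p by (simp_all add: 2 points_on_def zero_prod_def algebra_simps eq_neg_iff_add_eq_0)
      have "veronese_map (CD_zero scl T) p = Amb.V.span {?\<psi> (1, 0, 0) + \<eta> (cnj a, 1, cnj c) z'}"
        unfolding 2 by (rule veronese_line_point_0) (simp_all add: e offset_Pair cnj_simps algebra_simps cnj_mult_left)
      then show ?thesis unfolding line_points_def by blast
    next
      case 3
      then show ?thesis using p by (simp add: points_on_def zero_prod_def)
    qed
  qed
  show "?R \<subseteq> ?L"
  proof
    fix \<pi> assume "\<pi> \<in> ?R"
    then consider x r where "\<pi> = Amb.V.span {?\<psi> (N x, 1, x) + \<eta> (cnj a, 1, cnj c) r}"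
      | r where "\<pi> = Amb.V.span {?\<psi> (1, 0, 0) + \<eta> (cnj a, 1, cnj c) r}"
      unfolding line_points_def by blast
    then show "\<pi> \<in> ?L"
    proof cases
      case 1
      show ?thesis
      proof (rule image_eqI)
        show "((x, - r), (- a * x - c, cnj a * r - x * a' - c'), (1, 0)) \<in> points_on ((a, a'), (1, 0), (c, c'))"
          unfolding points_on_def by (intro CollectI conjI, simp add: G2_points_def, simp add: zero_prod_def algebra_simps)
        show "\<pi> = veronese_map (CD_zero scl T) ((x, - r), (- a * x - c, cnj a * r - x * a' - c'), (1, 0))"
          unfolding 1 by (rule veronese_line_point_1[symmetric]) (simp_all add: offset_Pair cnj_simps algebra_simps cnj_mult_left)
      qed
    next
      case 2
      show ?thesis
      proof (rule image_eqI)
        show "((1, 0), (- a, - cnj c * r - a'), (0, r)) \<in> points_on ((a, a'), (1, 0), (c, c'))"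
          unfolding points_on_def by (intro CollectI conjI, simp add: G2_points_def, simp add: zero_prod_def algebra_simps)
        show "\<pi> = veronese_map (CD_zero scl T) ((1, 0), (- a, - cnj c * r - a'), (0, r))"
          unfolding 2 by (rule veronese_line_point_0[symmetric]) (simp_all add: offset_Pair cnj_simps algebra_simps cnj_mult_left)
      qed
    qed
  qed
qed

lemma line_points_2:
  "veronese_map (CD_zero scl T) ` points_on ((1, 0), (0, b'), (c, c'))
    = line_points (1, 0, cnj c) (0, 1, 0) (- c, 0, 1) (0, 1, 0) (0, 0, 1) b' c'" (is "?L = ?R")
proof
  let ?\<psi> = "\<psi> (0, 1, 0) (- c, 0, 1) (0, 1, 0) (0, 0, 1) b' c'"
  show "?L \<subseteq> ?R"
  proof (intro image_subsetI)
    fix p assume p: "p \<in> points_on ((1, 0), (0, b'), (c, c'))"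
    then consider x x' y y' where "p = ((x, x'), (y, y'), (1, 0))"
      | y y' z' where "p = ((1, 0), (y, y'), (0, z'))" | x' z' where "p = ((0, x'), (1, 0), (0, z'))"
      unfolding points_on_def G2_points_def by auto
    then show "veronese_map (CD_zero scl T) p \<in> ?R"
    proof cases
      case 1
      have e: "x = - c" "x' = - y * b' - c'"
        using p by (simp_all add: 1 points_on_def zero_prod_def algebra_simps eq_neg_iff_add_eq_0)
      have "veronese_map (CD_zero scl T) p = Amb.V.span {?\<psi> (N y, 1, y) + \<eta> (1, 0, cnj c) y'}"
        unfolding 1 by (rule veronese_line_point_1) (simp_all add: e offset_Pair cnj_simps algebra_simps cnj_mult_left)
      then show ?thesis unfolding line_points_def by blast
    next
      case 2
      then show ?thesis using p by (simp add: points_on_def zero_prod_def)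
    next
      case 3
      have e: "x' = - cnj c * z' - b'"
        using p by (simp_all add: 3 points_on_def zero_prod_def algebra_simps eq_neg_iff_add_eq_0)
      have "veronese_map (CD_zero scl T) p = Amb.V.span {?\<psi> (1, 0, 0) + \<eta> (1, 0, cnj c) (- z')}"
        unfolding 3 by (rule veronese_line_point_0) (simp_all add: e offset_Pair cnj_simps algebra_simps cnj_mult_left)
      then show ?thesis unfolding line_points_def by blast
    qed
  qed
  show "?R \<subseteq> ?L"
  proof
    fix \<pi> assume "\<pi> \<in> ?R"
    then consider y r where "\<pi> = Amb.V.span {?\<psi> (N y, 1, y) + \<eta> (1, 0, cnj c) r}"
      | r where "\<pi> = Amb.V.span {?\<psi> (1, 0, 0) + \<eta> (1, 0, cnj c) r}"
      unfolding line_points_def by blast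
    then show "\<pi> \<in> ?L"
    proof cases
      case 1
      show ?thesis
      proof (rule image_eqI)
        show "((- c, - y * b' - c'), (y, r), (1, 0)) \<in> points_on ((1, 0), (0, b'), (c, c'))"
          unfolding points_on_def by (intro CollectI conjI, simp add: G2_points_def, simp add: zero_prod_def algebra_simps)
        show "\<pi> = veronese_map (CD_zero scl T) ((- c, - y * b' - c'), (y, r), (1, 0))"
          unfolding 1 by (rule veronese_line_point_1[symmetric]) (simp_all add: offset_Pair cnj_simps algebra_simps cnj_mult_left)
      qed
    next
      case 2
      show ?thesis
      proof (rule image_eqI)
        show "((0, cnj c * r - b'), (1, 0), (0, - r)) \<in> points_on ((1, 0), (0, b'), (c, c'))"
          unfolding points_on_def by (intro CollectI conjI, simp add: G2_points_def, simp add: zero_prod_def algebra_simps)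
        show "\<pi> = veronese_map (CD_zero scl T) ((0, cnj c * r - b'), (1, 0), (0, - r))"
          unfolding 2 by (rule veronese_line_point_0[symmetric]) (simp_all add: offset_Pair cnj_simps algebra_simps cnj_mult_left)
      qed
    qed
  qed
qed

lemma line_points_3:
  "veronese_map (CD_zero scl T) ` points_on ((0, a'), (0, b'), (1, 0))
    = line_points (0, 0, 1) (0, 1, 0) (1, 0, 0) (0, 1, 0) (1, 0, 0) (- b') (- a')" (is "?L = ?R")
proof
  let ?\<psi> = "\<psi> (0, 1, 0) (1, 0, 0) (0, 1, 0) (1, 0, 0) (- b') (- a')"
  show "?L \<subseteq> ?R"
  proof (intro image_subsetI)
    fix p assume p: "p \<in> points_on ((0, a'), (0, b'), (1, 0))"
    then consider x x' y y' where "p = ((x, x'), (y, y'), (1, 0))"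
      | y y' z' where "p = ((1, 0), (y, y'), (0, z'))" | x' z' where "p = ((0, x'), (1, 0), (0, z'))"
      unfolding points_on_def G2_points_def by auto
    then show "veronese_map (CD_zero scl T) p \<in> ?R"
    proof cases
      case 1
      then show ?thesis using p by (simp add: points_on_def zero_prod_def)
    next
      case 2
      have e: "z' = - a' - y * b'"
        using p by (simp_all add: 2 points_on_def zero_prod_def algebra_simps eq_neg_iff_add_eq_0)
      have "veronese_map (CD_zero scl T) p = Amb.V.span {?\<psi> (N y, 1, y) + \<eta> (0, 0, 1) (- y')}"
        unfolding 2 by (rule veronese_line_point_1) (simp_all add: e offset_Pair cnj_simps algebra_simps cnj_mult_left)
      then show ?thesis unfolding line_points_def by blast
    next
      case 3
      have e: "z' = - b'"
        using p by (simp_all add: 3 points_on_def zero_prod_def algebra_simps eq_neg_iff_add_eq_0)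
      have "veronese_map (CD_zero scl T) p = Amb.V.span {?\<psi> (1, 0, 0) + \<eta> (0, 0, 1) x'}"
        unfolding 3 by (rule veronese_line_point_0) (simp_all add: e offset_Pair cnj_simps algebra_simps cnj_mult_left)
      then show ?thesis unfolding line_points_def by blast
    qed
  qed
  show "?R \<subseteq> ?L"
  proof
    fix \<pi> assume "\<pi> \<in> ?R"
    then consider y r where "\<pi> = Amb.V.span {?\<psi> (N y, 1, y) + \<eta> (0, 0, 1) r}"
      | r where "\<pi> = Amb.V.span {?\<psi> (1, 0, 0) + \<eta> (0, 0, 1) r}"
      unfolding line_points_def by blast
    then show "\<pi> \<in> ?L"
    proof cases
      case 1
      show ?thesis
      proof (rule image_eqI)
        show "((1, 0), (y, - r), (0, - a' - y * b')) \<in> points_on ((0, a'), (0, b'), (1, 0))"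
          unfolding points_on_def by (intro CollectI conjI, simp add: G2_points_def, simp add: zero_prod_def algebra_simps)
        show "\<pi> = veronese_map (CD_zero scl T) ((1, 0), (y, - r), (0, - a' - y * b'))"
          unfolding 1 by (rule veronese_line_point_1[symmetric]) (simp_all add: offset_Pair cnj_simps algebra_simps cnj_mult_left)
      qed
    next
      case 2
      show ?thesis
      proof (rule image_eqI)
        show "((0, r), (1, 0), (0, - b')) \<in> points_on ((0, a'), (0, b'), (1, 0))"
          unfolding points_on_def by (intro CollectI conjI, simp add: G2_points_def, simp add: zero_prod_def algebra_simps)
        show "\<pi> = veronese_map (CD_zero scl T) ((0, r), (1, 0), (0, - b'))"
          unfolding 2 by (rule veronese_line_point_0[symmetric]) (simp_all add: offset_Pair cnj_simps algebra_simps cnj_mult_left)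
      qed
    qed
  qed
qed

abbreviation X\<^sub>A where "X\<^sub>A \<equiv> fst (veronese (CD_zero scl T))"
abbreviation \<Xi>\<^sub>A where "\<Xi>\<^sub>A \<equiv> snd (veronese (CD_zero scl T))"

definition line_A where
  "line_A m u w t t' e f = {\<psi> u w t t' e f k + \<eta> m r | k r. True}"

lemma veronese_lines:
  "\<Xi>\<^sub>A = {Amb.V.span (\<Union> (veronese_map (CD_zero scl T) ` points_on l))
     | l. l \<in> G2_lines (CD_zero scl T)}"
  by (simp only: veronese_def snd_conv points_on_def)

lemma lines_A_cases:
  assumes "\<xi> \<in> \<Xi>\<^sub>A"
  obtains m u w t t' e f where "frame m u w t t'" "\<xi> = line_A m u w t t' e f"
proof -
  obtain l where l: "l \<in> G2_lines (CD_zero scl T)"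
    "\<xi> = Amb.V.span (\<Union> (veronese_map (CD_zero scl T) ` points_on l))"
    using assms unfolding veronese_lines by blast
  from l(1) consider a a' c c' where "l = ((a, a'), (1, 0), (c, c'))"
    | b' c c' where "l = ((1, 0), (0, b'), (c, c'))" | a' b' where "l = ((0, a'), (0, b'), (1, 0))"
    unfolding G2_lines_def by auto
  then show thesis
  proof cases
    case 1
    have "\<xi> = line_A (cnj a, 1, cnj c) (1, - a, 0) (0, - c, 1) (1, 0, 0) (0, 0, 1) (- a') (- c')"
      unfolding l(2) 1 line_points_1 span_line_points line_A_def ..
    then show thesis using that frame_normal_1[of "cnj a" "cnj c"] by simp
  next
    case 2
    have "\<xi> = line_A (1, 0, cnj c) (0, 1, 0) (- c, 0, 1) (0, 1, 0) (0, 0, 1) b' c'"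
      unfolding l(2) 2 line_points_2 span_line_points line_A_def ..
    then show thesis using that frame_normal_2[of "cnj c"] by simp
  next
    case 3
    have "\<xi> = line_A (0, 0, 1) (0, 1, 0) (1, 0, 0) (0, 1, 0) (1, 0, 0) (- b') (- a')"
      unfolding l(2) 3 line_points_3 span_line_points line_A_def ..
    then show thesis using that frame_normal_3 by simp
  qed
qed

text \<open>Lines with zero t-part already realise every \<open>m\<close> up to a right factor. This
  suffices both for the list of vertices and for the lines induced on F.\<close>

lemma lines_A_exist:
  assumes "m \<noteq> 0"
  obtains m' u w t t' r where "frame m' u w t t'" "m = rmul m' r" "r \<noteq> 0" "line_A m' u w t t' 0 0 \<in> \<Xi>\<^sub>A"
proof -
  have lin: "Amb.V.span (\<Union> (veronese_map (CD_zero scl T) ` points_on l)) \<in> \<Xi>\<^sub>A"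
    if "l \<in> G2_lines (CD_zero scl T)" for l
    unfolding veronese_lines using that by blast
  from assms show thesis
  proof (cases rule: normal_form_line)
    case (1 a c r)
    have "((cnj a, 0), (1, 0), (cnj c, 0)) \<in> G2_lines (CD_zero scl T)"
      by (simp add: G2_lines_def)
    from lin[OF this] have "line_A (a, 1, c) (1, - cnj a, 0) (0, - cnj c, 1) (1, 0, 0) (0, 0, 1) 0 0 \<in> \<Xi>\<^sub>A"
      unfolding line_points_1 span_line_points line_A_def by simp
    then show thesis using that frame_normal_1 1 by blast
  next
    case (2 c r)
    have "((1, 0), (0, 0), (cnj c, 0)) \<in> G2_lines (CD_zero scl T)"
      by (simp add: G2_lines_def)
    from lin[OF this] have "line_A (1, 0, c) (0, 1, 0) (- cnj c, 0, 1) (0, 1, 0) (0, 0, 1) 0 0 \<in> \<Xi>\<^sub>A"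
      unfolding line_points_2 span_line_points line_A_def by simp
    then show thesis using that frame_normal_2 2 by blast
  next
    case (3 r)
    have "((0, 0), (0, 0), (1, 0)) \<in> G2_lines (CD_zero scl T)"
      by (simp add: G2_lines_def)
    from lin[OF this] have "line_A (0, 0, 1) (0, 1, 0) (1, 0, 0) (0, 1, 0) (1, 0, 0) 0 0 \<in> \<Xi>\<^sub>A"
      unfolding line_points_3 span_line_points line_A_def by simp
    then show thesis using that frame_normal_3 3 by blast
  qed
qed

lemma offset_orthogonal:
  assumes f: "frame m u w t t'"
  shows "hprod (rmul u \<alpha> + rmul w \<beta>) (offset t t' e f' (sclQ c (N \<alpha>, N \<beta>, \<alpha> * cnj \<beta>))) = 0"
  by (simp add: offset_Pair hprod_add hprod_rmul hprod_rmul_right hprod_diff_right frameD[OF f]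
      cnj_simps algebra_simps cnj_mult_left mult_cnj_left)

text \<open>Rank one forces isotropy. Conversely, an isotropic vector comes from a point
  \<open>u \<alpha> + w \<beta>\<close>; the offset is orthogonal to this point and so is
  \<open>m\<close>, so the vertex part is unrestricted. This is the cone structure required by the
  general lemmas on vertices.\<close>

lemma line_A_points_iff:
  assumes f: "frame m u w t t'"
  shows "Amb.V.span {\<psi> u w t t' e f' k + \<eta> m r} \<in> X\<^sub>A \<longleftrightarrow> k \<noteq> 0 \<and> isotropic k"
proof
  assume "Amb.V.span {\<psi> u w t t' e f' k + \<eta> m r} \<in> X\<^sub>A"
  then obtain p \<tau> where p: "p \<noteq> 0" "hprod p \<tau> = 0"
    "Amb.V.span {emb (rho p) \<tau>} = Amb.V.span {emb (line_map u w k) (offset t t' e f' k + rmul m r)}"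
    unfolding veronese_points \<psi>\<eta> by auto
  have "emb (rho p) \<tau> \<noteq> 0" using rho_nonzero[OF p(1)] by simp
  then obtain c where c: "c \<noteq> 0" "emb (line_map u w k) (offset t t' e f' k + rmul m r) = s\<^sub>A c (emb (rho p) \<tau>)"
    using Amb.V.span_singleton_eq_iff p(3) by blast
  then have l: "line_map u w k = s\<^sub>0 c (rho p)" unfolding emb_scale emb_inject by blast
  obtain \<alpha> \<beta> where "p = rmul u \<alpha> + rmul w \<beta>" "k = sclQ c (N \<alpha>, N \<beta>, \<alpha> * cnj \<beta>)"
    by (rule line_map_eq_rho[OF f p(1) c(1) l])
  then have "isotropic k" using isotropic_rank_1 by simp
  moreover have "k \<noteq> 0" using l line_map_eq_0_iff[OF f, of k] c(1) rho_nonzero[OF p(1)] by auto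
  ultimately show "k \<noteq> 0 \<and> isotropic k" by blast
next
  assume "k \<noteq> 0 \<and> isotropic k"
  then obtain c \<alpha> \<beta> where c: "c \<noteq> 0" "\<alpha> \<noteq> 0 \<or> \<beta> \<noteq> 0" "k = sclQ c (N \<alpha>, N \<beta>, \<alpha> * cnj \<beta>)"
    using isotropic_parametrization by blast
  interpret L: Vector_Spaces.linear sclQ s\<^sub>0 "line_map u w" by (rule linear_line_map)
  define p where "p = rmul u \<alpha> + rmul w \<beta>"
  define \<tau> where "\<tau> = offset t t' e f' k + rmul m r"
  have p0: "p \<noteq> 0" using frame_unique[OF f, of \<alpha> \<beta> 0 0] c(2) by (auto simp: p_def)
  have "hprod p \<tau> = 0"
    using offset_orthogonal[OF f, of \<alpha> \<beta> e f' c]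
    by (simp add: \<tau>_def p_def c(3) hprod_add_right hprod_rmul_right hprod_add hprod_rmul frameD[OF f] del: sclQ_Pair)
  then have h: "hprod p (scl3 (inverse c) \<tau>) = 0" by (simp add: hprod_scl3)
  have "line_map u w k = s\<^sub>0 c (rho p)" unfolding c(3) L.scale p_def rho_combination ..
  then have "emb (line_map u w k) \<tau> = s\<^sub>A c (emb (rho p) (scl3 (inverse c) \<tau>))"
    using c(1) by (cases \<tau>) (simp add: emb_scale)
  moreover have "emb (rho p) (scl3 (inverse c) \<tau>) \<noteq> 0" using rho_nonzero[OF p0] by simp
  ultimately have "Amb.V.span {emb (rho p) (scl3 (inverse c) \<tau>)} = Amb.V.span {emb (line_map u w k) \<tau>}"
    using Amb.V.span_singleton_eq_iff c(1) by blast
  then show "Amb.V.span {\<psi> u w t t' e f' k + \<eta> m r} \<in> X\<^sub>A"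
    unfolding veronese_points \<psi>\<eta> \<tau>_def[symmetric] using p0 h by blast
qed

lemma \<psi>\<eta>_eq_0:
  assumes f: "frame m u w t t'" and "\<psi> u w t t' e f' k + \<eta> m r = 0"
  shows "k = 0 \<and> r = 0"
proof -
  have z: "line_map u w k = 0" "offset t t' e f' k + rmul m r = 0" using assms(2) by (simp_all add: \<psi>\<eta>)
  then have k: "k = 0" using line_map_eq_0_iff[OF f] by blast
  then have "rmul m r = 0" using z(2) by (simp add: offset_def zero_prod_def)
  then show ?thesis using k frameD(1)[OF f] by simp
qed

section \<open>The vertices\<close>

text \<open>The offset parameters change only the complement carrying the base quadric, not the
  vertex.\<close>

lemma is_vertex_line_A:
  assumes f: "frame m u w t t'"
  shows "is_vertex s\<^sub>A X\<^sub>A (line_A m u w t t' e f') V \<longleftrightarrow> V = range (\<eta> m)"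
proof -
  have inj: "\<And>k r. \<psi> u w t t' e f' k + \<eta> m r = 0 \<Longrightarrow> k = 0 \<and> r = 0"
    using \<psi>\<eta>_eq_0[OF f] by blast
  show ?thesis
    using Amb.is_vertex_range[OF linear_\<psi> linear_\<eta> inj line_A_def line_A_points_iff[OF f]]
      Amb.is_vertex_unique[OF linear_\<psi> linear_\<eta> inj line_A_def line_A_points_iff[OF f]]
    by blast
qed

lemma unique_vertex: "\<xi> \<in> \<Xi>\<^sub>A \<Longrightarrow> \<exists>!V. is_vertex s\<^sub>A X\<^sub>A \<xi> V"
  by (elim lines_A_cases) (simp add: is_vertex_line_A)

definition vertices where "vertices = {range (\<eta> m) | m. m \<noteq> 0}"

lemma range_\<eta>_rmul:
  assumes "r \<noteq> 0" shows "range (\<eta> (rmul m r)) = range (\<eta> m)"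
proof -
  have "\<eta> (rmul m r) = \<eta> m \<circ> (*) r" by (simp add: fun_eq_iff \<eta>_def)
  moreover have "range ((*) r) = UNIV" using assms by (intro surjI[of _ "\<lambda>x. binv r * x"]) simp
  ultimately show ?thesis by (simp only: image_comp[symmetric])
qed

lemma vertices_eq: "{V. \<exists>\<xi>\<in>\<Xi>\<^sub>A. is_vertex s\<^sub>A X\<^sub>A \<xi> V} = vertices"
proof (intro equalityI subsetI)
  fix V assume "V \<in> {V. \<exists>\<xi>\<in>\<Xi>\<^sub>A. is_vertex s\<^sub>A X\<^sub>A \<xi> V}"
  then obtain \<xi> where x: "\<xi> \<in> \<Xi>\<^sub>A" "is_vertex s\<^sub>A X\<^sub>A \<xi> V" by blast
  from x(1) obtain m u w t t' e f' where f: "frame m u w t t'" "\<xi> = line_A m u w t t' e f'"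
    using lines_A_cases by blast
  then have "V = range (\<eta> m)" using x(2) is_vertex_line_A[OF f(1)] by simp
  then show "V \<in> vertices" unfolding vertices_def using frameD(1)[OF f(1)] by blast
next
  fix V assume "V \<in> vertices"
  then obtain m where m: "m \<noteq> 0" "V = range (\<eta> m)" unfolding vertices_def by blast
  obtain m' u w t t' r where f: "frame m' u w t t'" "m = rmul m' r" "r \<noteq> 0" "line_A m' u w t t' 0 0 \<in> \<Xi>\<^sub>A"
    using lines_A_exist[OF m(1)] by blast
  have "is_vertex s\<^sub>A X\<^sub>A (line_A m' u w t t' 0 0) V"
    unfolding is_vertex_line_A[OF f(1)] m(2) f(2) by (rule range_\<eta>_rmul[OF f(3)])
  then show "V \<in> {V. \<exists>\<xi>\<in>\<Xi>\<^sub>A. is_vertex s\<^sub>A X\<^sub>A \<xi> V}" using f(4) by blast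
qed

lemma mem_range_\<eta>: "emb M \<tau> \<in> range (\<eta> m) \<longleftrightarrow> M = 0 \<and> (\<exists>r. \<tau> = rmul m r)"
  by (auto simp: \<eta>_def)

lemma range_\<eta>_eq_iff:
  assumes "m' \<noteq> 0" shows "range (\<eta> m) = range (\<eta> m') \<longleftrightarrow> (\<exists>r. m' = rmul m r)"
proof
  assume e: "range (\<eta> m) = range (\<eta> m')"
  have "emb 0 m' \<in> range (\<eta> m')" unfolding mem_range_\<eta> by (metis rmul_one)
  then show "\<exists>r. m' = rmul m r" unfolding e[symmetric] mem_range_\<eta> by blast
next
  assume "\<exists>r. m' = rmul m r"
  then obtain r where "m' = rmul m r" by blast
  then show "range (\<eta> m) = range (\<eta> m')" using range_\<eta>_rmul[of r m] assms by auto
qed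

section \<open>Subspaces spanned by two vertices\<close>

definition \<theta> where "\<theta> u w z = emb 0 (rmul u (fst z) + rmul w (snd z))"

lemma linear_\<theta>: "Vector_Spaces.linear scl2 s\<^sub>A (\<theta> u w)"
proof -
  have "rmul u (scl k a) = scl3 k (rmul u a)" for u k a by (cases u) simp
  then have "rmul u (scl k a) + rmul w (scl k b) = scl3 k (rmul u a + rmul w b)" for k a b
    by (simp add: B3.p.scale_right_distrib)
  then show ?thesis
    unfolding Vector_Spaces.linear_iff \<theta>_def
    by (auto simp: vector_space_scl2 vector_space_sA emb_add emb_scale rmul_add_right add_ac)
qed

lemma inj_\<theta>:
  assumes f: "frame m u w t t'" shows "inj (\<theta> u w)"
proof (rule injI)
  fix x y assume "\<theta> u w x = \<theta> u w y"
  then have "rmul u (fst x) + rmul w (snd x) = rmul u (fst y) + rmul w (snd y)" by (simp add: \<theta>_def)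
  then have "fst x = fst y \<and> snd x = snd y" by (rule frame_unique[OF f])
  then show "x = y" by (simp add: prod_eq_iff)
qed

definition block where "block p = {emb 0 \<tau> | \<tau>. hprod p \<tau> = 0}"

lemma mem_block: "emb M \<tau> \<in> block p \<longleftrightarrow> M = 0 \<and> hprod p \<tau> = 0"
  unfolding block_def mem_Collect_eq emb_inject by blast

lemma range_\<theta>:
  assumes f: "frame p u w t t'" shows "range (\<theta> u w) = block p"
proof
  show "range (\<theta> u w) \<subseteq> block p" unfolding block_def \<theta>_def using frameD(10)[OF f] by blast
  show "block p \<subseteq> range (\<theta> u w)"
  proof
    fix v assume "v \<in> block p"
    then obtain \<tau> where "v = emb 0 \<tau>" "hprod p \<tau> = 0" unfolding block_def by blast
    then obtain a b where "v = emb 0 (rmul u a + rmul w b)" using frameD(10)[OF f, of \<tau>] by blast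
    then have "v = \<theta> u w (a, b)" by (simp add: \<theta>_def)
    then show "v \<in> range (\<theta> u w)" by blast
  qed
qed

lemma span_two_vertices: "Amb.V.span (range (\<eta> u) \<union> range (\<eta> w)) = range (\<theta> u w)"
proof -
  have sub: "Amb.V.subspace (range (\<eta> m))" for m
  proof -
    interpret n: Vector_Spaces.linear scl s\<^sub>A "\<eta> m" by (rule linear_\<eta>)
    show ?thesis by (rule n.subspace_image[OF B.subspace_UNIV])
  qed
  have "Amb.V.span (range (\<eta> u) \<union> range (\<eta> w)) = {x + y | x y. x \<in> range (\<eta> u) \<and> y \<in> range (\<eta> w)}"
    unfolding Amb.V.span_Un Amb.V.span_eq_iff[THEN iffD2, OF sub] ..
  also have "\<dots> = range (\<theta> u w)"
  proof -
    have "\<eta> u (fst z) + \<eta> w (snd z) = \<theta> u w z" "\<eta> u a + \<eta> w b = \<theta> u w (a, b)" for a b z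
      by (simp_all add: \<eta>_def \<theta>_def emb_add)
    then show ?thesis by (intro equalityI subsetI) (blast, smt (verit) mem_Collect_eq rangeE rangeI)
  qed
  finally show ?thesis .
qed

text \<open>Identifies the vertices inside a block with the points of a projective line over B, so
  that \<open>Amb.regular_spread_lines\<close> applies to them.\<close>

lemma spread_line_\<theta>: "Amb.spread_line (\<theta> u w) a b = range (\<eta> (rmul u a + rmul w b))"
  unfolding Amb.spread_line_def by (simp add: \<theta>_def \<eta>_def rmul_add)

lemma dim_vertex: "m \<noteq> 0 \<Longrightarrow> has_dimension s\<^sub>A d (range (\<eta> m))"
proof -
  assume m: "m \<noteq> 0"
  interpret n: Vector_Spaces.linear scl s\<^sub>A "\<eta> m" by (rule linear_\<eta>)
  have "inj (\<eta> m)" unfolding n.inj_iff_eq_0 using m by (simp add: \<eta>_def)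
  then show ?thesis using Amb.VP1.has_dimension_image[OF linear_\<eta> _ dim_B] by blast
qed

lemma n_space_vertex: "V \<in> vertices \<Longrightarrow> n_space s\<^sub>A (d - 1) V"
  using dim_vertex d_pos unfolding vertices_def n_space_def by auto

lemma vertices_frame:
  assumes "u \<noteq> 0" "w \<noteq> 0" "range (\<eta> u) \<noteq> range (\<eta> w)"
  obtains p t t' where "frame p u w t t'"
proof -
  obtain p where p: "p \<noteq> 0" "hprod u p = 0" "hprod w p = 0" using line_through[OF assms(1)] by blast
  have "\<nexists>r. w = rmul u r" using assms range_\<eta>_eq_iff by blast
  then show thesis
    using frame_of_points[OF p(1), of u w] p assms(1) hprod_eq_0_commute that by metis
qed

lemma range_\<eta>_subset_block: "range (\<eta> m) \<subseteq> block p \<longleftrightarrow> hprod p m = 0"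
proof
  assume "range (\<eta> m) \<subseteq> block p"
  moreover have "emb 0 m \<in> range (\<eta> m)" unfolding mem_range_\<eta> by (metis rmul_one)
  ultimately have "emb 0 m \<in> block p" by blast
  then show "hprod p m = 0" by (simp add: mem_block)
next
  assume "hprod p m = 0"
  then show "range (\<eta> m) \<subseteq> block p" by (intro image_subsetI) (simp add: \<eta>_def mem_block hprod_rmul_right)
qed

lemma block_subset_block:
  assumes "p \<noteq> 0" "p' \<noteq> 0" "block p \<subseteq> block p'"
  obtains r where "p' = rmul p r"
proof -
  have "hprod p' \<tau> = 0" if "hprod p \<tau> = 0" for \<tau>
  proof -
    have "emb 0 \<tau> \<in> block p" using that by (simp add: mem_block)
    then have "emb 0 \<tau> \<in> block p'" using assms(3) by blast
    then show ?thesis by (simp add: mem_block)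
  qed
  then have "hprod \<tau> p' = 0" if "hprod p \<tau> = 0" for \<tau> using that hprod_eq_0_commute by blast
  then show thesis using perp_perp[OF assms(1)] that by blast
qed

lemma block_rmul: "r \<noteq> 0 \<Longrightarrow> block (rmul p r) = block p"
  by (simp add: block_def hprod_rmul)

lemma block_eq_iff:
  assumes "p \<noteq> 0" "p' \<noteq> 0" shows "block p = block p' \<longleftrightarrow> (\<exists>r. p' = rmul p r)"
proof
  assume "block p = block p'"
  then show "\<exists>r. p' = rmul p r" using block_subset_block[OF assms] by blast
next
  assume "\<exists>r. p' = rmul p r"
  then show "block p = block p'" using block_rmul assms by fastforce
qed

definition blocks where "blocks = {block p | p. p \<noteq> 0}"

lemma n_space_block:
  assumes "p \<noteq> 0" shows "n_space s\<^sub>A (2 * (d - 1) + 1) (block p)"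
proof -
  obtain u w t t' where f: "frame p u w t t'" using frame_exists assms by blast
  show ?thesis using Amb.n_space_range[OF linear_\<theta> inj_\<theta>[OF f]] range_\<theta>[OF f] by simp
qed

lemma frame_not_proportional:
  assumes f: "frame m u w t t'" shows "u \<noteq> 0" "w \<noteq> 0" "\<nexists>r. w = rmul u r"
proof -
  show "u \<noteq> 0" "w \<noteq> 0" using frameD(2,5)[OF f] by auto
  show "\<nexists>r. w = rmul u r"
  proof
    assume "\<exists>r. w = rmul u r"
    then obtain r where "w = rmul u r" by blast
    then have "rmul u 0 + rmul w 1 = rmul u r + rmul w 0" by simp
    then show False using frame_unique[OF f] by fastforce
  qed
qed

lemma blocks_eq:
  "{b. n_space s\<^sub>A (2 * (d - 1) + 1) b \<and> (\<exists>V\<^sub>1\<in>vertices. \<exists>V\<^sub>2\<in>vertices. V\<^sub>1 \<noteq> V\<^sub>2 \<and> b = Amb.V.span (V\<^sub>1 \<union> V\<^sub>2))} = blocks"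
proof (intro equalityI subsetI)
  fix b assume "b \<in> {b. n_space s\<^sub>A (2 * (d - 1) + 1) b \<and> (\<exists>V\<^sub>1\<in>vertices. \<exists>V\<^sub>2\<in>vertices. V\<^sub>1 \<noteq> V\<^sub>2 \<and> b = Amb.V.span (V\<^sub>1 \<union> V\<^sub>2))}"
  then obtain u w where uw: "u \<noteq> 0" "w \<noteq> 0" "range (\<eta> u) \<noteq> range (\<eta> w)" "b = Amb.V.span (range (\<eta> u) \<union> range (\<eta> w))"
    unfolding vertices_def by blast
  obtain p t t' where f: "frame p u w t t'" using vertices_frame[OF uw(1-3)] by blast
  have "b = block p" unfolding uw(4) span_two_vertices range_\<theta>[OF f] ..
  then show "b \<in> blocks" unfolding blocks_def using frameD(1)[OF f] by blast
next
  fix b assume "b \<in> blocks"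
  then obtain p where p: "p \<noteq> 0" "b = block p" unfolding blocks_def by blast
  obtain u w t t' where f: "frame p u w t t'" using frame_exists p by blast
  have "range (\<eta> u) \<noteq> range (\<eta> w)" using range_\<eta>_eq_iff frame_not_proportional[OF f] by blast
  moreover have "b = Amb.V.span (range (\<eta> u) \<union> range (\<eta> w))" unfolding p(2) span_two_vertices range_\<theta>[OF f] ..
  moreover have "range (\<eta> u) \<in> vertices" "range (\<eta> w) \<in> vertices"
    unfolding vertices_def using frame_not_proportional[OF f] by blast+
  ultimately have "\<exists>V\<^sub>1\<in>vertices. \<exists>V\<^sub>2\<in>vertices. V\<^sub>1 \<noteq> V\<^sub>2 \<and> b = Amb.V.span (V\<^sub>1 \<union> V\<^sub>2)"
    by (intro bexI[of _ "range (\<eta> u)"] bexI[of _ "range (\<eta> w)"] conjI)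
  then show "b \<in> {b. n_space s\<^sub>A (2 * (d - 1) + 1) b \<and> (\<exists>V\<^sub>1\<in>vertices. \<exists>V\<^sub>2\<in>vertices. V\<^sub>1 \<noteq> V\<^sub>2 \<and> b = Amb.V.span (V\<^sub>1 \<union> V\<^sub>2))}"
    using n_space_block[OF p(1)] unfolding p(2) by simp
qed

section \<open>The complementary subspaces and the regular spread\<close>

definition Y\<^sub>A where "Y\<^sub>A = range (emb 0)"
definition F\<^sub>A where "F\<^sub>A = range (\<lambda>M. emb M 0)"

lemma dim_Y: "has_dimension s\<^sub>A (3 * d) Y\<^sub>A"
proof -
  interpret P: vector_space_pair scl3 s\<^sub>A by unfold_locales
  have "inj (emb 0)" by (rule injI) simp
  then show ?thesis unfolding Y\<^sub>A_def using P.has_dimension_image[OF linear_emb_right _ dim_B3] by blast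
qed

lemma complement_Y_F: "complement_in s\<^sub>A UNIV Y\<^sub>A F\<^sub>A"
  unfolding complement_in_def
proof (intro conjI)
  show "Amb.V.subspace Y\<^sub>A" using dim_Y Amb.V.has_dimension_subspace by blast
  interpret L: Vector_Spaces.linear s\<^sub>0 s\<^sub>A "\<lambda>M. emb M 0" by (rule linear_emb_left)
  show "Amb.V.subspace F\<^sub>A" unfolding F\<^sub>A_def by (rule L.subspace_image[OF M.subspace_UNIV])
  show "Y\<^sub>A \<inter> F\<^sub>A = {0}"
    using emb_zero unfolding Y\<^sub>A_def F\<^sub>A_def by auto
  have "v \<in> Amb.V.span (Y\<^sub>A \<union> F\<^sub>A)" for v
  proof -
    obtain M \<tau> where "v = emb M \<tau>" by (rule emb_surj)
    then have "v = emb 0 \<tau> + emb M 0" by (simp add: emb_add)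
    then show ?thesis by (simp add: Y\<^sub>A_def F\<^sub>A_def Amb.V.span_add Amb.V.span_base)
  qed
  then show "Amb.V.span (Y\<^sub>A \<union> F\<^sub>A) = UNIV" by blast
qed

lemma vertices_subset_Y: "V \<in> vertices \<Longrightarrow> V \<subseteq> Y\<^sub>A"
  by (auto simp: vertices_def Y\<^sub>A_def \<eta>_def)

lemma zero_in_vertex: "0 \<in> range (\<eta> m)"
  using mem_range_\<eta>[of 0 0 m] emb_zero by (metis rmul_zero(1))

lemma is_spread_vertices: "is_spread s\<^sub>A (d - 1) Y\<^sub>A vertices"
  unfolding is_spread_def
proof (intro conjI ballI)
  fix V assume "V \<in> vertices"
  then show "n_space s\<^sub>A (d - 1) V" "V \<subseteq> Y\<^sub>A" using n_space_vertex vertices_subset_Y by blast+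
next
  fix p assume "p \<in> points s\<^sub>A Y\<^sub>A"
  then obtain m where m: "p = Amb.V.span {emb 0 m}" "m \<noteq> 0"
    unfolding points_def Y\<^sub>A_def by force
  have iff: "p \<subseteq> range (\<eta> m') \<longleftrightarrow> range (\<eta> m') = range (\<eta> m)" if "m' \<noteq> 0" for m'
    unfolding m(1) Amb.V.span_singleton_subset_iff[OF Amb.V.has_dimension_subspace[OF dim_vertex[OF that]]]
      mem_range_\<eta> range_\<eta>_eq_iff[OF m(2)] by simp
  show "\<exists>!V. V \<in> vertices \<and> p \<subseteq> V"
  proof (rule ex1I[of _ "range (\<eta> m)"])
    show "range (\<eta> m) \<in> vertices \<and> p \<subseteq> range (\<eta> m)" unfolding vertices_def using iff m(2) by blast
    show "V = range (\<eta> m)" if "V \<in> vertices \<and> p \<subseteq> V" for V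
      using that iff unfolding vertices_def by blast
  qed
qed

lemma regular_spread_vertices: "regular_spread_plane s\<^sub>A (d - 1) Y\<^sub>A vertices"
  unfolding regular_spread_plane_def
proof (intro conjI ballI impI)
  have "3 * (d - 1) + 2 + 1 = 3 * d" using d_pos by simp
  then show "n_space s\<^sub>A (3 * (d - 1) + 2) Y\<^sub>A" using dim_Y unfolding n_space_def by metis
  show "is_spread s\<^sub>A (d - 1) Y\<^sub>A vertices" by (rule is_spread_vertices)
  fix V1 V2 assume "V1 \<in> vertices" "V2 \<in> vertices" "V1 \<noteq> V2"
  then obtain u w where uw: "V1 = range (\<eta> u)" "V2 = range (\<eta> w)" "u \<noteq> 0" "w \<noteq> 0" "range (\<eta> u) \<noteq> range (\<eta> w)"
    unfolding vertices_def by blast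
  obtain p t t' where f: "frame p u w t t'" using vertices_frame[OF uw(3-5)] by blast
  define Z where "Z = Amb.V.span (V1 \<union> V2)"
  have Z: "Z = range (\<theta> u w)" unfolding Z_def uw(1,2) span_two_vertices ..
  have inj: "inj (\<theta> u w)" using inj_\<theta>[OF f] .
  have meet: "meets V Z \<Longrightarrow> V \<in> {Amb.spread_line (\<theta> u w) a b | a b. a \<noteq> 0 \<or> b \<noteq> 0}" if V: "V \<in> vertices" for V
  proof -
    assume mt: "meets V Z"
    obtain m where m: "V = range (\<eta> m)" "m \<noteq> 0" using V unfolding vertices_def by blast
    have "0 \<in> V \<inter> Z" using zero_in_vertex m Z_def Amb.V.span_zero by blast
    then obtain v where v: "v \<in> V" "v \<in> Z" "v \<noteq> 0" using mt unfolding meets_def by blast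
    then obtain r where r: "v = emb 0 (rmul m r)" using m by (auto simp: \<eta>_def)
    obtain z where "v = \<theta> u w z" using v Z by blast
    then have e: "rmul m r = rmul u (fst z) + rmul w (snd z)" using r by (simp add: \<theta>_def)
    \<comment> \<open>As \<open>r\<close> is invertible, a single common nonzero vector makes
      \<open>m\<close>, up to a right factor, a combination of \<open>u\<close> and
      \<open>w\<close>; the whole vertex then lies in \<open>Z\<close>.\<close>
    have "r \<noteq> 0" using v r emb_zero by auto
    then have "V = Amb.spread_line (\<theta> u w) (fst z) (snd z)"
      unfolding spread_line_\<theta> e[symmetric] using m range_\<eta>_rmul by simp
    moreover have "fst z \<noteq> 0 \<or> snd z \<noteq> 0" using e \<open>r \<noteq> 0\<close> m(2) by auto
    ultimately show ?thesis by blast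
  qed
  have sub: "V \<in> vertices \<and> meets V Z" if V: "V = Amb.spread_line (\<theta> u w) a b" "a \<noteq> 0 \<or> b \<noteq> 0" for V a b
  proof -
    define m where "m = rmul u a + rmul w b"
    have V': "V = range (\<eta> m)" unfolding V(1) spread_line_\<theta> m_def ..
    have m0: "m \<noteq> 0" using frame_unique[OF f, of a b 0 0] V(2) by (auto simp: m_def)
    have "emb 0 m \<in> V \<inter> Z"
      unfolding V' Z mem_range_\<eta> using mem_range_\<eta>[of 0 m m]
      by (auto simp: \<theta>_def m_def image_iff intro: exI[of _ a] exI[of _ b] exI[of _ 1])
    moreover have "emb 0 m \<noteq> 0" using m0 by simp
    ultimately have "meets V Z" unfolding meets_def by blast
    then show ?thesis using V' m0 unfolding vertices_def by blast
  qed
  have M: "{V \<in> vertices. meets V Z} = {Amb.spread_line (\<theta> u w) a b | a b. a \<noteq> 0 \<or> b \<noteq> 0}"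
  proof (intro equalityI subsetI)
    fix V assume "V \<in> {V \<in> vertices. meets V Z}"
    then show "V \<in> {Amb.spread_line (\<theta> u w) a b | a b. a \<noteq> 0 \<or> b \<noteq> 0}" using meet by simp
  next
    fix V assume "V \<in> {Amb.spread_line (\<theta> u w) a b | a b. a \<noteq> 0 \<or> b \<noteq> 0}"
    then obtain a b where "V = Amb.spread_line (\<theta> u w) a b" "a \<noteq> 0 \<or> b \<noteq> 0" by blast
    then show "V \<in> {V \<in> vertices. meets V Z}" using sub by simp
  qed
  have "regular_spread_line s\<^sub>A (d - 1) Z {V \<in> vertices. meets V Z}"
    unfolding M unfolding Z by (rule Amb.regular_spread_lines[OF linear_\<theta> inj])
  moreover have "\<forall>V\<in>{V \<in> vertices. meets V Z}. V \<subseteq> Z"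
    unfolding M unfolding Z using Amb.spread_line_subset[OF linear_\<theta> inj] by blast
  ultimately show "let Z = Amb.V.span (V1 \<union> V2); M = {V \<in> vertices. meets V Z}
         in (\<forall>V\<in>M. V \<subseteq> Z) \<and> regular_spread_line s\<^sub>A (d - 1) Z M"
    unfolding Let_def Z_def by blast
qed

section \<open>The projective plane of the vertices\<close>

lemma projective_plane_vertices: "projective_plane vertices blocks"
  unfolding projective_plane_def
proof (intro conjI ballI impI)
  fix V1 V2 assume "V1 \<in> vertices" "V2 \<in> vertices" "V1 \<noteq> V2"
  then obtain u w where uw: "V1 = range (\<eta> u)" "V2 = range (\<eta> w)" "u \<noteq> 0" "w \<noteq> 0" "range (\<eta> u) \<noteq> range (\<eta> w)"
    unfolding vertices_def by blast
  obtain p t t' where f: "frame p u w t t'" using vertices_frame[OF uw(3-5)] by blast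
  show "\<exists>!l. l \<in> blocks \<and> V1 \<subseteq> l \<and> V2 \<subseteq> l"
  proof (rule ex1I[of _ "block p"])
    show "block p \<in> blocks \<and> V1 \<subseteq> block p \<and> V2 \<subseteq> block p"
      unfolding uw range_\<eta>_subset_block blocks_def using frameD[OF f] by blast
    fix l assume "l \<in> blocks \<and> V1 \<subseteq> l \<and> V2 \<subseteq> l"
    then obtain p' where p': "l = block p'" "p' \<noteq> 0" "hprod p' u = 0" "hprod p' w = 0"
      unfolding uw blocks_def using range_\<eta>_subset_block by blast
    have "block p \<subseteq> block p'"
      unfolding range_\<theta>[OF f, symmetric] using p'(3,4)
      by (intro image_subsetI) (simp add: \<theta>_def mem_block hprod_add_right hprod_rmul_right)
    then obtain r where "p' = rmul p r" using block_subset_block[OF frameD(1)[OF f] p'(2)] by blast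
    then show "l = block p" using block_eq_iff[OF frameD(1)[OF f] p'(2)] p'(1) by metis
  qed
next
  fix l l' assume "l \<in> blocks" "l' \<in> blocks" "l \<noteq> l'"
  then obtain p p' where p: "l = block p" "l' = block p'" "p \<noteq> 0" "p' \<noteq> 0" "block p \<noteq> block p'"
    unfolding blocks_def by blast
  obtain m where m: "m \<noteq> 0" "hprod p m = 0" "hprod p' m = 0" using line_through[OF p(3)] by blast
  have "\<nexists>r. p' = rmul p r" using p block_eq_iff by blast
  \<comment> \<open>The frame is used dually: \<open>p\<close> and \<open>p'\<close> are a basis of
    the solutions for \<open>m\<close>, and \<open>frame_kernel\<close> says that a vertex in both
    blocks is the one of \<open>m\<close>.\<close>
  then obtain t t' where f: "frame m p p' t t'"
    using frame_of_points[OF m(1), of p p'] m p hprod_eq_0_commute by metis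
  show "\<exists>!V. V \<in> vertices \<and> V \<subseteq> l \<and> V \<subseteq> l'"
  proof (rule ex1I[of _ "range (\<eta> m)"])
    show "range (\<eta> m) \<in> vertices \<and> range (\<eta> m) \<subseteq> l \<and> range (\<eta> m) \<subseteq> l'"
      unfolding p range_\<eta>_subset_block vertices_def using m by blast
    fix V assume "V \<in> vertices \<and> V \<subseteq> l \<and> V \<subseteq> l'"
    then obtain m' where m': "V = range (\<eta> m')" "m' \<noteq> 0" "hprod p m' = 0" "hprod p' m' = 0"
      unfolding p vertices_def using range_\<eta>_subset_block by blast
    then obtain r where "m' = rmul m r" using frame_kernel[OF f] by blast
    then show "V = range (\<eta> m)" using range_\<eta>_eq_iff[OF m'(2)] m'(1) by metis
  qed
next
  define e1 e2 e3 e4 :: "'b \<times> 'b \<times> 'b" where e: "e1 = (1, 0, 0)" "e2 = (0, 1, 0)" "e3 = (0, 0, 1)" "e4 = (1, 1, 1)"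
  have nz: "e1 \<noteq> 0" "e2 \<noteq> 0" "e3 \<noteq> 0" "e4 \<noteq> 0" by (simp_all add: e zero_prod_def)
  define M where "M = {range (\<eta> e1), range (\<eta> e2), range (\<eta> e3), range (\<eta> e4)}"
  have ne: "range (\<eta> e1) \<noteq> range (\<eta> e2)" "range (\<eta> e1) \<noteq> range (\<eta> e3)" "range (\<eta> e1) \<noteq> range (\<eta> e4)"
    "range (\<eta> e2) \<noteq> range (\<eta> e3)" "range (\<eta> e2) \<noteq> range (\<eta> e4)" "range (\<eta> e3) \<noteq> range (\<eta> e4)"
    by (simp_all add: range_\<eta>_eq_iff nz) (simp_all add: e)
  have card: "card M = 4" unfolding M_def using ne by simp
  show "\<exists>M\<subseteq>vertices. card M = 4 \<and> (\<forall>l\<in>blocks. \<forall>N\<subseteq>M. card N = 3 \<longrightarrow> \<not> (\<forall>p\<in>N. p \<subseteq> l))"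
  proof (intro exI[of _ M] conjI ballI allI impI card notI)
    show "M \<subseteq> vertices" unfolding M_def vertices_def using nz by blast
    fix l Q assume l: "l \<in> blocks" and Q: "Q \<subseteq> M" "card Q = 3" "\<forall>p\<in>Q. p \<subseteq> l"
    obtain p where p: "l = block p" "p \<noteq> 0" using l unfolding blocks_def by blast
    \<comment> \<open>Three of four points omit only one, so any two of the four include a member of
      the triple.\<close>
    have two: "V \<in> Q \<or> W \<in> Q" if "V \<in> M" "W \<in> M" "V \<noteq> W" for V W
    proof (rule ccontr)
      assume "\<not> (V \<in> Q \<or> W \<in> Q)"
      then have "Q \<subseteq> M - {V, W}" using Q(1) by blast
      moreover have "finite M" unfolding M_def by simp
      ultimately have "card Q \<le> card (M - {V, W})" by (simp add: card_mono)
      also have "\<dots> = 2" using that card \<open>finite M\<close> by (simp add: card_Diff_subset)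
      finally show False using Q(2) by simp
    qed
    have 12: "hprod p m = 0 \<or> hprod p m' = 0" if "range (\<eta> m) \<in> M" "range (\<eta> m') \<in> M" "range (\<eta> m) \<noteq> range (\<eta> m')" for m m'
    proof -
      have "hprod p m = 0" if "range (\<eta> m) \<in> Q" for m
        using Q(3)[rule_format, OF that] unfolding p(1) range_\<eta>_subset_block .
      then show ?thesis using two[OF that] by blast
    qed
    obtain x y z where xyz: "p = (x, y, z)" by (cases p)
    \<comment> \<open>At most one of the conjugated coordinates and their sum is nonzero. A single
      nonzero coordinate would make the sum nonzero too, so all coordinates vanish.\<close>
    have "x = 0 \<or> y = 0" "x = 0 \<or> z = 0" "y = 0 \<or> z = 0"
      "x = 0 \<or> cnj x + cnj y + cnj z = 0" "y = 0 \<or> cnj x + cnj y + cnj z = 0" "z = 0 \<or> cnj x + cnj y + cnj z = 0"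
      using 12[of e1 e2] 12[of e1 e3] 12[of e2 e3] 12[of e1 e4] 12[of e2 e4] 12[of e3 e4] ne
      by (simp_all add: M_def e xyz)
    then have "x = 0 \<and> y = 0 \<and> z = 0" by auto
    then show False using p(2) xyz by (simp add: zero_prod_def)
  qed
qed

lemma vimage_emb_vertex: "emb 0 -` range (\<eta> m) = range (rmul m)"
  by (auto simp: \<eta>_def)

lemma vimage_emb_block: "emb 0 -` block p = {\<tau>. hprod p \<tau> = 0}"
  by (auto simp: block_def)

lemma pg2_points_eq: "(pg2_points :: ('b \<times> 'b \<times> 'b) set set) = {range (rmul m) | m. m \<noteq> 0}"
proof -
  have "(pg2_points :: ('b \<times> 'b \<times> 'b) set set) = {range (rmul (x, y, z)) | x y z. (x, y, z) \<noteq> 0}"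
    unfolding pg2_points_def by simp
  also have "\<dots> = {range (rmul m) | m. m \<noteq> 0}" by (rule Collect_cong) (metis surj_pair)
  finally show ?thesis .
qed

text \<open>The preimage under \<open>emb 0\<close> turns vertices and blocks into the right
  subspaces of the space of triples themselves, so the isomorphism is just this change of
  carrier.\<close>

lemma isomorphic_pg2: "isomorphic_geometries vertices blocks (pg2_points :: ('b \<times> 'b \<times> 'b) set set) pg2_lines"
proof -
  have sub: "V = emb 0 ` (emb 0 -` V)" if "V \<subseteq> Y\<^sub>A" for V
    using that unfolding Y\<^sub>A_def by blast
  have bY: "b \<subseteq> Y\<^sub>A" if "b \<in> blocks" for b using that by (auto simp: blocks_def block_def Y\<^sub>A_def)
  have inj1: "inj_on (\<lambda>V. emb 0 -` V) vertices"
    using sub vertices_subset_Y by (metis (no_types, lifting) inj_onI)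
  have inj2: "inj_on (\<lambda>V. emb 0 -` V) blocks"
    using sub bY by (metis (no_types, lifting) inj_onI)
  have im1: "(\<lambda>V. emb 0 -` V) ` vertices = pg2_points"
  proof -
    have "(\<lambda>V. emb 0 -` V) ` vertices = {emb 0 -` range (\<eta> m) | m. m \<noteq> 0}" unfolding vertices_def by blast
    then show ?thesis unfolding vimage_emb_vertex pg2_points_eq .
  qed
  have sum: "{a + b | a b. a \<in> range (rmul u) \<and> b \<in> range (rmul w)} = {\<tau>. hprod p \<tau> = 0}"
    if "frame p u w t t'" for p u w t t'
  proof -
    have "{a + b | a b. a \<in> range (rmul u) \<and> b \<in> range (rmul w)} = {\<tau>. \<exists>a b. \<tau> = rmul u a + rmul w b}" by blast
    then show ?thesis unfolding frameD(10)[OF that] .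
  qed
  have im2: "(\<lambda>V. emb 0 -` V) ` blocks = (pg2_lines :: ('b \<times> 'b \<times> 'b) set set)"
  proof (intro equalityI subsetI)
    fix l assume "l \<in> (\<lambda>V. emb 0 -` V) ` blocks"
    then obtain p where p: "p \<noteq> 0" "l = {\<tau>. hprod p \<tau> = 0}"
      unfolding blocks_def using vimage_emb_block by blast
    obtain u w t t' where f: "frame p u w t t'" using frame_exists p by blast
    note np = frame_not_proportional[OF f]
    have "range (rmul u) \<noteq> range (rmul w)" using np(3) rmul_one by (metis rangeE rangeI)
    moreover have "range (rmul u) \<in> pg2_points" "range (rmul w) \<in> pg2_points"
      unfolding pg2_points_eq using np by blast+
    ultimately show "l \<in> pg2_lines" unfolding pg2_lines_def p(2) sum[OF f, symmetric] by blast
  next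
    fix l assume "l \<in> (pg2_lines :: ('b \<times> 'b \<times> 'b) set set)"
    then obtain u w where uw: "u \<noteq> 0" "w \<noteq> 0" "range (rmul u) \<noteq> range (rmul w)"
      "l = {a + b | a b. a \<in> range (rmul u) \<and> b \<in> range (rmul w)}"
      unfolding pg2_lines_def pg2_points_eq by blast
    have "range (\<eta> u) \<noteq> range (\<eta> w)" using uw(3) vimage_emb_vertex by metis
    then obtain p t t' where f: "frame p u w t t'" using vertices_frame uw by blast
    have "l = emb 0 -` block p" unfolding uw(4) vimage_emb_block by (rule sum[OF f])
    then show "l \<in> (\<lambda>V. emb 0 -` V) ` blocks" unfolding blocks_def using frameD(1)[OF f] by blast
  qed
  have "V \<subseteq> b \<longleftrightarrow> emb 0 -` V \<subseteq> emb 0 -` b" if "V \<in> vertices" for V b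
    using vertices_subset_Y[OF that] unfolding Y\<^sub>A_def by blast
  then show ?thesis
    unfolding isomorphic_geometries_def bij_betw_def using inj1 inj2 im1 im2 by blast
qed

section \<open>The span of X\<close>

lemma span_X: "Amb.V.span (\<Union> X\<^sub>A) = UNIV"
proof -
  let ?S = "Amb.V.span (\<Union> X\<^sub>A)"
  have pt: "emb (rho p) \<tau> \<in> ?S" if "p \<noteq> 0" "hprod p \<tau> = 0" for p \<tau>
  proof (rule Amb.V.span_base, rule UnionI)
    show "Amb.V.span {emb (rho p) \<tau>} \<in> X\<^sub>A" unfolding veronese_points using that by blast
    show "emb (rho p) \<tau> \<in> Amb.V.span {emb (rho p) \<tau>}" by (simp add: Amb.V.span_base)
  qed
  \<comment> \<open>Two points over the same \<open>p\<close> differ by a pure t-part; the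
    orthogonal spaces of two different \<open>p\<close> together fill Y.\<close>
  have t: "emb 0 \<tau> \<in> ?S" if "p \<noteq> 0" "hprod p \<tau> = 0" for p \<tau>
    using Amb.V.span_diff[OF pt[OF that] pt[of p 0]] that by (simp add: emb_diff)
  have Y: "emb 0 \<tau> \<in> ?S" for \<tau>
  proof -
    obtain a b c where abc: "\<tau> = (a, b, c)" by (cases \<tau>)
    have "emb 0 (a, 0, c) \<in> ?S" by (rule t[of "(0, 1, 0)"]) (simp_all add: zero_prod_def)
    moreover have "emb 0 (0, b, 0) \<in> ?S" by (rule t[of "(1, 0, 0)"]) (simp_all add: zero_prod_def)
    ultimately have "emb 0 (a, 0, c) + emb 0 (0, b, 0) \<in> ?S" by (rule Amb.V.span_add)
    then show ?thesis by (simp add: emb_add abc)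
  qed
  have r: "emb (rho p) 0 \<in> ?S" if "p \<noteq> 0" for p using pt that by simp
  note cl = Amb.V.span_add Amb.V.span_scale Amb.V.span_diff
  have D1: "emb ((k, 0, 0), 0) 0 \<in> ?S" and D2: "emb ((0, k, 0), 0) 0 \<in> ?S" and D3: "emb ((0, 0, k), 0) 0 \<in> ?S" for k
    using Amb.V.span_scale[OF r[of "(1, 0, 0)"], of k] Amb.V.span_scale[OF r[of "(0, 1, 0)"], of k]
      Amb.V.span_scale[OF r[of "(0, 0, 1)"], of k]
    by (simp_all add: emb_scale zero_prod_def)
  \<comment> \<open>\<open>rho (0, a, 1)\<close> is the single off-diagonal entry \<open>a\<close>
    plus diagonal entries, which are in the span already.\<close>
  have E1: "emb (0, (a, 0, 0)) 0 \<in> ?S" for a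
    using cl(3)[OF cl(3)[OF r[of "(0, a, 1)"] D2[of "N a"]] D3[of 1]] by (simp add: emb_diff zero_prod_def)
  have E2: "emb (0, (0, a, 0)) 0 \<in> ?S" for a
    using cl(3)[OF cl(3)[OF r[of "(1, 0, a)"] D3[of "N a"]] D1[of 1]] by (simp add: emb_diff zero_prod_def)
  have E3: "emb (0, (0, 0, a)) 0 \<in> ?S" for a
    using cl(3)[OF cl(3)[OF r[of "(a, 1, 0)"] D1[of "N a"]] D2[of 1]] by (simp add: emb_diff zero_prod_def)
  have "v \<in> ?S" for v
  proof -
    obtain M \<tau> where v: "v = emb M \<tau>" by (rule emb_surj)
    obtain k1 k2 k3 a b c where M: "M = ((k1, k2, k3), (a, b, c))" by (metis surj_pair)
    have "v = emb 0 \<tau> + (emb ((k1, 0, 0), 0) 0 + emb ((0, k2, 0), 0) 0 + emb ((0, 0, k3), 0) 0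
       + emb (0, (a, 0, 0)) 0 + emb (0, (0, b, 0)) 0 + emb (0, (0, 0, c)) 0)"
      unfolding v M by (simp add: emb_add)
    then show ?thesis using Y D1 D2 D3 E1 E2 E3 by (simp add: cl(1))
  qed
  then show ?thesis by blast
qed

lemma n_space_ambient: "n_space s\<^sub>A (6 * d + 2) UNIV"
proof -
  have "6 * d + 2 + 1 = 6 * d + 3" by simp
  then show ?thesis unfolding n_space_def using dim_sA by metis
qed

section \<open>The induced Veronese representation\<close>

definition point_F where "point_F p = Amb.V.span {emb (rho p) 0}"
definition line_F where "line_F m = (\<lambda>M. emb M 0) ` line_space m"

lemma subspace_F: "Amb.V.subspace F\<^sub>A"
  using complement_Y_F by (simp add: complement_in_def)

lemma mem_F: "emb M \<tau> \<in> F\<^sub>A \<longleftrightarrow> \<tau> = 0"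
  unfolding F\<^sub>A_def image_iff emb_inject by blast

lemma induced_points_eq: "induced_points s\<^sub>A X\<^sub>A F\<^sub>A = {point_F p | p. p \<noteq> 0}"
proof -
  have iff: "Amb.V.span {emb (rho p) \<tau>} \<in> points s\<^sub>A F\<^sub>A \<longleftrightarrow> \<tau> = 0" if "p \<noteq> 0" for p \<tau>
    unfolding Amb.V.span_singleton_in_points_iff[OF subspace_F] mem_F using rho_nonzero[OF that] by simp
  have "\<pi> \<in> X\<^sub>A \<inter> points s\<^sub>A F\<^sub>A \<longleftrightarrow> (\<exists>p. \<pi> = point_F p \<and> p \<noteq> 0)" for \<pi>
  proof
    assume p: "\<pi> \<in> X\<^sub>A \<inter> points s\<^sub>A F\<^sub>A"
    then obtain p \<tau> where "\<pi> = Amb.V.span {emb (rho p) \<tau>}" "p \<noteq> 0" unfolding veronese_points by blast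
    moreover from this have "\<tau> = 0" using iff p by blast
    ultimately show "\<exists>p. \<pi> = point_F p \<and> p \<noteq> 0" unfolding point_F_def by blast
  next
    assume "\<exists>p. \<pi> = point_F p \<and> p \<noteq> 0"
    then obtain p where p: "\<pi> = Amb.V.span {emb (rho p) 0}" "p \<noteq> 0" unfolding point_F_def by blast
    then have "\<pi> \<in> X\<^sub>A" unfolding veronese_points using hprod_zero(2) by blast
    then show "\<pi> \<in> X\<^sub>A \<inter> points s\<^sub>A F\<^sub>A" using iff p by simp
  qed
  then show ?thesis unfolding induced_points_def by blast
qed

lemma point_F_eq_iff:
  assumes "p \<noteq> 0" "p' \<noteq> 0" shows "point_F p = point_F p' \<longleftrightarrow> (\<exists>r. p' = rmul p r)"
proof
  have n: "emb (rho p) 0 \<noteq> 0" using rho_nonzero[OF assms(1)] by simp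
  {
    assume "point_F p = point_F p'"
    then obtain c where "emb (rho p') 0 = s\<^sub>A c (emb (rho p) 0)"
      unfolding point_F_def using Amb.V.span_singleton_eq_iff[OF n] by blast
    then have "rho p' = s\<^sub>0 c (rho p)" by (simp add: emb_scale)
    then show "\<exists>r. p' = rmul p r" using rho_proportional[OF assms] by blast
  }
  assume "\<exists>r. p' = rmul p r"
  then obtain r where r: "p' = rmul p r" by blast
  then have "N r \<noteq> 0" using assms by auto
  moreover have "emb (rho p') 0 = s\<^sub>A (N r) (emb (rho p) 0)" by (simp add: r rho_rmul emb_scale)
  ultimately show "point_F p = point_F p'"
    unfolding point_F_def using Amb.V.span_singleton_eq_iff[OF n] by blast
qed

lemma offset_00 [simp]: "offset t t' 0 0 k = 0"
  by (cases k) (simp add: offset_Pair)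

lemma line_A_Int_F:
  assumes f: "frame m u w t t'"
  shows "line_A m u w t t' 0 0 \<inter> F\<^sub>A = line_F m"
proof -
  have "emb M 0 \<in> line_A m u w t t' 0 0 \<longleftrightarrow> M \<in> range (line_map u w)" for M
    unfolding line_A_def \<psi>\<eta> by auto
  then show ?thesis unfolding line_F_def line_space_eq[OF f] F\<^sub>A_def by blast
qed

lemma point_F_subset_iff:
  assumes "Amb.V.subspace U" shows "point_F p \<subseteq> U \<longleftrightarrow> emb (rho p) 0 \<in> U"
  unfolding point_F_def using Amb.V.span_singleton_subset_iff[OF assms] .

lemma subspace_line_A: "Amb.V.subspace (line_A m u w t t' e f)"
  unfolding line_A_def using span_line_points[of m u w t t' e f] Amb.V.subspace_span by metis

text \<open>Decides which members of \<Xi> induce lines on F. A point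
  \<open>u \<alpha> + w \<beta>\<close> of F on the member gives, for
  \<open>\<beta> \<noteq> 0\<close>, the relation
  \<open>f' = - \<alpha> \<beta>\<inverse> e\<close>, and for \<open>\<beta> = 0\<close> it gives
  \<open>e = 0\<close>. Different points have different ratios, so two of them leave only
  zero.\<close>

lemma offset_vanishes:
  assumes f: "frame m u w t t'"
    and p: "p \<noteq> 0" "emb (rho p) 0 \<in> line_A m u w t t' e f'"
    and q: "q \<noteq> 0" "emb (rho q) 0 \<in> line_A m u w t t' e f'"
    and pq: "\<nexists>r. q = rmul p r"
  shows "e = 0 \<and> f' = 0"
proof -
  have ex: "\<exists>\<alpha> \<beta>. p = rmul u \<alpha> + rmul w \<beta> \<and> \<alpha> * cnj \<beta> * e + scl (N \<beta>) f' = 0 \<and> scl (N \<alpha>) e + \<beta> * cnj \<alpha> * f' = 0"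
    if p: "p \<noteq> 0" "emb (rho p) 0 \<in> line_A m u w t t' e f'" for p
  proof -
    obtain k r where k: "line_map u w k = s\<^sub>0 1 (rho p)" "offset t t' e f' k + rmul m r = 0"
      using p(2) unfolding line_A_def \<psi>\<eta> by auto
    obtain \<alpha> \<beta> where ab: "p = rmul u \<alpha> + rmul w \<beta>" "k = sclQ 1 (N \<alpha>, N \<beta>, \<alpha> * cnj \<beta>)"
      using line_map_eq_rho[OF f p(1) one_neq_zero k(1)] by blast
    \<comment> \<open>Pairing with \<open>u\<close> and \<open>w\<close> removes the unknown vertex
      part \<open>rmul m r\<close>.\<close>
    have "hprod u (offset t t' e f' k + rmul m r) = 0" "hprod w (offset t t' e f' k + rmul m r) = 0"
      using k(2) by simp_all
    then have "\<alpha> * cnj \<beta> * e + scl (N \<beta>) f' = 0" "- (scl (N \<alpha>) e + \<beta> * cnj \<alpha> * f') = 0"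
      unfolding ab(2)
      by (simp_all add: offset_Pair hprod_add_right hprod_diff_right hprod_rmul_right frameD[OF f] cnj_simps)
    then show ?thesis using ab(1) neg_equal_0_iff_equal by blast
  qed
  obtain \<alpha> \<beta> where p': "p = rmul u \<alpha> + rmul w \<beta>" and p1: "\<alpha> * cnj \<beta> * e + scl (N \<beta>) f' = 0"
    and p2: "scl (N \<alpha>) e + \<beta> * cnj \<alpha> * f' = 0" using ex[OF p] by blast
  obtain \<gamma> \<delta> where q': "q = rmul u \<gamma> + rmul w \<delta>" and q1: "\<gamma> * cnj \<delta> * e + scl (N \<delta>) f' = 0"
    and q2: "scl (N \<gamma>) e + \<delta> * cnj \<gamma> * f' = 0" using ex[OF q] by blast
  have f'_eq: "f' = - (\<alpha> * (binv \<beta> * e))" if "\<alpha> * cnj \<beta> * e + scl (N \<beta>) f' = 0" "\<beta> \<noteq> 0" for \<alpha> \<beta>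
  proof -
    have "scl (N \<beta>) f' = - (\<alpha> * cnj \<beta> * e)" using that(1) by (simp add: eq_neg_iff_add_eq_0 add.commute)
    then have "scl (inverse (N \<beta>)) (scl (N \<beta>) f') = scl (inverse (N \<beta>)) (- (\<alpha> * cnj \<beta> * e))" by simp
    then show ?thesis using that(2) by (simp add: binv_def mult.assoc)
  qed
  have np: "\<not> (\<gamma> = \<alpha> * r \<and> \<delta> = \<beta> * r)" for r
    using pq p' q' by (auto simp: rmul_add)
  show ?thesis
  proof (cases "\<beta> = 0")
    case True
    then have "\<alpha> \<noteq> 0" using p p' by auto
    then have e: "e = 0" using p2 True by simp
    have "\<delta> \<noteq> 0"
    proof
      assume "\<delta> = 0"
      then show False using np[of "binv \<alpha> * \<gamma>"] True \<open>\<alpha> \<noteq> 0\<close> by simp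
    qed
    then show ?thesis using q1 e by simp
  next
    case b: False
    then have fe: "f' = - (\<alpha> * (binv \<beta> * e))" using f'_eq p1 by blast
    have "e = 0"
    proof (cases "\<delta> = 0")
      case True
      then have "\<gamma> \<noteq> 0" using q q' by auto
      then show ?thesis using q2 True by simp
    next
      case False
      then have "f' = - (\<gamma> * (binv \<delta> * e))" using f'_eq q1 by blast
      then have "(\<alpha> * binv \<beta> - \<gamma> * binv \<delta>) * e = 0" using fe by (simp add: left_diff_distrib mult.assoc)
      moreover have "\<alpha> * binv \<beta> \<noteq> \<gamma> * binv \<delta>"
      proof
        assume eq: "\<alpha> * binv \<beta> = \<gamma> * binv \<delta>"
        have "\<gamma> = \<gamma> * binv \<delta> * \<delta>" using False by (simp add: mult.assoc)
        then have "\<gamma> = \<alpha> * (binv \<beta> * \<delta>)" unfolding eq[symmetric] by (simp add: mult.assoc)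
        then show False using np[of "binv \<beta> * \<delta>"] b by simp
      qed
      ultimately show ?thesis by simp
    qed
    then show ?thesis using fe by simp
  qed
qed

lemma line_F_rmul: "r \<noteq> 0 \<Longrightarrow> line_F (rmul m r) = line_F m"
  by (simp add: line_F_def line_space_def hprod_rmul)

lemma induced_lines_eq: "induced_lines s\<^sub>A X\<^sub>A \<Xi>\<^sub>A F\<^sub>A = {line_F m | m. m \<noteq> 0}"
proof (intro equalityI subsetI)
  fix l assume "l \<in> induced_lines s\<^sub>A X\<^sub>A \<Xi>\<^sub>A F\<^sub>A"
  then obtain \<xi> p q where x: "l = \<xi> \<inter> F\<^sub>A" "\<xi> \<in> \<Xi>\<^sub>A" "p \<noteq> 0" "q \<noteq> 0" "point_F p \<noteq> point_F q"
    "point_F p \<subseteq> \<xi>" "point_F q \<subseteq> \<xi>"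
    unfolding induced_lines_def induced_points_eq by blast
  obtain m u w t t' e f' where f: "frame m u w t t'" "\<xi> = line_A m u w t t' e f'"
    using lines_A_cases x(2) by blast
  have "\<nexists>r. q = rmul p r" using x point_F_eq_iff by blast
  then have "e = 0 \<and> f' = 0"
    using offset_vanishes[OF f(1)] x unfolding f(2) point_F_subset_iff[OF subspace_line_A] by blast
  then have "l = line_F m" using x(1) f line_A_Int_F by simp
  then show "l \<in> {line_F m | m. m \<noteq> 0}" using frameD(1)[OF f(1)] by blast
next
  fix l assume "l \<in> {line_F m | m. m \<noteq> 0}"
  then obtain m where m: "l = line_F m" "m \<noteq> 0" by blast
  obtain m' u w t t' r where f: "frame m' u w t t'" "m = rmul m' r" "r \<noteq> 0" "line_A m' u w t t' 0 0 \<in> \<Xi>\<^sub>A"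
    using lines_A_exist[OF m(2)] by blast
  have l: "l = line_A m' u w t t' 0 0 \<inter> F\<^sub>A"
    unfolding line_A_Int_F[OF f(1)] m(1) f(2) using line_F_rmul[OF f(3)] .
  note np = frame_not_proportional[OF f(1)]
  have "emb (rho u) 0 \<in> l" "emb (rho w) 0 \<in> l"
    unfolding l line_A_Int_F[OF f(1)] line_F_def using rho_in_line_space_iff frameD[OF f(1)] np by auto
  then have "point_F u \<subseteq> line_A m' u w t t' 0 0" "point_F w \<subseteq> line_A m' u w t t' 0 0"
    unfolding point_F_subset_iff[OF subspace_line_A] l by blast+
  moreover have "point_F u \<noteq> point_F w" using point_F_eq_iff np by blast
  ultimately show "l \<in> induced_lines s\<^sub>A X\<^sub>A \<Xi>\<^sub>A F\<^sub>A"
    unfolding induced_lines_def induced_points_eq using f(4) l np by blast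
qed

lemma base_points: "fst (veronese (base_algebra scl T)) = {M.span {rho p} | p. p \<noteq> 0}"
proof -
  have G: "G2_points (base_algebra scl T) = {(x, y, 1) | x y. True} \<union> {(1, y, 0) | y. True} \<union> {(0, 1, 0)}"
    unfolding G2_points_def by auto
  have sc: "M.span {rho (rmul p r)} = M.span {rho p}" if "r \<noteq> 0" for p r
    using M.span_image_scale[of "{rho p}" "\<lambda>_. N r"] that by (simp add: rho_rmul)
  show ?thesis
    unfolding veronese_def fst_conv
  proof (intro equalityI subsetI)
    fix \<pi> assume "\<pi> \<in> veronese_map (base_algebra scl T) ` G2_points (base_algebra scl T)"
    then obtain p where p: "p \<in> G2_points (base_algebra scl T)" "\<pi> = M.span {rho p}"
      unfolding veronese_map_base by blast
    have "p \<noteq> 0" using p(1) unfolding G by (auto simp: zero_prod_def)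
    then show "\<pi> \<in> {M.span {rho p} | p. p \<noteq> 0}" using p by blast
  next
    fix \<pi> assume "\<pi> \<in> {M.span {rho p} | p. p \<noteq> 0}"
    then obtain p where p: "\<pi> = M.span {rho p}" "p \<noteq> 0" by blast
    from p(2) have "\<exists>q\<in>G2_points (base_algebra scl T). \<pi> = M.span {rho q}"
    proof (cases rule: normal_form_point)
      case (1 x y r)
      then show ?thesis unfolding p(1)
        by (intro bexI[of _ "(x, y, 1)"]) (simp_all add: sc G del: rmul_Pair rho_Pair)
    next
      case (2 y r)
      then show ?thesis unfolding p(1)
        by (intro bexI[of _ "(1, y, 0)"]) (simp_all add: sc G del: rmul_Pair rho_Pair)
    next
      case (3 r)
      then show ?thesis unfolding p(1)
        by (intro bexI[of _ "(0, 1, 0)"]) (simp_all add: sc G del: rmul_Pair rho_Pair)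
    qed
    then show "\<pi> \<in> veronese_map (base_algebra scl T) ` G2_points (base_algebra scl T)"
      unfolding veronese_map_base by blast
  qed
qed

lemma base_line:
  "M.span (\<Union> (veronese_map (base_algebra scl T) ` {p \<in> G2_points (base_algebra scl T). hprod m p = 0})) = line_space m"
proof
  let ?G = "G2_points (base_algebra scl T)"
  have "M.span {rho p} \<subseteq> line_space m" if "hprod m p = 0" for p
    using M.span_singleton_subset_iff[OF subspace_line_space] that by (simp add: line_space_def M.span_base)
  then show "M.span (\<Union> (veronese_map (base_algebra scl T) ` {p \<in> ?G. hprod m p = 0})) \<subseteq> line_space m"
    unfolding veronese_map_base by (intro M.span_minimal subspace_line_space) blast
  have G: "?G = {(x, y, 1) | x y. True} \<union> {(1, y, 0) | y. True} \<union> {(0, 1, 0)}"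
    unfolding G2_points_def by auto
  let ?S = "M.span (\<Union> (veronese_map (base_algebra scl T) ` {p \<in> ?G. hprod m p = 0}))"
  have S: "rho p \<in> ?S" if "p \<in> ?G" "hprod m p = 0" for p
    unfolding veronese_map_base
    by (rule M.span_base, rule UN_I[of p]) (use that M.span_base[of "rho p" "{rho p}"] in simp_all)
  have "rho p \<in> ?S" if p: "hprod m p = 0" for p
  proof (cases "p = 0")
    case True
    have "rho 0 = 0" using rho_rmul[of 0 0] by simp
    then show ?thesis using True M.span_zero by simp
  next
    case False
    then obtain q r where q: "p = rmul q r" "r \<noteq> 0" "q \<in> ?G"
      by (cases rule: normal_form_point) (unfold G, blast+)
    then have "hprod m q = 0" using p by (simp add: hprod_rmul_right)
    then show ?thesis unfolding q(1) rho_rmul using S q(3) M.span_scale by blast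
  qed
  then show "line_space m \<subseteq> ?S"
    unfolding line_space_def by (intro M.span_minimal M.subspace_span) blast
qed

lemma base_lines: "snd (veronese (base_algebra scl T)) = {line_space m | m. m \<noteq> 0}"
proof -
  let ?A = "base_algebra scl T"
  have inc: "G2_incident ?A p (a, b, c) \<longleftrightarrow> hprod (cnj a, cnj b, cnj c) p = 0" for p a b c
    by (cases p) simp
  have L: "G2_lines ?A = {(a, 1, c) | a c. True} \<union> {(1, 0, c) | c. True} \<union> {(0, 0, 1)}"
    unfolding G2_lines_def by auto
  have span: "M.span (\<Union> (veronese_map ?A ` {p \<in> G2_points ?A. G2_incident ?A p (a, b, c)})) = line_space (cnj a, cnj b, cnj c)" for a b c
    unfolding inc by (rule base_line)
  have eq: "snd (veronese ?A) = {line_space (cnj a, cnj b, cnj c) | a b c. (a, b, c) \<in> G2_lines ?A}"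
  proof -
    have "snd (veronese ?A) = {M.span (\<Union> (veronese_map ?A ` {p \<in> G2_points ?A. G2_incident ?A p l})) | l. l \<in> G2_lines ?A}"
      by (simp only: veronese_def snd_conv)
    also have "\<dots> = {M.span (\<Union> (veronese_map ?A ` {p \<in> G2_points ?A. G2_incident ?A p (a, b, c)})) | a b c. (a, b, c) \<in> G2_lines ?A}"
      by (simp only: split_paired_Ex)
    finally show ?thesis unfolding span .
  qed
  have sc: "line_space (rmul m r) = line_space m" if "r \<noteq> 0" for m r
    using that by (simp add: line_space_def hprod_rmul)
  show ?thesis
    unfolding eq
  proof (intro equalityI subsetI)
    fix l assume "l \<in> {line_space (cnj a, cnj b, cnj c) | a b c. (a, b, c) \<in> G2_lines ?A}"
    then obtain a b c where abc: "l = line_space (cnj a, cnj b, cnj c)" "(a, b, c) \<in> G2_lines ?A" by blast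
    have "(cnj a, cnj b, cnj c) \<noteq> 0" using abc(2) unfolding L by (auto simp: zero_prod_def)
    then show "l \<in> {line_space m | m. m \<noteq> 0}" using abc(1) by blast
  next
    fix l assume "l \<in> {line_space m | m. m \<noteq> 0}"
    then obtain m where m: "l = line_space m" "m \<noteq> 0" by blast
    from m(2) have "\<exists>a b c. l = line_space (cnj a, cnj b, cnj c) \<and> (a, b, c) \<in> G2_lines ?A"
      unfolding m(1)
    proof (cases rule: normal_form_line)
      case (1 a c r)
      then show "\<exists>a b c. line_space m = line_space (cnj a, cnj b, cnj c) \<and> (a, b, c) \<in> G2_lines ?A"
        by (intro exI[of _ "cnj a"] exI[of _ 1] exI[of _ "cnj c"]) (simp add: sc L del: rmul_Pair)
    next
      case (2 c r)
      then show "\<exists>a b c. line_space m = line_space (cnj a, cnj b, cnj c) \<and> (a, b, c) \<in> G2_lines ?A"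
        by (intro exI[of _ 1] exI[of _ 0] exI[of _ "cnj c"]) (simp add: sc L del: rmul_Pair)
    next
      case (3 r)
      then show "\<exists>a b c. line_space m = line_space (cnj a, cnj b, cnj c) \<and> (a, b, c) \<in> G2_lines ?A"
        by (intro exI[of _ 0] exI[of _ 0] exI[of _ 1]) (simp add: sc L del: rmul_Pair)
    qed
    then show "l \<in> {line_space (cnj a, cnj b, cnj c) | a b c. (a, b, c) \<in> G2_lines ?A}" by blast
  qed
qed

definition drop_t :: "('k, 'b \<times> 'b) ambient \<Rightarrow> ('k, 'b) ambient" where
  "drop_t = (\<lambda>(k, (a, _), (b, _), (c, _)). (k, a, b, c))"

lemma drop_t_emb [simp]: "drop_t (emb M \<tau>) = M"
  by (cases M; cases \<tau>) (simp add: drop_t_def)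

lemma linear_drop_t: "Vector_Spaces.linear s\<^sub>A s\<^sub>0 drop_t"
proof -
  have "drop_t (v + v') = drop_t v + drop_t v'" for v v'
    by (rule emb_surj[of v], rule emb_surj[of v']) (simp add: emb_add)
  moreover have "drop_t (s\<^sub>A c v) = s\<^sub>0 c (drop_t v)" for c v
    by (rule emb_surj[of v]) (simp add: emb_scale)
  ultimately show ?thesis
    unfolding Vector_Spaces.linear_iff using vector_space_sA vector_space_s0 by blast
qed

text \<open>\<open>drop_t\<close> is the projection from Y; on F the t-parts it forgets are zero, so
  it is a bijection there.\<close>

lemma projectively_equivalent_base:
  "projectively_equivalent s\<^sub>A F\<^sub>A ({point_F p | p. p \<noteq> 0}, {line_F m | m. m \<noteq> 0})
     s\<^sub>0 UNIV (veronese (base_algebra scl T))"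
  unfolding projectively_equivalent_def fst_conv snd_conv base_points base_lines
proof (intro exI[of _ drop_t] conjI linear_drop_t)
  show "bij_betw drop_t F\<^sub>A UNIV"
    by (rule bij_betw_byWitness[of _ "\<lambda>M. emb M 0"]) (auto simp: F\<^sub>A_def)
  interpret D: Vector_Spaces.linear s\<^sub>A s\<^sub>0 drop_t by (rule linear_drop_t)
  have "drop_t ` point_F p = M.span {rho p}" for p
    unfolding point_F_def D.span_image[symmetric] by simp
  moreover have "(`) drop_t ` {point_F p | p. p \<noteq> 0} = {drop_t ` point_F p | p. p \<noteq> 0}" by blast
  ultimately show "(`) drop_t ` {point_F p | p. p \<noteq> 0} = {M.span {rho p} | p. p \<noteq> 0}" by simp
  have "drop_t ` line_F m = line_space m" for m
    unfolding line_F_def by (simp add: image_image)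
  moreover have "(`) drop_t ` {line_F m | m. m \<noteq> 0} = {drop_t ` line_F m | m. m \<noteq> 0}" by blast
  ultimately show "(`) drop_t ` {line_F m | m. m \<noteq> 0} = {line_space m | m. m \<noteq> 0}" by simp
qed

section \<open>The linear duality\<close>

text \<open>The polarity on projective points: the chosen representative is determined up to a right
  factor only, which neither \<open>block\<close> nor the range of \<open>\<eta>\<close>
  notices.\<close>

definition \<chi> where "\<chi> x = block (SOME p. p \<noteq> 0 \<and> x = point_F p)"
definition \<chi>' where "\<chi>' \<xi> = range (\<eta> (SOME m. m \<noteq> 0 \<and> \<xi> = line_F m))"

lemma \<chi>_point_F:
  assumes "p \<noteq> 0" shows "\<chi> (point_F p) = block p"
proof -
  define q where "q = (SOME q. q \<noteq> 0 \<and> point_F p = point_F q)"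
  have q: "q \<noteq> 0 \<and> point_F p = point_F q" unfolding q_def by (rule someI[of _ p]) (simp add: assms)
  then have "block p = block q" using point_F_eq_iff[of p q] block_eq_iff[of p q] assms by simp
  then show ?thesis by (simp add: \<chi>_def q_def)
qed

lemma subspace_line_F: "Amb.V.subspace (line_F m)"
proof -
  interpret L: Vector_Spaces.linear s\<^sub>0 s\<^sub>A "\<lambda>M. emb M 0" by (rule linear_emb_left)
  show ?thesis unfolding line_F_def by (rule L.subspace_image[OF subspace_line_space])
qed

lemma mem_line_F: "emb M \<tau> \<in> line_F m \<longleftrightarrow> M \<in> line_space m \<and> \<tau> = 0"
  unfolding line_F_def image_iff emb_inject by blast

lemma point_F_subset_line_F: "m \<noteq> 0 \<Longrightarrow> p \<noteq> 0 \<Longrightarrow> point_F p \<subseteq> line_F m \<longleftrightarrow> hprod m p = 0"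
  by (simp add: point_F_subset_iff[OF subspace_line_F] mem_line_F rho_in_line_space_iff)

lemma line_F_eq_iff:
  assumes "m \<noteq> 0" "m' \<noteq> 0" shows "line_F m = line_F m' \<longleftrightarrow> (\<exists>r. m' = rmul m r)"
proof
  assume e: "line_F m = line_F m'"
  have "hprod p m' = 0" if p: "hprod m p = 0" for p
  proof (cases "p = 0")
    case False
    then have "hprod m' p = 0" using point_F_subset_line_F e assms p by metis
    then show ?thesis using hprod_eq_0_commute by blast
  qed simp
  then show "\<exists>r. m' = rmul m r" using perp_perp[OF assms(1)] by metis
next
  assume "\<exists>r. m' = rmul m r"
  then obtain r where r: "m' = rmul m r" by blast
  then have "r \<noteq> 0" using assms by auto
  then show "line_F m = line_F m'" using r line_F_rmul by simp
qed

lemma \<chi>'_line_F: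
  assumes "m \<noteq> 0" shows "\<chi>' (line_F m) = range (\<eta> m)"
proof -
  define q where "q = (SOME q. q \<noteq> 0 \<and> line_F m = line_F q)"
  have q: "q \<noteq> 0 \<and> line_F m = line_F q" unfolding q_def by (rule someI[of _ m]) (simp add: assms)
  then have "range (\<eta> m) = range (\<eta> q)" using line_F_eq_iff[of m q] range_\<eta>_eq_iff[of q m] assms by simp
  then show ?thesis by (simp add: \<chi>'_def q_def)
qed

lemma duality: "is_duality {point_F p | p. p \<noteq> 0} {line_F m | m. m \<noteq> 0} vertices blocks \<chi> \<chi>'"
  unfolding is_duality_def
proof (intro conjI ballI)
  have "inj_on \<chi> {point_F p | p. p \<noteq> 0}"
  proof (rule inj_onI)
    fix x y assume "x \<in> {point_F p | p. p \<noteq> 0}" "y \<in> {point_F p | p. p \<noteq> 0}" "\<chi> x = \<chi> y"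
    then obtain p q where "x = point_F p" "y = point_F q" "p \<noteq> 0" "q \<noteq> 0" "block p = block q"
      using \<chi>_point_F by auto
    then show "x = y" using point_F_eq_iff[of p q] block_eq_iff[of p q] by simp
  qed
  moreover have "\<chi> ` {point_F p | p. p \<noteq> 0} = {\<chi> (point_F p) | p. p \<noteq> 0}" by blast
  moreover have "{\<chi> (point_F p) | p. p \<noteq> 0} = blocks"
    unfolding blocks_def by (rule Collect_cong) (metis \<chi>_point_F)
  ultimately show "bij_betw \<chi> {point_F p | p. p \<noteq> 0} blocks" unfolding bij_betw_def by simp
  have "inj_on \<chi>' {line_F m | m. m \<noteq> 0}"
  proof (rule inj_onI)
    fix x y assume "x \<in> {line_F m | m. m \<noteq> 0}" "y \<in> {line_F m | m. m \<noteq> 0}" "\<chi>' x = \<chi>' y"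
    then obtain p q where "x = line_F p" "y = line_F q" "p \<noteq> 0" "q \<noteq> 0" "range (\<eta> p) = range (\<eta> q)"
      using \<chi>'_line_F by auto
    then show "x = y" using line_F_eq_iff[of p q] range_\<eta>_eq_iff[of q p] by simp
  qed
  moreover have "\<chi>' ` {line_F m | m. m \<noteq> 0} = {\<chi>' (line_F m) | m. m \<noteq> 0}" by blast
  moreover have "{\<chi>' (line_F m) | m. m \<noteq> 0} = vertices"
    unfolding vertices_def by (rule Collect_cong) (metis \<chi>'_line_F)
  ultimately show "bij_betw \<chi>' {line_F m | m. m \<noteq> 0} vertices" unfolding bij_betw_def by simp
  fix x \<xi> assume "x \<in> {point_F p | p. p \<noteq> 0}" "\<xi> \<in> {line_F m | m. m \<noteq> 0}"
  then obtain p m where "x = point_F p" "p \<noteq> 0" "\<xi> = line_F m" "m \<noteq> 0" by blast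
  then show "x \<subseteq> \<xi> \<longleftrightarrow> \<chi>' \<xi> \<subseteq> \<chi> x"
    using point_F_subset_line_F \<chi>_point_F \<chi>'_line_F range_\<eta>_subset_block hprod_eq_0_commute by simp
qed

lemma subspace_block: "p \<noteq> 0 \<Longrightarrow> Amb.V.subspace (block p)"
  using n_space_block Amb.V.has_dimension_subspace unfolding n_space_def by blast

section \<open>X as a union of punctured joins\<close>

text \<open>Outside the block the coefficient of \<open>rho p\<close> is nonzero and can be scaled
  to 1, which leaves exactly a t-part orthogonal to \<open>p\<close>.\<close>

lemma points_of_join:
  assumes p: "p \<noteq> 0"
  shows "points s\<^sub>A (Amb.V.span (point_F p \<union> block p)) - points s\<^sub>A (block p) =
    {Amb.V.span {emb (rho p) \<tau>} | \<tau>. hprod p \<tau> = 0}"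
proof (intro equalityI subsetI)
  fix \<pi> assume \<pi>: "\<pi> \<in> points s\<^sub>A (Amb.V.span (point_F p \<union> block p)) - points s\<^sub>A (block p)"
  then obtain v where v: "\<pi> = Amb.V.span {v}" "v \<in> Amb.V.span (point_F p \<union> block p)" "v \<noteq> 0" "v \<notin> block p"
    unfolding points_def by blast
  obtain x y where xy: "v = x + y" "x \<in> point_F p" "y \<in> block p"
    using v(2) unfolding Amb.V.span_Un point_F_def Amb.V.span_span Amb.V.span_eq_iff[THEN iffD2, OF subspace_block[OF p]] by blast
  obtain c where c: "x = s\<^sub>A c (emb (rho p) 0)" using xy(2) unfolding point_F_def Amb.V.span_singleton by blast
  obtain \<tau> where t: "y = emb 0 \<tau>" "hprod p \<tau> = 0" using xy(3) unfolding block_def by blast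
  have c0: "c \<noteq> 0" using v(4) xy(1,3) c by auto
  have "v = s\<^sub>A c (emb (rho p) (scl3 (inverse c) \<tau>))"
    unfolding xy(1) c t(1) emb_scale emb_add using c0 by simp
  moreover have "emb (rho p) (scl3 (inverse c) \<tau>) \<noteq> 0" using rho_nonzero[OF p] by simp
  ultimately have "\<pi> = Amb.V.span {emb (rho p) (scl3 (inverse c) \<tau>)}"
    unfolding v(1) using Amb.V.span_singleton_eq_iff c0 by blast
  moreover have "hprod p (scl3 (inverse c) \<tau>) = 0" using t(2) by (simp add: hprod_scl3)
  ultimately show "\<pi> \<in> {Amb.V.span {emb (rho p) \<tau>} | \<tau>. hprod p \<tau> = 0}" by blast
next
  fix \<pi> assume "\<pi> \<in> {Amb.V.span {emb (rho p) \<tau>} | \<tau>. hprod p \<tau> = 0}"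
  then obtain \<tau> where t: "\<pi> = Amb.V.span {emb (rho p) \<tau>}" "hprod p \<tau> = 0" by blast
  have "emb (rho p) \<tau> = emb (rho p) 0 + emb 0 \<tau>" by (simp add: emb_add)
  moreover have "emb (rho p) 0 \<in> point_F p" unfolding point_F_def by (simp add: Amb.V.span_base)
  moreover have "emb 0 \<tau> \<in> block p" using t(2) by (simp add: mem_block)
  ultimately have "emb (rho p) \<tau> \<in> Amb.V.span (point_F p \<union> block p)"
    by (simp add: Amb.V.span_add Amb.V.span_base)
  then show "\<pi> \<in> points s\<^sub>A (Amb.V.span (point_F p \<union> block p)) - points s\<^sub>A (block p)"
    unfolding t(1) using rho_nonzero[OF p]
    by (simp add: Amb.V.span_singleton_in_points_iff subspace_block[OF p] mem_block)
qed

lemma X_union: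
  "X\<^sub>A = (\<Union>x'\<in>{point_F p | p. p \<noteq> 0}. points s\<^sub>A (Amb.V.span (x' \<union> \<chi> x')) - points s\<^sub>A (\<chi> x'))"
proof -
  have "(\<Union>x'\<in>{point_F p | p. p \<noteq> 0}. points s\<^sub>A (Amb.V.span (x' \<union> \<chi> x')) - points s\<^sub>A (\<chi> x'))
    = (\<Union>p\<in>{p. p \<noteq> 0}. points s\<^sub>A (Amb.V.span (point_F p \<union> \<chi> (point_F p))) - points s\<^sub>A (\<chi> (point_F p)))"
    by blast
  also have "\<dots> = (\<Union>p\<in>{p. p \<noteq> 0}. {Amb.V.span {emb (rho p) \<tau>} | \<tau>. hprod p \<tau> = 0})"
    by (rule SUP_cong) (simp_all only: mem_Collect_eq \<chi>_point_F points_of_join not_False_eq_True)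
  finally show ?thesis unfolding veronese_points by blast
qed

text \<open>Dividing \<open>Y\<close> by a vertex: the chart of the quotient \<open>Y / \<langle>m\<rangle>\<close> given by \<open>\<tau> \<mapsto> (- w\<^sup>*\<tau>, u\<^sup>*\<tau>)\<close>
  carries the block of \<open>u a + w b\<close> to the spread element through \<open>(a, b)\<close> when \<open>a\<close> and \<open>b\<close> are
  scalars.\<close>

lemma quotient_chart:
  assumes f: "frame m u w t t'" and W: "complement_in s\<^sub>A Y\<^sub>A (range (\<eta> m)) W"
  obtains \<phi> where "Vector_Spaces.linear scl2 s\<^sub>A \<phi>" "inj \<phi>" "range \<phi> = W"
    "\<And>z. \<exists>\<tau>. \<phi> z = emb 0 \<tau> \<and> hprod u \<tau> = snd z \<and> hprod w \<tau> = - fst z"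
proof -
  have sW: "Amb.V.subspace W" and int: "range (\<eta> m) \<inter> W = {0}" using W by (simp_all add: complement_in_def)
  have WY: "W \<subseteq> Y\<^sub>A" using Amb.V.complement_in_subset[OF W] by blast
  define P where "P = (\<lambda>z v. v \<in> W \<and> (\<exists>\<tau>. v = emb 0 \<tau> \<and> hprod u \<tau> = snd z \<and> hprod w \<tau> = - fst z))"
  have ex: "\<exists>v. P z v" for z
  proof -
    \<comment> \<open>The dual vectors produce a t-part with the prescribed pairings. Its component
      in \<open>W\<close> has the same pairings, since it differs by a multiple of \<open>m\<close>,
      which is orthogonal to \<open>u\<close> and \<open>w\<close>.\<close>
    define \<tau>0 where "\<tau>0 = rmul t (snd z) + rmul t' (- fst z)"
    have "emb 0 \<tau>0 \<in> Y\<^sub>A" by (simp add: Y\<^sub>A_def)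
    then obtain a v where av: "a \<in> range (\<eta> m)" "v \<in> W" "emb 0 \<tau>0 = a + v"
      using Amb.V.complement_decomposition[OF W] by blast
    obtain r where r: "a = emb 0 (rmul m r)" using av(1) by (auto simp: \<eta>_def)
    have "v = emb 0 \<tau>0 - a" using av(3) by simp
    then have v: "v = emb 0 (\<tau>0 - rmul m r)" by (simp add: r emb_diff)
    have "hprod u (\<tau>0 - rmul m r) = snd z" "hprod w (\<tau>0 - rmul m r) = - fst z"
      by (simp_all add: \<tau>0_def hprod_diff_right hprod_add_right hprod_rmul_right frameD[OF f])
    then show ?thesis unfolding P_def using av(2) v by blast
  qed
  \<comment> \<open>Two candidates differ by a vector that is orthogonal to \<open>u\<close> and
    \<open>w\<close>, hence lies in the vertex, and that also lies in the complement
    \<open>W\<close>.\<close>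
  have uniq: "v = v'" if P: "P z v" "P z v'" for z v v'
  proof -
    obtain \<tau> \<tau>' where t: "v = emb 0 \<tau>" "hprod u \<tau> = snd z" "hprod w \<tau> = - fst z"
      "v' = emb 0 \<tau>'" "hprod u \<tau>' = snd z" "hprod w \<tau>' = - fst z"
      using P unfolding P_def by blast
    have "hprod u (\<tau> - \<tau>') = 0" "hprod w (\<tau> - \<tau>') = 0" using t by (simp_all add: hprod_diff_right)
    then obtain r where "\<tau> - \<tau>' = rmul m r" by (rule frame_kernel[OF f])
    then have "emb 0 (\<tau> - \<tau>') \<in> range (\<eta> m)" unfolding mem_range_\<eta> by blast
    then have "v - v' \<in> range (\<eta> m)" using t by (simp add: emb_diff)
    moreover have "v - v' \<in> W" using P sW Amb.V.subspace_diff unfolding P_def by blast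
    ultimately have "v - v' = 0" using int by blast
    then show ?thesis by simp
  qed
  \<comment> \<open>\<open>P\<close> is total and single-valued; closure under sums and multiples
    then makes the map it describes linear.\<close>
  define \<phi> where "\<phi> = (\<lambda>z. THE v. P z v)"
  have \<phi>: "P z (\<phi> z)" for z
  proof -
    have "\<exists>!v. P z v" using ex uniq by blast
    then show ?thesis unfolding \<phi>_def by (rule theI')
  qed
  have \<phi>_eq: "\<phi> z = v" if "P z v" for z v using uniq[OF \<phi> that] .
  have P_add: "P (z + z') (v + v')" if P: "P z v" "P z' v'" for z z' v v'
  proof -
    obtain \<tau> \<tau>' where t: "v = emb 0 \<tau>" "hprod u \<tau> = snd z" "hprod w \<tau> = - fst z"
      "v' = emb 0 \<tau>'" "hprod u \<tau>' = snd z'" "hprod w \<tau>' = - fst z'"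
      using P unfolding P_def by blast
    have "v + v' = emb 0 (\<tau> + \<tau>')" using t by (simp add: emb_add)
    moreover have "hprod u (\<tau> + \<tau>') = snd (z + z')" "hprod w (\<tau> + \<tau>') = - fst (z + z')"
      using t by (simp_all add: hprod_add_right)
    moreover have "v + v' \<in> W" using P sW Amb.V.subspace_add unfolding P_def by blast
    ultimately show ?thesis unfolding P_def by blast
  qed
  have P_scale: "P (scl2 c z) (s\<^sub>A c v)" if P: "P z v" for c z v
  proof -
    obtain \<tau> where t: "v = emb 0 \<tau>" "hprod u \<tau> = snd z" "hprod w \<tau> = - fst z"
      using P unfolding P_def by blast
    have "s\<^sub>A c v = emb 0 (scl3 c \<tau>)" using t by (simp add: emb_scale)
    moreover have "hprod u (scl3 c \<tau>) = snd (scl2 c z)" "hprod w (scl3 c \<tau>) = - fst (scl2 c z)"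
      using t by (cases z, simp add: hprod_scl3)+
    moreover have "s\<^sub>A c v \<in> W" using P sW Amb.V.subspace_scale unfolding P_def by blast
    ultimately show ?thesis unfolding P_def by blast
  qed
  have lin: "Vector_Spaces.linear scl2 s\<^sub>A \<phi>"
    unfolding Vector_Spaces.linear_iff
    using vector_space_scl2 vector_space_sA \<phi>_eq[OF P_add[OF \<phi> \<phi>]] \<phi>_eq[OF P_scale[OF \<phi>]] by blast
  show thesis
  proof (rule that[of \<phi>])
    show "Vector_Spaces.linear scl2 s\<^sub>A \<phi>" by (rule lin)
    show "inj \<phi>"
    proof (rule injI)
      fix z z' assume e: "\<phi> z = \<phi> z'"
      obtain \<tau> where t: "\<phi> z = emb 0 \<tau>" "hprod u \<tau> = snd z" "hprod w \<tau> = - fst z"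
        using \<phi>[of z] unfolding P_def by blast
      obtain \<tau>' where t': "\<phi> z' = emb 0 \<tau>'" "hprod u \<tau>' = snd z'" "hprod w \<tau>' = - fst z'"
        using \<phi>[of z'] unfolding P_def by blast
      have "\<tau> = \<tau>'" using e t t' by simp
      then show "z = z'" using t(2,3) t'(2,3) by (intro prod_eqI) simp_all
    qed
    show "\<exists>\<tau>. \<phi> z = emb 0 \<tau> \<and> hprod u \<tau> = snd z \<and> hprod w \<tau> = - fst z" for z
      using \<phi>[of z] unfolding P_def by blast
    show "range \<phi> = W"
    proof (intro equalityI subsetI)
      fix v assume "v \<in> range \<phi>"
      then show "v \<in> W" using \<phi> unfolding P_def by blast
    next
      fix v assume v: "v \<in> W"
      then obtain \<tau> where t: "v = emb 0 \<tau>" using WY unfolding Y\<^sub>A_def by blast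
      have "P (- hprod w \<tau>, hprod u \<tau>) v" unfolding P_def using v t by auto
      then show "v \<in> range \<phi>" using \<phi>_eq by blast
    qed
  qed
qed

lemma block_Int_chart:
  assumes "range \<phi> = W" "\<And>z. \<exists>\<tau>. \<phi> z = emb 0 \<tau> \<and> hprod u \<tau> = snd z \<and> hprod w \<tau> = - fst z"
  shows "block (rmul u \<alpha> + rmul w \<beta>) \<inter> W = \<phi> ` {z. cnj \<alpha> * snd z = cnj \<beta> * fst z}"
proof -
  have iff: "\<phi> z \<in> block (rmul u \<alpha> + rmul w \<beta>) \<longleftrightarrow> cnj \<alpha> * snd z = cnj \<beta> * fst z" for z
  proof -
    obtain \<tau> where t: "\<phi> z = emb 0 \<tau>" "hprod u \<tau> = snd z" "hprod w \<tau> = - fst z" using assms(2) by blast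
    show ?thesis unfolding t(1) mem_block by (simp add: hprod_add hprod_rmul t(2,3))
  qed
  then show ?thesis unfolding assms(1)[symmetric] by blast
qed

text \<open>The blocks through the vertex of \<open>m\<close> belong to the points of the line
  \<open>m\<close>. In the chart, the block of \<open>u \<alpha> + w \<beta>\<close> becomes the
  right subspace given by one homogeneous left equation with coefficients conjugate to
  \<open>\<alpha>\<close> and \<open>\<beta>\<close>. Such equations describe exactly the points of
  the projective line over B.\<close>

lemma regular_spread_quotient:
  assumes m: "m \<noteq> 0" and W: "complement_in s\<^sub>A Y\<^sub>A (range (\<eta> m)) W"
  shows "regular_spread_line s\<^sub>A (d - 1) W {b \<inter> W | b. b \<in> blocks \<and> range (\<eta> m) \<subseteq> b}"
proof -
  obtain u w t t' where f: "frame m u w t t'" using frame_exists m by blast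
  obtain \<phi> where \<phi>: "Vector_Spaces.linear scl2 s\<^sub>A \<phi>" "inj \<phi>" "range \<phi> = W"
    "\<And>z. \<exists>\<tau>. \<phi> z = emb 0 \<tau> \<and> hprod u \<tau> = snd z \<and> hprod w \<tau> = - fst z"
    using quotient_chart[OF f W] by blast
  have sl: "Amb.spread_line \<phi> a b = \<phi> ` {z. \<exists>r. z = (a * r, b * r)}" for a b
    unfolding Amb.spread_line_def by blast
  have 1: "\<exists>x y. (x \<noteq> 0 \<or> y \<noteq> 0) \<and> block p \<inter> W = Amb.spread_line \<phi> x y" if p: "p \<noteq> 0" "hprod p m = 0" for p
  proof -
    have "hprod m p = 0" using p hprod_eq_0_commute by blast
    then obtain \<alpha> \<beta> where ab: "p = rmul u \<alpha> + rmul w \<beta>" using frameD(10)[OF f] by blast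
    then have n: "\<alpha> \<noteq> 0 \<or> \<beta> \<noteq> 0" using p by auto
    show ?thesis
    proof (cases "\<beta> = 0")
      case True
      have "{z. cnj \<alpha> * snd z = cnj \<beta> * fst z} = {z. \<exists>r. z = (1 * r, 0 * r)}"
        using True n by (auto simp: prod_eq_iff)
      then show ?thesis unfolding ab block_Int_chart[OF \<phi>(3,4)] sl by (intro exI[of _ 1] exI[of _ 0]) simp
    next
      case False
      have "cnj \<alpha> * z2 = cnj \<beta> * z1 \<longleftrightarrow> z1 = binv (cnj \<beta>) * cnj \<alpha> * z2" for z1 z2
      proof
        assume "cnj \<alpha> * z2 = cnj \<beta> * z1"
        then have "binv (cnj \<beta>) * (cnj \<alpha> * z2) = z1" using False by simp
        then show "z1 = binv (cnj \<beta>) * cnj \<alpha> * z2" by (simp add: mult.assoc)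
      next
        assume "z1 = binv (cnj \<beta>) * cnj \<alpha> * z2"
        then show "cnj \<alpha> * z2 = cnj \<beta> * z1" using False by (simp add: mult.assoc)
      qed
      then have "{z. cnj \<alpha> * snd z = cnj \<beta> * fst z} = {z. \<exists>r. z = (binv (cnj \<beta>) * cnj \<alpha> * r, 1 * r)}"
        by (simp add: prod_eq_iff)
      then show ?thesis unfolding ab block_Int_chart[OF \<phi>(3,4)] sl
        by (intro exI[of _ "binv (cnj \<beta>) * cnj \<alpha>"] exI[of _ 1]) simp
    qed
  qed
  have 2: "\<exists>p. p \<noteq> 0 \<and> hprod p m = 0 \<and> block p \<inter> W = Amb.spread_line \<phi> x y" if xy: "x \<noteq> 0 \<or> y \<noteq> 0" for x y
  proof -
    obtain \<alpha> \<beta> where ab: "\<alpha> \<noteq> 0 \<or> \<beta> \<noteq> 0" "{z. cnj \<alpha> * snd z = cnj \<beta> * fst z} = {z. \<exists>r. z = (x * r, y * r)}"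
    proof (cases "x = 0")
      case True
      have y: "y \<noteq> 0" using xy True by simp
      have "z2 = y * (binv y * z2)" for z2 using y by simp
      then have "{z. cnj 0 * snd z = cnj 1 * fst z} = {z. \<exists>r. z = (x * r, y * r)}"
        using True by (auto simp: prod_eq_iff)
      then show thesis using that[of 0 1] by simp
    next
      case False
      have "z2 = y * binv x * z1 \<longleftrightarrow> (\<exists>r. z1 = x * r \<and> z2 = y * r)" for z1 z2
      proof
        assume "z2 = y * binv x * z1"
        then have "z1 = x * (binv x * z1) \<and> z2 = y * (binv x * z1)" using False by (simp add: mult.assoc)
        then show "\<exists>r. z1 = x * r \<and> z2 = y * r" by blast
      next
        assume "\<exists>r. z1 = x * r \<and> z2 = y * r"
        then show "z2 = y * binv x * z1" using False by (auto simp: mult.assoc)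
      qed
      then have "{z. cnj 1 * snd z = cnj (cnj (y * binv x)) * fst z} = {z. \<exists>r. z = (x * r, y * r)}"
        by (simp add: prod_eq_iff)
      then show thesis using that[of 1 "cnj (y * binv x)"] by simp
    qed
    define p where "p = rmul u \<alpha> + rmul w \<beta>"
    have "p \<noteq> 0" using frame_unique[OF f, of \<alpha> \<beta> 0 0] ab(1) by (auto simp: p_def)
    moreover have "hprod p m = 0" by (simp add: p_def hprod_add hprod_rmul frameD[OF f])
    moreover have "block p \<inter> W = Amb.spread_line \<phi> x y"
      unfolding p_def block_Int_chart[OF \<phi>(3,4)] sl ab(2) ..
    ultimately show ?thesis by blast
  qed
  have "{b \<inter> W | b. b \<in> blocks \<and> range (\<eta> m) \<subseteq> b} = {Amb.spread_line \<phi> x y | x y. x \<noteq> 0 \<or> y \<noteq> 0}"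
  proof (intro equalityI subsetI)
    fix V assume "V \<in> {b \<inter> W | b. b \<in> blocks \<and> range (\<eta> m) \<subseteq> b}"
    then obtain p where "V = block p \<inter> W" "p \<noteq> 0" "hprod p m = 0"
      unfolding blocks_def using range_\<eta>_subset_block by blast
    then show "V \<in> {Amb.spread_line \<phi> x y | x y. x \<noteq> 0 \<or> y \<noteq> 0}" using 1 by blast
  next
    fix V assume "V \<in> {Amb.spread_line \<phi> x y | x y. x \<noteq> 0 \<or> y \<noteq> 0}"
    then obtain x y where "V = Amb.spread_line \<phi> x y" "x \<noteq> 0 \<or> y \<noteq> 0" by blast
    then obtain p where "p \<noteq> 0" "hprod p m = 0" "V = block p \<inter> W" using 2 by metis
    moreover from this have "range (\<eta> m) \<subseteq> block p" by (simp add: range_\<eta>_subset_block)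
    moreover have "block p \<in> blocks" unfolding blocks_def using \<open>p \<noteq> 0\<close> by blast
    ultimately show "V \<in> {b \<inter> W | b. b \<in> blocks \<and> range (\<eta> m) \<subseteq> b}" by blast
  qed
  then show ?thesis using Amb.regular_spread_lines[OF \<phi>(1,2)] \<phi>(3) by simp
qed

lemma block_Int_member:
  assumes \<phi>: "Vector_Spaces.linear scl2 s\<^sub>A \<phi>" "inj \<phi>" "range \<phi> = W"
    "\<And>z. \<exists>\<tau>. \<phi> z = emb 0 \<tau> \<and> hprod u \<tau> = snd z \<and> hprod w \<tau> = - fst z" and ab: "a \<noteq> 0 \<or> b \<noteq> 0"
  shows "block (rmul u (scl a 1) + rmul w (scl b 1)) \<inter> W = Amb.\<kappa>_member \<phi> a b"
proof -
  have eq: "{z. cnj (scl a 1) * snd z = cnj (scl b 1) * fst z} = {z. \<exists>r. z = (scl a r, scl b r)}"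
  proof -
    have "scl a z2 = scl b z1 \<longleftrightarrow> (\<exists>r. z1 = scl a r \<and> z2 = scl b r)" for z1 z2
    proof
      assume e: "scl a z2 = scl b z1"
      show "\<exists>r. z1 = scl a r \<and> z2 = scl b r"
      proof (cases "a = 0")
        case True
        then have b: "b \<noteq> 0" using ab by simp
        have "z2 = scl b (scl (inverse b) z2)" using b by simp
        moreover have "z1 = 0" using e True b by simp
        ultimately show ?thesis using True B.scale_zero_left by metis
      next
        case False
        have "z1 = scl a (scl (inverse a) z1)" using False by simp
        moreover have "z2 = scl (inverse a) (scl a z2)" using False by simp
        then have "z2 = scl b (scl (inverse a) z1)" unfolding e by (simp add: mult.commute)
        ultimately show ?thesis by blast
      qed
    next
      assume "\<exists>r. z1 = scl a r \<and> z2 = scl b r"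
      then show "scl a z2 = scl b z1" by (auto simp: mult.commute)
    qed
    then show ?thesis by (simp add: cnj_scl prod_eq_iff)
  qed
  show ?thesis
    unfolding block_Int_chart[OF \<phi>(3,4)] Amb.\<kappa>_member_def[OF \<phi>(1,2)] eq by blast
qed

section \<open>Conics as chains\<close>

text \<open>The points of a line over B that have scalar coordinates relative to \<open>u\<close>,
  \<open>w\<close> form a subline over K, a chain of the projective line over B.\<close>

definition chain_point where
  "chain_point u w a b = point_F (rmul u (scl a 1) + rmul w (scl b 1))"

lemma chain_vector_nonzero:
  assumes f: "frame m u w t t'" and "a \<noteq> 0 \<or> b \<noteq> 0"
  shows "rmul u (scl a 1) + rmul w (scl b 1) \<noteq> 0"
  using frame_unique[OF f, of "scl a 1" "scl b 1" 0 0] assms(2) by auto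

text \<open>The factor \<open>r\<close> between representatives is a priori in B. Scalars are
  central, so it can be eliminated, and the usual determinant condition over K remains.\<close>

lemma chain_point_eq_iff:
  assumes f: "frame m u w t t'" and "a \<noteq> 0 \<or> b \<noteq> 0" "a' \<noteq> 0 \<or> b' \<noteq> 0"
  shows "chain_point u w a b = chain_point u w a' b' \<longleftrightarrow> a * b' = a' * b"
proof -
  have "(\<exists>r. rmul u (scl a' 1) + rmul w (scl b' 1) = rmul (rmul u (scl a 1) + rmul w (scl b 1)) r) \<longleftrightarrow>
    (\<exists>r. scl a' 1 = scl a r \<and> scl b' 1 = scl b r)"
  proof -
    have "rmul u (scl a' 1) + rmul w (scl b' 1) = rmul (rmul u (scl a 1) + rmul w (scl b 1)) r \<longleftrightarrow>
        scl a' 1 = scl a r \<and> scl b' 1 = scl b r" for r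
      using frame_unique[OF f, of "scl a' 1" "scl b' 1" "scl a r" "scl b r"] by (auto simp: rmul_add)
    then show ?thesis by simp
  qed
  also have "\<dots> \<longleftrightarrow> a * b' = a' * b"
  proof
    assume "\<exists>r. scl a' 1 = scl a r \<and> scl b' 1 = scl b r"
    then obtain r where r: "scl a' 1 = scl a r" "scl b' 1 = scl b r" by blast
    have "scl (a * b') 1 = scl a (scl b' 1)" by simp
    also have "\<dots> = scl b (scl a r)" unfolding r(2) by (simp add: mult.commute)
    also have "\<dots> = scl (a' * b) 1" unfolding r(1)[symmetric] by (simp add: mult.commute)
    finally show "a * b' = a' * b" by simp
  next
    assume e: "a * b' = a' * b"
    show "\<exists>r. scl a' 1 = scl a r \<and> scl b' 1 = scl b r"
    proof (cases "a = 0")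
      case True
      then have "b \<noteq> 0" "a' = 0" using assms(2) e by auto
      then show ?thesis using True by (intro exI[of _ "scl (b' / b) 1"]) simp
    next
      case False
      then have "b' = b * (a' / a)" using e by (simp add: field_simps)
      then show ?thesis using False by (intro exI[of _ "scl (a' / a) 1"]) simp
    qed
  qed
  finally show ?thesis
    unfolding chain_point_def using point_F_eq_iff chain_vector_nonzero[OF f] assms(2,3) by simp
qed

lemma chain_point_conic_vector:
  "chain_point u w a b = Amb.V.span {conic_vector s\<^sub>A (emb (rho u) 0) (emb (herm u w 1) 0) (emb (rho w) 0) (a, b)}"
proof -
  have "herm u w (scl k \<gamma>) = s\<^sub>0 k (herm u w \<gamma>)" for k \<gamma>
    by (cases u; cases w) (simp add: cnj_simps T_scl algebra_simps)
  then have h: "herm u w (scl k 1) = s\<^sub>0 k (herm u w 1)" for k .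
  have "rho (rmul u (scl a 1) + rmul w (scl b 1)) = s\<^sub>0 (a\<^sup>2) (rho u) + s\<^sub>0 (b\<^sup>2) (rho w) + s\<^sub>0 (a * b) (herm u w 1)"
    unfolding rho_combination line_map_Pair by (simp add: N_scl cnj_scl mult.commute h)
  then show ?thesis
    unfolding chain_point_def point_F_def conic_vector_def
    by (simp add: emb_scale emb_add algebra_simps)
qed

lemma conic_vectors_independent:
  assumes f: "frame m u w t t'"
  shows "card {emb (rho u) 0, emb (herm u w 1) 0, emb (rho w) 0} = 3 \<and>
    Amb.V.independent {emb (rho u) 0, emb (herm u w 1) 0, emb (rho w) 0}"
  unfolding Amb.V.independent_3_iff
proof (intro allI impI)
  fix x y z
  assume e: "s\<^sub>A x (emb (rho u) 0) + s\<^sub>A y (emb (herm u w 1) 0) + s\<^sub>A z (emb (rho w) 0) = 0"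
  have "herm u w (scl y 1) = s\<^sub>0 y (herm u w 1)"
    by (cases u; cases w) (simp add: cnj_simps T_scl algebra_simps)
  then have "line_map u w (x, z, scl y 1) = 0"
    using e unfolding line_map_Pair emb_scale emb_add emb_eq_0_iff by (simp add: add_ac)
  then have "(x, z, scl y 1) = 0" using line_map_eq_0_iff[OF f] by blast
  then show "x = 0 \<and> y = 0 \<and> z = 0" by (simp add: zero_prod_def)
qed

text \<open>Three points of the conic that span its plane are normalised to \<open>u\<close>,
  \<open>w\<close>, \<open>u + w\<close>. The plane then consists of the matrices whose
  \<open>\<gamma>\<close>-entry is a scalar, and a point of the line has such an image precisely
  when its coordinates have a ratio in K.\<close>

lemma conic_is_chain:
  assumes m: "m \<noteq> 0" and C: "C \<in> conics_of s\<^sub>A (line_F m) ({point_F p | p. p \<noteq> 0} \<inter> points s\<^sub>A (line_F m))"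
  obtains u w t t' where "frame m u w t t'" "C = {chain_point u w a b | a b. a \<noteq> 0 \<or> b \<noteq> 0}"
proof -
  define Q where "Q = {point_F p | p. p \<noteq> 0} \<inter> points s\<^sub>A (line_F m)"
  have Q: "x \<in> Q \<longleftrightarrow> (\<exists>p. p \<noteq> 0 \<and> hprod m p = 0 \<and> x = point_F p)" for x
  proof -
    have "point_F p \<in> points s\<^sub>A (line_F m) \<longleftrightarrow> hprod m p = 0" if "p \<noteq> 0" for p
      unfolding point_F_def Amb.V.span_singleton_in_points_iff[OF subspace_line_F] mem_line_F
      using rho_in_line_space_iff[OF m that] rho_nonzero[OF that] by simp
    then show ?thesis unfolding Q_def by blast
  qed
  obtain E where E: "E \<subseteq> line_F m" "is_conic s\<^sub>A E C" "C = Q \<inter> points s\<^sub>A E"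
    using C unfolding conics_of_def Q_def by blast
  obtain q where q: "n_space s\<^sub>A 2 E" "C \<noteq> {}" "quadratic_form_on s\<^sub>A E q" "nondegenerate_on E q" "C = quadric s\<^sub>A E q"
    using E(2) unfolding is_conic_def by blast
  obtain e f h where efh: "card {e, f, h} = 3" "Amb.V.independent {e, f, h}" "Amb.V.span {e, f, h} = E"
    "q e = 0" "q f = 0" "q h = 0"
    using Amb.V.conic_spanning_points[OF q(1,3,4)] q(2,5) by metis
  have sE: "Amb.V.subspace E" using efh(3) Amb.V.subspace_span by metis
  have ind: "x = 0 \<and> y = 0 \<and> z = 0" if "s\<^sub>A x e + s\<^sub>A y f + s\<^sub>A z h = 0" for x y z
    using Amb.V.independent_3_iff efh(1,2) that by blast
  have nz: "e \<noteq> 0" "f \<noteq> 0" "h \<noteq> 0" using ind[of 1 0 0] ind[of 0 1 0] ind[of 0 0 1] by auto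
  have inC: "Amb.V.span {v} \<in> C" if "v \<in> {e, f, h}" for v
  proof -
    have "v \<in> E" using Amb.V.span_base[OF that] efh(3) by simp
    moreover have "v \<noteq> 0" using that nz by blast
    moreover have "q v = 0" using that efh by blast
    ultimately show ?thesis unfolding q(5) quadric_def by blast
  qed
  have pt: "\<exists>p. p \<noteq> 0 \<and> hprod m p = 0 \<and> Amb.V.span {v} = point_F p" if "v \<in> {e, f, h}" for v
    using inC[OF that] unfolding E(3) Q[symmetric] using Q by blast
  obtain p1 where p1: "p1 \<noteq> 0" "hprod m p1 = 0" "Amb.V.span {e} = point_F p1" using pt by blast
  obtain p2 where p2: "p2 \<noteq> 0" "hprod m p2 = 0" "Amb.V.span {f} = point_F p2" using pt by blast
  obtain p3 where p3: "p3 \<noteq> 0" "hprod m p3 = 0" "Amb.V.span {h} = point_F p3" using pt by blast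
  have n12: "\<nexists>r. p2 = rmul p1 r"
  proof
    assume "\<exists>r. p2 = rmul p1 r"
    then have "Amb.V.span {e} = Amb.V.span {f}" using point_F_eq_iff[OF p1(1) p2(1)] p1(3) p2(3) by simp
    then obtain c where "f = s\<^sub>A c e" using Amb.V.span_singleton_eq_iff[OF nz(1)] by blast
    then show False using ind[of "- c" 1 0] by simp
  qed
  have n13: "\<nexists>r. p3 = rmul p1 r"
  proof
    assume "\<exists>r. p3 = rmul p1 r"
    then have "Amb.V.span {e} = Amb.V.span {h}" using point_F_eq_iff[OF p1(1) p3(1)] p1(3) p3(3) by simp
    then obtain c where "h = s\<^sub>A c e" using Amb.V.span_singleton_eq_iff[OF nz(1)] by blast
    then show False using ind[of "- c" 0 1] by simp
  qed
  have n23: "\<nexists>r. p3 = rmul p2 r"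
  proof
    assume "\<exists>r. p3 = rmul p2 r"
    then have "Amb.V.span {f} = Amb.V.span {h}" using point_F_eq_iff[OF p2(1) p3(1)] p2(3) p3(3) by simp
    then obtain c where "h = s\<^sub>A c f" using Amb.V.span_singleton_eq_iff[OF nz(2)] by blast
    then show False using ind[of 0 "- c" 1] by simp
  qed
  obtain t0 t0' where f0: "frame m p1 p2 t0 t0'" using frame_of_points[OF m p1(2,1) p2(2) n12] by blast
  obtain \<alpha> \<beta> where ab: "p3 = rmul p1 \<alpha> + rmul p2 \<beta>" using frameD(10)[OF f0] p3(2) by blast
  have a0: "\<alpha> \<noteq> 0" using n23 ab by auto
  have b0: "\<beta> \<noteq> 0" using n13 ab by auto
  \<comment> \<open>The third point is \<open>p1 \<alpha> + p2 \<beta>\<close>; absorbing the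
    factors makes it \<open>u + w\<close>. This replaces the representatives but not the
    points.\<close>
  define u w where "u = rmul p1 \<alpha>" and "w = rmul p2 \<beta>"
  have u: "u \<noteq> 0" "hprod m u = 0" "point_F u = point_F p1"
    using p1 a0 point_F_eq_iff[of p1 u] by (auto simp: u_def hprod_rmul_right)
  have w: "w \<noteq> 0" "hprod m w = 0" "point_F w = point_F p2"
    using p2 b0 point_F_eq_iff[of p2 w] by (auto simp: w_def hprod_rmul_right)
  have "\<nexists>r. w = rmul u r"
  proof
    assume "\<exists>r. w = rmul u r"
    then have "point_F p1 = point_F p2" using point_F_eq_iff[OF u(1) w(1)] u(3) w(3) by simp
    then show False using n12 point_F_eq_iff[OF p1(1) p2(1)] by blast
  qed
  then obtain t t' where fr: "frame m u w t t'" using frame_of_points[OF m u(2,1) w(2)] by blast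
  interpret L: Vector_Spaces.linear sclQ s\<^sub>0 "line_map u w" by (rule linear_line_map)
  have lm: "rho u = line_map u w (1, 0, 0)" "rho w = line_map u w (0, 1, 0)" "rho p3 = line_map u w (1, 1, 1)"
    using rho_combination[of u 1 w 0] rho_combination[of u 0 w 1] rho_add[of u w]
    by (simp_all add: ab flip: u_def w_def)
  have inE: "emb (rho u) 0 \<in> E" "emb (rho w) 0 \<in> E" "emb (rho p3) 0 \<in> E"
  proof -
    have "point_F u \<in> points s\<^sub>A E" "point_F w \<in> points s\<^sub>A E" "point_F p3 \<in> points s\<^sub>A E"
      using inC[of e] inC[of f] inC[of h] p1(3) p2(3) p3(3) u(3) w(3) unfolding E(3) by simp_all
    then show "emb (rho u) 0 \<in> E" "emb (rho w) 0 \<in> E" "emb (rho p3) 0 \<in> E"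
      unfolding point_F_def Amb.V.span_singleton_in_points_iff[OF sE] by blast+
  qed
  \<comment> \<open>\<open>rho (u + w)\<close> has \<open>\<gamma>\<close>-entry 1, so the span of
    the three images is the part of the quadric space with scalar \<open>\<gamma>\<close>.\<close>
  have vecE: "v \<in> E \<longleftrightarrow> (\<exists>a b c. v = emb (line_map u w (a, b, scl c 1)) 0)" for v
  proof -
    have gen: "s\<^sub>A x (emb (rho u) 0) + s\<^sub>A y (emb (rho w) 0) + s\<^sub>A z (emb (rho p3) 0)
      = emb (line_map u w (x + z, y + z, scl z 1)) 0" for x y z
      unfolding lm emb_scale emb_add L.scale[symmetric] L.add[symmetric] by simp
    have "e \<in> Amb.V.span {emb (rho u) 0}" "f \<in> Amb.V.span {emb (rho w) 0}" "h \<in> Amb.V.span {emb (rho p3) 0}"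
      using p1(3) p2(3) p3(3) u(3) w(3) Amb.V.span_base[of e "{e}"] Amb.V.span_base[of f "{f}"] Amb.V.span_base[of h "{h}"]
      unfolding point_F_def by simp_all
    then have "{e, f, h} \<subseteq> Amb.V.span {emb (rho u) 0, emb (rho w) 0, emb (rho p3) 0}"
      using Amb.V.span_mono[of "{emb (rho u) 0}" "{emb (rho u) 0, emb (rho w) 0, emb (rho p3) 0}"]
        Amb.V.span_mono[of "{emb (rho w) 0}" "{emb (rho u) 0, emb (rho w) 0, emb (rho p3) 0}"]
        Amb.V.span_mono[of "{emb (rho p3) 0}" "{emb (rho u) 0, emb (rho w) 0, emb (rho p3) 0}"] by blast
    then have "E = Amb.V.span {emb (rho u) 0, emb (rho w) 0, emb (rho p3) 0}"
      unfolding efh(3)[symmetric] Amb.V.span_eq using inE unfolding efh(3) by simp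
    then have "v \<in> E \<longleftrightarrow> (\<exists>x y z. v = emb (line_map u w (x + z, y + z, scl z 1)) 0)"
      unfolding Amb.V.span_3 gen by blast
    also have "\<dots> \<longleftrightarrow> (\<exists>a b c. v = emb (line_map u w (a, b, scl c 1)) 0)"
      by (metis diff_add_cancel)
    finally show ?thesis .
  qed
  have "C = {chain_point u w a b | a b. a \<noteq> 0 \<or> b \<noteq> 0}"
  proof (intro equalityI subsetI)
    fix x assume "x \<in> C"
    then have xQ: "x \<in> Q" "x \<in> points s\<^sub>A E" unfolding E(3) by blast+
    obtain p where p: "p \<noteq> 0" "hprod m p = 0" "x = point_F p" using xQ(1) Q[of x] by blast
    have p4: "point_F p \<in> points s\<^sub>A E" using xQ(2) p(3) by simp
    obtain \<gamma> \<delta> where gd: "p = rmul u \<gamma> + rmul w \<delta>" using frameD(10)[OF fr] p(2) by blast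
    have "emb (rho p) 0 \<in> E"
      using p4 unfolding point_F_def by (simp add: Amb.V.span_singleton_in_points_iff[OF sE])
    then obtain a b c where "emb (rho p) 0 = emb (line_map u w (a, b, scl c 1)) 0" using vecE by blast
    then have "line_map u w (N \<gamma>, N \<delta>, \<gamma> * cnj \<delta>) = line_map u w (a, b, scl c 1)"
      by (simp add: gd rho_combination)
    \<comment> \<open>Multiplying by \<open>\<delta>\<close> from the right turns this into:
      \<open>\<gamma>\<close> is a scalar multiple of \<open>\<delta>\<close>, unless
      \<open>\<delta> = 0\<close>.\<close>
    then have c: "\<gamma> * cnj \<delta> = scl c 1" using line_map_inject[OF fr] by blast
    show "x \<in> {chain_point u w a b | a b. a \<noteq> 0 \<or> b \<noteq> 0}"
    proof (cases "\<delta> = 0")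
      case True
      then have "p = rmul (rmul u (scl 1 1) + rmul w (scl 0 1)) \<gamma>" by (simp add: gd)
      then have "x = chain_point u w 1 0"
        using point_F_eq_iff[OF chain_vector_nonzero[OF fr, of 1 0] p(1)] unfolding chain_point_def p(3) by auto
      then show ?thesis by force
    next
      case False
      have "scl (N \<delta>) \<gamma> = \<gamma> * cnj \<delta> * \<delta>" by (simp add: mult.assoc cnj_mult_self)
      then have "scl (inverse (N \<delta>)) (scl (N \<delta>) \<gamma>) = scl (inverse (N \<delta>)) (scl c \<delta>)" unfolding c by simp
      then have "\<gamma> = scl (c / N \<delta>) \<delta>" using False by (simp add: divide_inverse mult.commute)
      then have "p = rmul (rmul u (scl (c / N \<delta>) 1) + rmul w (scl 1 1)) \<delta>" by (simp add: gd rmul_add)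
      then have "x = chain_point u w (c / N \<delta>) 1"
        using point_F_eq_iff[OF chain_vector_nonzero[OF fr, of "c / N \<delta>" 1] p(1)] unfolding chain_point_def p(3) by auto
      then show ?thesis by force
    qed
  next
    fix x assume "x \<in> {chain_point u w a b | a b. a \<noteq> 0 \<or> b \<noteq> 0}"
    then obtain a b where ab: "x = chain_point u w a b" "a \<noteq> 0 \<or> b \<noteq> 0" by blast
    define p where "p = rmul u (scl a 1) + rmul w (scl b 1)"
    have p: "p \<noteq> 0" "hprod m p = 0" "x = point_F p"
      using chain_vector_nonzero[OF fr ab(2)] ab(1) frameD(11,12)[OF fr]
      by (simp_all add: p_def chain_point_def hprod_add_right hprod_rmul_right)
    have "rho p = line_map u w (a\<^sup>2, b\<^sup>2, scl (a * b) 1)"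
      unfolding p_def rho_combination by (simp add: N_scl cnj_scl mult.commute)
    then have "emb (rho p) 0 \<in> E" unfolding vecE by metis
    then have "x \<in> points s\<^sub>A E"
      unfolding p(3) point_F_def using rho_nonzero[OF p(1)] by (simp add: Amb.V.span_singleton_in_points_iff[OF sE])
    then show "x \<in> C" unfolding E(3) using Q p by blast
  qed
  then show thesis using that fr by blast
qed

text \<open>A linear change of coordinates over K moves any three points of the chain to the
  parameters \<open>(1, 0)\<close>, \<open>(0, 1)\<close>, \<open>(1, 1)\<close> and leaves the
  chain as a set unchanged.\<close>

lemma chain_rebase:
  assumes f: "frame m u w t t'" and C: "C = {chain_point u w a b | a b. a \<noteq> 0 \<or> b \<noteq> 0}"
    and p: "p1 \<in> C" "p2 \<in> C" "p3 \<in> C" and ne: "p1 \<noteq> p2" "p1 \<noteq> p3" "p2 \<noteq> p3"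
  obtains u' w' t1 t1' where "frame m u' w' t1 t1'" "C = {chain_point u' w' a b | a b. a \<noteq> 0 \<or> b \<noteq> 0}"
    "p1 = chain_point u' w' 1 0" "p2 = chain_point u' w' 0 1" "p3 = chain_point u' w' 1 1"
proof -
  obtain a1 b1 where 1: "p1 = chain_point u w a1 b1" "a1 \<noteq> 0 \<or> b1 \<noteq> 0" using p(1) C by blast
  obtain a2 b2 where 2: "p2 = chain_point u w a2 b2" "a2 \<noteq> 0 \<or> b2 \<noteq> 0" using p(2) C by blast
  obtain a3 b3 where 3: "p3 = chain_point u w a3 b3" "a3 \<noteq> 0 \<or> b3 \<noteq> 0" using p(3) C by blast
  define D where "D = a1 * b2 - a2 * b1"
  have D: "D \<noteq> 0" using ne(1) chain_point_eq_iff[OF f 1(2) 2(2)] 1(1) 2(1) by (auto simp: D_def)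
  \<comment> \<open>Cramer's rule for writing the third parameter pair as a combination of the first
    two; neither coefficient is zero because the points are distinct.\<close>
  define x y where "x = (a3 * b2 - a2 * b3) / D" and "y = (a1 * b3 - a3 * b1) / D"
  have x0: "x \<noteq> 0" using ne(3) chain_point_eq_iff[OF f 2(2) 3(2)] 2(1) 3(1) D by (auto simp: x_def)
  have y0: "y \<noteq> 0" using ne(2) chain_point_eq_iff[OF f 1(2) 3(2)] 1(1) 3(1) D by (auto simp: y_def)
  have xy: "x * a1 + y * a2 = a3" "x * b1 + y * b2 = b3"
  proof -
    have "D * (x * a1 + y * a2) = D * a3" "D * (x * b1 + y * b2) = D * b3"
      using D by (simp_all add: x_def y_def distrib_left) (simp_all add: D_def algebra_simps)
    then show "x * a1 + y * a2 = a3" "x * b1 + y * b2 = b3" using D by simp_all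
  qed
  define u' w' where "u' = rmul u (scl (x * a1) 1) + rmul w (scl (x * b1) 1)"
    and "w' = rmul u (scl (y * a2) 1) + rmul w (scl (y * b2) 1)"
  have conv: "chain_point u' w' a b = chain_point u w (a * x * a1 + b * y * a2) (a * x * b1 + b * y * b2)" for a b
    unfolding chain_point_def u'_def w'_def
    by (rule arg_cong[of _ _ point_F]) (simp add: rmul_add rmul_add_right B.scale_left_distrib algebra_simps)
  have cp_scale: "chain_point u w (k * a) (k * b) = chain_point u w a b" if "k \<noteq> 0" "a \<noteq> 0 \<or> b \<noteq> 0" for k a b
    using chain_point_eq_iff[OF f, of "k * a" "k * b" a b] that by (simp add: algebra_simps)
  have u'0: "u' \<noteq> 0" unfolding u'_def by (rule chain_vector_nonzero[OF f]) (use x0 1 in auto)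
  have w'0: "w' \<noteq> 0" unfolding w'_def by (rule chain_vector_nonzero[OF f]) (use y0 2 in auto)
  have m: "hprod m u' = 0" "hprod m w' = 0"
    by (simp_all add: u'_def w'_def hprod_add_right hprod_rmul_right frameD[OF f])
  have pf: "p1 = chain_point u' w' 1 0" "p2 = chain_point u' w' 0 1" "p3 = chain_point u' w' 1 1"
    unfolding conv 1(1) 2(1) 3(1) using cp_scale[OF x0 1(2)] cp_scale[OF y0 2(2)] xy by simp_all
  have "\<nexists>r. w' = rmul u' r"
  proof
    assume "\<exists>r. w' = rmul u' r"
    then have "point_F u' = point_F w'" using point_F_eq_iff[OF u'0 w'0] by blast
    then show False using pf ne(1) by (simp add: chain_point_def)
  qed
  then obtain t1 t1' where f': "frame m u' w' t1 t1'" using frame_of_points[OF frameD(1)[OF f] m(1) u'0 m(2)] by blast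
  have "C = {chain_point u' w' a b | a b. a \<noteq> 0 \<or> b \<noteq> 0}"
  proof (intro equalityI subsetI)
    fix z assume "z \<in> C"
    then obtain c e where z: "z = chain_point u w c e" "c \<noteq> 0 \<or> e \<noteq> 0" using C by blast
    \<comment> \<open>Cramer's rule again, now for the rescaled pairs \<open>x (a1, b1)\<close> and
      \<open>y (a2, b2)\<close>.\<close>
    define a b where "a = (c * b2 - a2 * e) / (D * x)" and "b = (a1 * e - c * b1) / (D * y)"
    have ax: "a * x = (c * b2 - a2 * e) / D" "b * y = (a1 * e - c * b1) / D"
      using x0 y0 by (simp_all add: a_def b_def)
    have "D * (a * x * a1 + b * y * a2) = D * c" "D * (a * x * b1 + b * y * b2) = D * e"
      using D by (simp_all add: ax distrib_left) (simp_all add: D_def algebra_simps)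
    then have ce: "a * x * a1 + b * y * a2 = c" "a * x * b1 + b * y * b2 = e" using D by simp_all
    have "z = chain_point u' w' a b" unfolding conv ce z(1) ..
    moreover have "a \<noteq> 0 \<or> b \<noteq> 0" using ce z(2) by auto
    ultimately show "z \<in> {chain_point u' w' a b | a b. a \<noteq> 0 \<or> b \<noteq> 0}" by blast
  next
    fix z assume "z \<in> {chain_point u' w' a b | a b. a \<noteq> 0 \<or> b \<noteq> 0}"
    then obtain a b where z: "z = chain_point u' w' a b" "a \<noteq> 0 \<or> b \<noteq> 0" by blast
    define c e where "c = a * x * a1 + b * y * a2" and "e = a * x * b1 + b * y * b2"
    have "a * x * D = c * b2 - a2 * e" "b * y * D = a1 * e - c * b1"
      by (simp_all add: D_def c_def e_def algebra_simps)
    then have "c \<noteq> 0 \<or> e \<noteq> 0" using z(2) x0 y0 D by auto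
    then show "z \<in> C" unfolding C z(1) conv c_def[symmetric] e_def[symmetric] by blast
  qed
  then show thesis using that f' pf by blast
qed

text \<open>With the first three points at \<open>(1, 0)\<close>, \<open>(0, 1)\<close>,
  \<open>(1, 1)\<close>, the fourth has parameters \<open>(r0, 1)\<close>. Its polar block cuts
  \<open>W\<close> in the regulus member with the same parameters, so each of the two cross-ratios
  holds for \<open>r0\<close> and for no other value.\<close>

lemma linear_duality_F:
  "linear_duality s\<^sub>A (d - 1) Y\<^sub>A {point_F p | p. p \<noteq> 0} {line_F m | m. m \<noteq> 0} vertices blocks \<chi> \<chi>'"
  unfolding linear_duality_def
proof (intro conjI ballI allI impI)
  show "is_duality {point_F p | p. p \<noteq> 0} {line_F m | m. m \<noteq> 0} vertices blocks \<chi> \<chi>'" by (rule duality)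
  fix \<xi> W assume "\<xi> \<in> {line_F m | m. m \<noteq> 0}" and W0: "complement_in s\<^sub>A Y\<^sub>A (\<chi>' \<xi>) W"
  then obtain m where m: "m \<noteq> 0" "\<xi> = line_F m" by blast
  have \<chi>': "\<chi>' \<xi> = range (\<eta> m)" using \<chi>'_line_F m by simp
  have W: "complement_in s\<^sub>A Y\<^sub>A (range (\<eta> m)) W" using W0 \<chi>' by simp
  show "regular_spread_line s\<^sub>A (d - 1) W {b \<inter> W | b. b \<in> blocks \<and> \<chi>' \<xi> \<subseteq> b}"
    unfolding \<chi>' by (rule regular_spread_quotient[OF m(1) W])
  fix C assume "C \<in> conics_of s\<^sub>A \<xi> ({point_F p | p. p \<noteq> 0} \<inter> points s\<^sub>A \<xi>)"
  then obtain u w t t' where f: "frame m u w t t'" and C: "C = {chain_point u w a b | a b. a \<noteq> 0 \<or> b \<noteq> 0}"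
    using conic_is_chain[OF m(1)] unfolding m(2) by blast
  have member: "\<chi> (chain_point u w a b) \<inter> W = Amb.\<kappa>_member \<phi> a b"
    if f: "frame m u w t t'" and \<phi>: "Vector_Spaces.linear scl2 s\<^sub>A \<phi>" "inj \<phi>" "range \<phi> = W"
      "\<And>z. \<exists>\<tau>. \<phi> z = emb 0 \<tau> \<and> hprod u \<tau> = snd z \<and> hprod w \<tau> = - fst z"
      and ab: "a \<noteq> 0 \<or> b \<noteq> 0" for u w t t' \<phi> a b
    unfolding chain_point_def \<chi>_point_F[OF chain_vector_nonzero[OF f ab]]
    by (rule block_Int_member[OF \<phi> ab])
  obtain \<phi> where \<phi>: "Vector_Spaces.linear scl2 s\<^sub>A \<phi>" "inj \<phi>" "range \<phi> = W"
    "\<And>z. \<exists>\<tau>. \<phi> z = emb 0 \<tau> \<and> hprod u \<tau> = snd z \<and> hprod w \<tau> = - fst z"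
    using quotient_chart[OF f W] by blast
  have "(\<lambda>x. \<chi> x \<inter> W) ` C = {\<chi> (chain_point u w a b) \<inter> W | a b. a \<noteq> 0 \<or> b \<noteq> 0}" unfolding C by blast
  also have "\<dots> = {Amb.\<kappa>_member \<phi> a b | a b. a \<noteq> 0 \<or> b \<noteq> 0}"
    by (rule Collect_cong) (metis member[OF f \<phi>])
  finally show "is_regulus s\<^sub>A (d - 1) W ((\<lambda>x. \<chi> x \<inter> W) ` C)"
    using Amb.is_regulus_members[OF \<phi>(1,2)] \<phi>(3) by simp
  fix p1 p2 p3 p4 r assume p: "p1 \<in> C" "p2 \<in> C" "p3 \<in> C" "p4 \<in> C" and ds: "distinct [p1, p2, p3, p4]"
  have ne: "p1 \<noteq> p2" "p1 \<noteq> p3" "p2 \<noteq> p3" using ds by auto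
  obtain u' w' t1 t1' where f': "frame m u' w' t1 t1'" and C': "C = {chain_point u' w' a b | a b. a \<noteq> 0 \<or> b \<noteq> 0}"
    and p': "p1 = chain_point u' w' 1 0" "p2 = chain_point u' w' 0 1" "p3 = chain_point u' w' 1 1"
    by (rule chain_rebase[OF f C p(1-3) ne])
  obtain a b where ab: "p4 = chain_point u' w' a b" "a \<noteq> 0 \<or> b \<noteq> 0" using p(4) C' by blast
  have d4: "p1 \<noteq> p4" "p2 \<noteq> p4" "p3 \<noteq> p4" using ds by auto
  have cpe: "chain_point u' w' a1 b1 = chain_point u' w' a2 b2 \<longleftrightarrow> a1 * b2 = a2 * b1"
    if "a1 \<noteq> 0 \<or> b1 \<noteq> 0" "a2 \<noteq> 0 \<or> b2 \<noteq> 0" for a1 b1 a2 b2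
    by (rule chain_point_eq_iff[OF f' that])
  have b0: "b \<noteq> 0" using d4(1) ab cpe[of 1 0 a b] unfolding p' by simp
  define r0 where "r0 = a / b"
  have p4: "p4 = chain_point u' w' r0 1" unfolding ab(1) using cpe[of a b r0 1] b0 ab(2) by (simp add: r0_def)
  have r0: "r0 \<noteq> 0" "r0 \<noteq> 1" using d4(2,3) cpe[of 0 1 r0 1] cpe[of 1 1 r0 1] unfolding p' p4 by auto
  have "conic_cross_ratio s\<^sub>A C p1 p2 p3 p4 r \<longleftrightarrow> r = r0"
  proof -
    let ?e1 = "emb (rho u') 0" and ?e2 = "emb (herm u' w' 1) 0" and ?e3 = "emb (rho w') 0"
    have i: "card {?e1, ?e2, ?e3} = 3" "Amb.V.independent {?e1, ?e2, ?e3}"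
      using conic_vectors_independent[OF f'] by blast+
    have Cc: "C = (\<lambda>z. Amb.V.span {conic_vector s\<^sub>A ?e1 ?e2 ?e3 z}) ` (UNIV - {0})"
      unfolding C' chain_point_conic_vector by (auto simp: zero_prod_def image_iff)
    have pp: "p1 = Amb.V.span {?e1}" "p2 = Amb.V.span {?e3}" "p3 = Amb.V.span {?e1 + ?e2 + ?e3}"
      "p4 = Amb.V.span {s\<^sub>A (r0\<^sup>2) ?e1 + s\<^sub>A r0 ?e2 + ?e3}"
      unfolding p' p4 chain_point_conic_vector by (simp_all add: conic_vector_def)
    show ?thesis unfolding pp by (rule Amb.V.conic_cross_ratio_iff[OF i Cc r0])
  qed
  moreover have "regulus_cross_ratio s\<^sub>A (\<chi> p1 \<inter> W) (\<chi> p2 \<inter> W) (\<chi> p3 \<inter> W) (\<chi> p4 \<inter> W) r \<longleftrightarrow> r = r0"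
  proof -
    \<comment> \<open>The chart of the quotient depends on the frame, so the rebased points need a
      new chart of the same \<open>W\<close>.\<close>
    obtain \<phi>' where \<phi>': "Vector_Spaces.linear scl2 s\<^sub>A \<phi>'" "inj \<phi>'" "range \<phi>' = W"
      "\<And>z. \<exists>\<tau>. \<phi>' z = emb 0 \<tau> \<and> hprod u' \<tau> = snd z \<and> hprod w' \<tau> = - fst z"
      using quotient_chart[OF f' W] by blast
    have mem: "\<chi> (chain_point u' w' a b) \<inter> W = Amb.\<kappa>_member \<phi>' a b" if "a \<noteq> 0 \<or> b \<noteq> 0" for a b
      by (rule member[OF f' \<phi>' that])
    show ?thesis unfolding p' p4 using Amb.regulus_cross_ratio_iff[OF \<phi>'(1,2) r0(1)] by (simp add: mem)
  qed
  ultimately show "conic_cross_ratio s\<^sub>A C p1 p2 p3 p4 r \<longleftrightarrow>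
    regulus_cross_ratio s\<^sub>A (\<chi> p1 \<inter> W) (\<chi> p2 \<inter> W) (\<chi> p3 \<inter> W) (\<chi> p4 \<inter> W) r" by simp
qed

end

theorem corollary4p2:
  fixes scl :: "'k::field \<Rightarrow> 'b::ring_1 \<Rightarrow> 'b"
    and T N :: "'b \<Rightarrow> 'k"
    and d v :: nat
    and s :: "'k \<Rightarrow> ('k, 'b \<times> 'b) ambient \<Rightarrow> ('k, 'b \<times> 'b) ambient"
    and X \<Xi> S \<B> :: "('k, 'b \<times> 'b) ambient set set"
  assumes "quadratic_division_algebra scl T N"
    and "has_dimension scl d UNIV"
    and "v = d - 1"
    and "s = ambient_scale (CD_zero scl T)"
    and "(X, \<Xi>) = veronese (CD_zero scl T)"
    and "S = {V. \<exists>\<xi>\<in>\<Xi>. is_vertex s X \<xi> V}"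
    and "\<B> = {b. n_space s (2 * v + 1) b \<and>
                  (\<exists>V\<^sub>1\<in>S. \<exists>V\<^sub>2\<in>S. V\<^sub>1 \<noteq> V\<^sub>2 \<and> b = module.span s (V\<^sub>1 \<union> V\<^sub>2))}"
  shows "module.span s (\<Union>X) = UNIV \<and> n_space s (6 * d + 2) (UNIV :: ('k, 'b \<times> 'b) ambient set) \<and>
    (\<forall>\<xi>\<in>\<Xi>. \<exists>!V. is_vertex s X \<xi> V) \<and>
    (\<forall>V\<in>S. n_space s (d - 1) V) \<and>
    (\<exists>Y. regular_spread_plane s v Y S \<and>
      (\<exists>F X' \<Xi>'. complement_in s UNIV Y F \<and>
        X' = induced_points s X F \<and> \<Xi>' = induced_lines s X \<Xi> F \<and>
        projectively_equivalent s F (X', \<Xi>')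
          (ambient_scale (base_algebra scl T)) UNIV (veronese (base_algebra scl T)) \<and>
        projective_plane S \<B> \<and>
        isomorphic_geometries S \<B> (pg2_points :: ('b \<times> 'b \<times> 'b) set set) pg2_lines \<and>
        (\<exists>\<chi> \<chi>'. linear_duality s v Y X' \<Xi>' S \<B> \<chi> \<chi>' \<and>
          X = (\<Union>x'\<in>X'. points s (module.span s (x' \<union> \<chi> x')) - points s (\<chi> x')))))"
proof -
  interpret quadratic_algebra_dim scl T N d
    using assms(1,2) by unfold_locales
  have X: "X = X\<^sub>A" and \<Xi>: "\<Xi> = \<Xi>\<^sub>A" using assms(5)[symmetric] by simp_all
  note s = assms(4) and v = assms(3)
  have S: "S = vertices" unfolding assms(6) X \<Xi> s by (rule vertices_eq)
  have B: "\<B> = blocks" unfolding assms(7) S s v by (rule blocks_eq)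
  show ?thesis
    unfolding X \<Xi> S B unfolding s v
  proof (intro conjI)
    show "Amb.V.span (\<Union> X\<^sub>A) = UNIV" by (rule span_X)
    show "n_space s\<^sub>A (6 * d + 2) UNIV" by (rule n_space_ambient)
    show "\<forall>\<xi>\<in>\<Xi>\<^sub>A. \<exists>!V. is_vertex s\<^sub>A X\<^sub>A \<xi> V" using unique_vertex by blast
    show "\<forall>V\<in>vertices. n_space s\<^sub>A (d - 1) V" using n_space_vertex by blast
    show "\<exists>Y. regular_spread_plane s\<^sub>A (d - 1) Y vertices \<and>
      (\<exists>F X' \<Xi>'. complement_in s\<^sub>A UNIV Y F \<and>
        X' = induced_points s\<^sub>A X\<^sub>A F \<and> \<Xi>' = induced_lines s\<^sub>A X\<^sub>A \<Xi>\<^sub>A F \<and>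
        projectively_equivalent s\<^sub>A F (X', \<Xi>') s\<^sub>0 UNIV (veronese (base_algebra scl T)) \<and>
        projective_plane vertices blocks \<and>
        isomorphic_geometries vertices blocks (pg2_points :: ('b \<times> 'b \<times> 'b) set set) pg2_lines \<and>
        (\<exists>\<chi> \<chi>'. linear_duality s\<^sub>A (d - 1) Y X' \<Xi>' vertices blocks \<chi> \<chi>' \<and>
          X\<^sub>A = (\<Union>x'\<in>X'. points s\<^sub>A (Amb.V.span (x' \<union> \<chi> x')) - points s\<^sub>A (\<chi> x'))))"
      by (rule exI[of _ Y\<^sub>A], rule conjI[OF regular_spread_vertices], rule exI[of _ F\<^sub>A],
          rule exI[of _ "{point_F p | p. p \<noteq> 0}"], rule exI[of _ "{line_F m | m. m \<noteq> 0}"],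
          intro conjI complement_Y_F induced_points_eq[symmetric] induced_lines_eq[symmetric]
            projectively_equivalent_base projective_plane_vertices isomorphic_pg2,
          rule exI[of _ \<chi>], rule exI[of _ \<chi>'], rule conjI[OF linear_duality_F X_union])
  qed
qed

end
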